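(* The functor $$(X,\mathcal{F})\longmapsto {}_{\mathcal{F}}C(X)$$ is a contravariant equivalence between the category of Tychonoff spaces equipped with functionally distinguished families of compact sets and the category of unital commutative pro-$C^*$-algebras.
   Context: A pro-$C^*$-algebra is a cofiltered limit of $C^*$-algebras in the category of topological $*$-algebras; equivalently, a complete Hausdorff topological $*$-algebra over $\mathbb{C}$ whose topology is generated by its continuous $C^*$-seminorms. Morphisms of unital commutative pro-$C^*$-algebras are continuous unital $*$-homomorphisms. A Tychonoff ($T_{3\frac12}$) space is a $T_1$ completely regular space. A family $\mathcal{F}$ of compact subsets of a topological space $X$ is functionally distinguished if it contains the singletons, is closed under taking compact subsets of its members, is closed under finite unions, and determines the continuous functions: a function $f:X\to\mathbb{R}$ is continuous if and only if $f|_F$ is continuous for all $F\in\mathcal{F}$. Objects of the first category are pairs $(X,\mathcal{F})$ with $X$ Tychonoff and $\mathcal{F}$ a functionally distinguished family of compact subsets of $X$; morphisms $(X,\mathcal{F})\to(Y,\mathcal{G})$ are continuous maps $f:X\to Y$ with $f(F)\in\mathcal{G}$ for all $F\in\mathcal{F}$. ${}_{\mathcal{F}}C(X)$ denotes the algebra of continuous $\mathbb{C}$-valued functions on $X$ with the topology of uniform convergence on members of $\mathcal{F}$; the functor acts on morphisms by precomposition. *)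

theory Defs
  imports "HOL-Analysis.Analysis" "HOL-Algebra.Module"
begin

(* HOL has no type of all sets, so the objects of a large category are spread over all types:
   an object is a structure carried by a subset of some type, and hom-sets, identities and
   compositions are defined between structures that may live on different types.
   Morphisms are extensional functions (undefined off the carrier), so that equality of
   morphisms is equality in HOL and composition is "compose" of HOL-Library.FuncSet. *)

section \<open>Tychonoff spaces with functionally distinguished families\<close>

definition Tychonoff_space :: "'a topology \<Rightarrow> bool" where
  "Tychonoff_space X \<longleftrightarrow> t1_space X \<and> completely_regular_space X"

(* The third clause includes the empty union, hence {} is always a member. This only matters
   for the empty space, where it makes { {} } the unique functionally distinguished family. *)
definition functionally_distinguished :: "'a topology \<Rightarrow> 'a set set \<Rightarrow> bool" where
  "functionally_distinguished X \<F> \<longleftrightarrow>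
     (\<forall>K\<in>\<F>. compactin X K) \<and>
     (\<forall>x\<in>topspace X. {x} \<in> \<F>) \<and>
     (\<forall>\<K>. finite \<K> \<and> \<K> \<subseteq> \<F> \<longrightarrow> \<Union>\<K> \<in> \<F>) \<and>
     (\<forall>K\<in>\<F>. \<forall>L. L \<subseteq> K \<and> compactin X L \<longrightarrow> L \<in> \<F>) \<and>
     (\<forall>f :: 'a \<Rightarrow> real.
        continuous_map X euclideanreal f \<longleftrightarrow>
        (\<forall>K\<in>\<F>. continuous_map (subtopology X K) euclideanreal f))"

type_synonym 'a fd_space = "'a topology \<times> 'a set set"

abbreviation points :: "'a fd_space \<Rightarrow> 'a set" where
  "points X \<equiv> topspace (fst X)"

definition fd_spaces :: "'a fd_space set" where
  "fd_spaces = {(X, \<F>). Tychonoff_space X \<and> functionally_distinguished X \<F>}"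

definition fd_hom :: "'a fd_space \<Rightarrow> 'b fd_space \<Rightarrow> ('a \<Rightarrow> 'b) set" where
  "fd_hom X Y =
     {f \<in> extensional (points X). continuous_map (fst X) (fst Y) f \<and> (\<forall>K\<in>snd X. f ` K \<in> snd Y)}"

definition fd_id :: "'a fd_space \<Rightarrow> 'a \<Rightarrow> 'a" where
  "fd_id X = (\<lambda>x\<in>points X. x)"

definition fd_iso :: "'a fd_space \<Rightarrow> 'b fd_space \<Rightarrow> ('a \<Rightarrow> 'b) set" where
  "fd_iso X Y =
     {f \<in> fd_hom X Y. \<exists>g \<in> fd_hom Y X.
        compose (points X) g f = fd_id X \<and> compose (points Y) f g = fd_id Y}"

lemma fd_spaces_subset_points:
  assumes "X \<in> fd_spaces" and "K \<in> snd X"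
  shows "K \<subseteq> points X"
proof -
  have "functionally_distinguished (fst X) (snd X)"
    using assms(1) by (simp add: fd_spaces_def case_prod_unfold)
  then have "compactin (fst X) K"
    using assms(2) unfolding functionally_distinguished_def by blast
  then show ?thesis by (rule compactin_subset_topspace)
qed

lemma fd_id_in_hom:
  assumes X: "X \<in> fd_spaces"
  shows "fd_id X \<in> fd_hom X X"
proof -
  have "fd_id X ` K = K" if "K \<in> snd X" for K
    using fd_spaces_subset_points[OF X that] unfolding fd_id_def
    by (simp add: image_restrict_eq restrict_apply' subset_iff cong: image_cong)
  moreover have "continuous_map (fst X) (fst X) (fd_id X)"
    unfolding fd_id_def by (rule continuous_map_eq[OF continuous_map_id]) simp
  moreover have "fd_id X \<in> extensional (points X)"
    unfolding fd_id_def by (rule restrict_extensional)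
  ultimately show ?thesis by (simp add: fd_hom_def)
qed

lemma fd_compose_in_hom:
  assumes X: "X \<in> fd_spaces" and f: "f \<in> fd_hom X Y" and g: "g \<in> fd_hom Y Z"
  shows "compose (points X) g f \<in> fd_hom X Z"
proof -
  have "compose (points X) g f ` K = g ` f ` K" if "K \<in> snd X" for K
    unfolding image_image
    by (rule image_cong[OF refl]) (use fd_spaces_subset_points[OF X that] in \<open>auto simp: compose_eq\<close>)
  moreover have "continuous_map (fst X) (fst Z) (compose (points X) g f)"
    by (rule continuous_map_eq[OF continuous_map_compose[of _ "fst Y" f _ g]])
      (use f g in \<open>simp_all add: fd_hom_def compose_eq\<close>)
  ultimately show ?thesis using f g by (simp add: fd_hom_def)
qed


section \<open>Unital commutative pro-C*-algebras\<close>

definition complex_ring :: "complex ring" where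
  "complex_ring = \<lparr> carrier = UNIV, mult = (*), one = 1, zero = 0, add = (+) \<rparr>"

record 'a star_algebra = "(complex, 'a) module" +
  star :: "'a \<Rightarrow> 'a"
  topo :: "'a topology"

locale comm_star_algebra = algebra complex_ring A
  for A :: "'a star_algebra" (structure) +
  assumes star_closed: "x \<in> carrier A \<Longrightarrow> star A x \<in> carrier A"
    and star_star: "x \<in> carrier A \<Longrightarrow> star A (star A x) = x"
    and star_add: "x \<in> carrier A \<Longrightarrow> y \<in> carrier A \<Longrightarrow> star A (x \<oplus> y) = star A x \<oplus> star A y"
    and star_mult: "x \<in> carrier A \<Longrightarrow> y \<in> carrier A \<Longrightarrow> star A (x \<otimes> y) = star A y \<otimes> star A x"
    and star_smult: "x \<in> carrier A \<Longrightarrow> star A (c \<odot> x) = cnj c \<odot> star A x"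

locale topological_comm_star_algebra = comm_star_algebra +
  assumes topspace_topo: "topspace (topo A) = carrier A"
    and continuous_add: "continuous_map (prod_topology (topo A) (topo A)) (topo A) (\<lambda>(x, y). x \<oplus> y)"
    and continuous_mult: "continuous_map (prod_topology (topo A) (topo A)) (topo A) (\<lambda>(x, y). x \<otimes> y)"
    and continuous_smult: "continuous_map (prod_topology euclidean (topo A)) (topo A) (\<lambda>(c, x). c \<odot> x)"
    and continuous_star: "continuous_map (topo A) (topo A) (star A)"

definition cstar_seminorm :: "'a star_algebra \<Rightarrow> ('a \<Rightarrow> real) \<Rightarrow> bool" where
  "cstar_seminorm A p \<longleftrightarrow>
     (\<forall>x\<in>carrier A. 0 \<le> p x) \<and>
     (\<forall>c. \<forall>x\<in>carrier A. p (c \<odot>\<^bsub>A\<^esub> x) = cmod c * p x) \<and>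
     (\<forall>x\<in>carrier A. \<forall>y\<in>carrier A. p (x \<oplus>\<^bsub>A\<^esub> y) \<le> p x + p y) \<and>
     (\<forall>x\<in>carrier A. \<forall>y\<in>carrier A. p (x \<otimes>\<^bsub>A\<^esub> y) \<le> p x * p y) \<and>
     (\<forall>x\<in>carrier A. p (star A x \<otimes>\<^bsub>A\<^esub> x) = (p x)\<^sup>2)"

definition continuous_cstar_seminorm :: "'a star_algebra \<Rightarrow> ('a \<Rightarrow> real) \<Rightarrow> bool" where
  "continuous_cstar_seminorm A p \<longleftrightarrow>
     cstar_seminorm A p \<and> continuous_map (topo A) euclideanreal p"

(* Cauchy filters for the additive uniform structure of A. *)
definition cauchy_filter_in :: "'a star_algebra \<Rightarrow> 'a filter \<Rightarrow> bool" where
  "cauchy_filter_in A \<Phi> \<longleftrightarrow>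
     \<Phi> \<noteq> bot \<and> eventually (\<lambda>x. x \<in> carrier A) \<Phi> \<and>
     (\<forall>U. openin (topo A) U \<and> \<zero>\<^bsub>A\<^esub> \<in> U \<longrightarrow>
        (\<exists>S \<subseteq> carrier A. eventually (\<lambda>x. x \<in> S) \<Phi> \<and> (\<forall>x\<in>S. \<forall>y\<in>S. x \<ominus>\<^bsub>A\<^esub> y \<in> U)))"

locale comm_pro_cstar_algebra = topological_comm_star_algebra +
  assumes Hausdorff: "Hausdorff_space (topo A)"
    and complete: "cauchy_filter_in A \<Phi> \<Longrightarrow> \<exists>l. limitin (topo A) (\<lambda>x. x) l \<Phi>"
    and generated:
      "topo A = topology_generated_by
         {{y \<in> carrier A. p (y \<ominus> x) < r} |p x r.
            continuous_cstar_seminorm A p \<and> x \<in> carrier A \<and> 0 < r}"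

(* One = zero is allowed: the zero algebra is the algebra of the empty space. *)
definition pro_cstar_algebras :: "'a star_algebra set" where
  "pro_cstar_algebras = {A. comm_pro_cstar_algebra A}"

definition pro_cstar_hom :: "'a star_algebra \<Rightarrow> 'b star_algebra \<Rightarrow> ('a \<Rightarrow> 'b) set" where
  "pro_cstar_hom A B =
     {h \<in> extensional (carrier A) \<inter> ring_hom A B.
        (\<forall>c. \<forall>x\<in>carrier A. h (c \<odot>\<^bsub>A\<^esub> x) = c \<odot>\<^bsub>B\<^esub> h x) \<and>
        (\<forall>x\<in>carrier A. h (star A x) = star B (h x)) \<and>
        continuous_map (topo A) (topo B) h}"

definition pro_cstar_id :: "'a star_algebra \<Rightarrow> 'a \<Rightarrow> 'a" where
  "pro_cstar_id A = (\<lambda>x\<in>carrier A. x)"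

definition pro_cstar_iso :: "'a star_algebra \<Rightarrow> 'b star_algebra \<Rightarrow> ('a \<Rightarrow> 'b) set" where
  "pro_cstar_iso A B =
     {h \<in> pro_cstar_hom A B. \<exists>k \<in> pro_cstar_hom B A.
        compose (carrier A) k h = pro_cstar_id A \<and> compose (carrier B) h k = pro_cstar_id B}"

lemma pro_cstar_id_in_hom: "A \<in> pro_cstar_algebras \<Longrightarrow> pro_cstar_id A \<in> pro_cstar_hom A A"
proof -
  assume "A \<in> pro_cstar_algebras"
  then interpret comm_pro_cstar_algebra A by (simp add: pro_cstar_algebras_def)
  have c: "c \<odot>\<^bsub>A\<^esub> x \<in> carrier A" if "x \<in> carrier A" for c x
    using that smult_closed[of c x] by (simp add: complex_ring_def)
  have "continuous_map (topo A) (topo A) (pro_cstar_id A)"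
    unfolding pro_cstar_id_def
    by (rule continuous_map_eq[OF continuous_map_id]) (auto simp: topspace_topo)
  then show ?thesis
    by (auto simp: pro_cstar_hom_def pro_cstar_id_def ring_hom_def star_closed c)
qed

lemma pro_cstar_compose_in_hom:
  assumes A: "A \<in> pro_cstar_algebras"
    and h: "h \<in> pro_cstar_hom A B" and k: "k \<in> pro_cstar_hom B C"
  shows "compose (carrier A) k h \<in> pro_cstar_hom A C"
proof -
  interpret comm_pro_cstar_algebra A using A by (simp add: pro_cstar_algebras_def)
  have c: "c \<odot>\<^bsub>A\<^esub> x \<in> carrier A" if "x \<in> carrier A" for c x
    using that smult_closed[of c x] by (simp add: complex_ring_def)
  have "continuous_map (topo A) (topo C) (compose (carrier A) k h)"
    by (rule continuous_map_eq[OF continuous_map_compose[of _ "topo B" h _ k]])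
      (use h k in \<open>auto simp: pro_cstar_hom_def compose_def topspace_topo\<close>)
  then show ?thesis
    using h k
    by (auto simp: pro_cstar_hom_def ring_hom_def compose_def Pi_iff star_closed c)
qed


section \<open>The functor\<close>

(* The members of the family are compact, so the sets {g. ALL x:K. |g x - f x| < r} are the open
   balls of the sup-seminorm over K. *)
definition FC :: "'a fd_space \<Rightarrow> ('a \<Rightarrow> complex) star_algebra" where
  "FC X =
     (let C = {f \<in> extensional (points X). continuous_map (fst X) euclidean f} in
      \<lparr> carrier = C,
        mult = (\<lambda>f g. \<lambda>x\<in>points X. f x * g x),
        one = (\<lambda>x\<in>points X. 1),
        zero = (\<lambda>x\<in>points X. 0),
        add = (\<lambda>f g. \<lambda>x\<in>points X. f x + g x),
        smult = (\<lambda>c f. \<lambda>x\<in>points X. c * f x),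
        star = (\<lambda>f. \<lambda>x\<in>points X. cnj (f x)),
        topo = topology_generated_by
          {{g \<in> C. \<forall>x\<in>K. cmod (g x - f x) < r} |K f r. K \<in> snd X \<and> f \<in> C \<and> 0 < r} \<rparr>)"

definition FC_map ::
    "'a fd_space \<Rightarrow> 'b fd_space \<Rightarrow> ('a \<Rightarrow> 'b) \<Rightarrow> ('b \<Rightarrow> complex) \<Rightarrow> ('a \<Rightarrow> complex)" where
  "FC_map X Y f = (\<lambda>\<phi>\<in>carrier (FC Y). compose (points X) \<phi> f)"


section \<open>The quasi-inverse\<close>

(* A quasi-inverse functor is a family of maps over all types, which HOL cannot quantify
   existentially, so the spectrum is named explicitly. *)

definition complex_star_algebra :: "complex star_algebra" where
  "complex_star_algebra =
     \<lparr> carrier = UNIV, mult = (*), one = 1, zero = 0, add = (+), smult = (*), star = cnj,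
       topo = euclidean \<rparr>"

definition characters :: "'a star_algebra \<Rightarrow> ('a \<Rightarrow> complex) set" where
  "characters A = pro_cstar_hom A complex_star_algebra"

definition character_space :: "'a star_algebra \<Rightarrow> ('a \<Rightarrow> complex) topology" where
  "character_space A = subtopology (product_topology (\<lambda>_. euclidean) (carrier A)) (characters A)"

(* The topology is that of pointwise convergence; the family consists of the compact sets of
   characters dominated by a single continuous C*-seminorm (the equicontinuous compact sets). *)
definition Spec :: "'a star_algebra \<Rightarrow> ('a \<Rightarrow> complex) fd_space" where
  "Spec A =
     (character_space A,
      {K. compactin (character_space A) K \<and>
          (\<exists>p. continuous_cstar_seminorm A p \<and> (\<forall>\<omega>\<in>K. \<forall>a\<in>carrier A. cmod (\<omega> a) \<le> p a))})"

definition Spec_map ::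
    "'a star_algebra \<Rightarrow> 'b star_algebra \<Rightarrow> ('a \<Rightarrow> 'b) \<Rightarrow> ('b \<Rightarrow> complex) \<Rightarrow> ('a \<Rightarrow> complex)" where
  "Spec_map A B h = (\<lambda>\<omega>\<in>characters B. compose (carrier A) \<omega> h)"

definition point_evaluation :: "'a fd_space \<Rightarrow> 'a \<Rightarrow> ('a \<Rightarrow> complex) \<Rightarrow> complex" where
  "point_evaluation X = (\<lambda>x\<in>points X. \<lambda>\<phi>\<in>carrier (FC X). \<phi> x)"

definition Gelfand_transform :: "'a star_algebra \<Rightarrow> 'a \<Rightarrow> ('a \<Rightarrow> complex) \<Rightarrow> complex" where
  "Gelfand_transform A = (\<lambda>a\<in>carrier A. \<lambda>\<omega>\<in>characters A. \<omega> a)"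

end

theory Submission
  imports Defs
begin

text \<open>
  The heart of the matter is that a continuous \<open>C\<^sup>*\<close>-seminorm \<open>p\<close> is the supremum of \<open>\<bar>\<omega>\<bar>\<close> over the
  characters \<open>\<omega>\<close> dominated by \<open>p\<close>. To avoid completions of quotients, the character is found inside
  the algebra: given \<open>a\<close> with \<open>p a > 0\<close>, a minimal \<open>C\<^sup>*\<close>-seminorm below \<open>p\<close> among those with
  \<open>q (a x) = p a q x\<close> is multiplicative, so by the Gelfand--Mazur argument it is the modulus of a
  character. The characters dominated by \<open>p\<close> form a compact set, on which Stone--Weierstrass
  approximates every continuous function by Gelfand transforms; completeness of the algebra then
  turns a function that is continuous on all these compact sets into a Gelfand transform. This gives
  at once that they determine the continuous functions on the spectrum and that the Gelfand
  transform is onto. Conversely, a character of \<open>C(X)\<close> is dominated by the supremum over a member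
  \<open>K\<close> of the family, and compactness makes it the evaluation at a point of \<open>K\<close>.
\<close>

section \<open>\<open>C\<^sup>*\<close>-seminorms on commutative star algebras\<close>

text \<open>The same kind of topology comes in two presentations: by all continuous C*-seminorms for
  an abstract algebra, by sup-norms over the members of the family for \<open>FC X\<close>. They are
  reconciled by commutativity: all elements are normal, so
  \<open>p (x \<otimes> x) = (p x)\<^sup>2\<close> holds for every \<open>x\<close>, and a
  C*-seminorm bounded on a \<open>p\<close>-ball is already at most \<open>p\<close>, with constant
  1. Thus the continuous C*-seminorms on \<open>FC X\<close> are exactly those below the sup-norm
  over some member \<open>K\<close>. Since the characters below that sup-norm are the evaluations at
  points of \<open>K\<close>, the spectrum recovers the family and not only the space. The two
  completeness-like conditions mirror each other: completeness of an algebra makes the family on its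
  spectrum determine the continuous functions, and a family that determines the continuous functions
  makes \<open>FC X\<close> complete.\<close>

context comm_star_algebra
begin

lemma smult_carrier [simp, intro]: "x \<in> carrier A \<Longrightarrow> c \<odot> x \<in> carrier A"
  using smult_closed[of c x] by (simp add: complex_ring_def)

declare star_closed [simp, intro]

lemma smult_add_left: "x \<in> carrier A \<Longrightarrow> (a + b) \<odot> x = a \<odot> x \<oplus> b \<odot> x"
  using smult_l_distr[of a b x] by (simp add: complex_ring_def)

lemma smult_add_right:
  "x \<in> carrier A \<Longrightarrow> y \<in> carrier A \<Longrightarrow> a \<odot> (x \<oplus> y) = a \<odot> x \<oplus> a \<odot> y"
  using smult_r_distr[of a x y] by (simp add: complex_ring_def)

lemma smult_smult: "x \<in> carrier A \<Longrightarrow> a \<odot> (b \<odot> x) = (a * b) \<odot> x"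
  using smult_assoc1[of a b x] by (simp add: complex_ring_def)

lemma one_smult [simp]: "x \<in> carrier A \<Longrightarrow> 1 \<odot> x = x"
  using smult_one[of x] by (simp add: complex_ring_def)

lemma zero_smult [simp]: "x \<in> carrier A \<Longrightarrow> 0 \<odot> x = \<zero>"
  using smult_l_null[of x] by (simp add: complex_ring_def)

lemma smult_mult_left:
  "x \<in> carrier A \<Longrightarrow> y \<in> carrier A \<Longrightarrow> (c \<odot> x) \<otimes> y = c \<odot> (x \<otimes> y)"
  using smult_assoc2[of c x y] by (simp add: complex_ring_def)

lemma smult_mult_right:
  "x \<in> carrier A \<Longrightarrow> y \<in> carrier A \<Longrightarrow> x \<otimes> (c \<odot> y) = c \<odot> (x \<otimes> y)"
  by (metis smult_mult_left m_comm smult_carrier)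

lemma uminus_smult: "x \<in> carrier A \<Longrightarrow> \<ominus> x = (-1) \<odot> x"
proof -
  assume x: "x \<in> carrier A"
  have "(-1) \<odot> x \<oplus> x = (-1 + 1) \<odot> x" using x smult_add_left[of x "-1" 1] by simp
  then show ?thesis using x by (intro minus_equality) auto
qed

lemma star_one [simp]: "star A \<one> = \<one>"
proof -
  have "star A (star A \<one> \<otimes> \<one>) = star A \<one> \<otimes> star A (star A \<one>)" by (rule star_mult) auto
  then show ?thesis by (simp add: star_star)
qed

lemma star_uminus: "x \<in> carrier A \<Longrightarrow> star A (\<ominus> x) = \<ominus> star A x"
  by (simp add: uminus_smult star_smult)

lemma star_diff:
  "x \<in> carrier A \<Longrightarrow> y \<in> carrier A \<Longrightarrow> star A (x \<ominus> y) = star A x \<ominus> star A y"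
  by (simp add: a_minus_def star_add star_uminus)

lemma diff_add_diff:
  assumes "x \<in> carrier A" "y \<in> carrier A" "z \<in> carrier A"
  shows "(x \<ominus> y) \<oplus> (y \<ominus> z) = x \<ominus> z"
  using assms by (simp add: a_minus_def a_assoc r_neg1)

lemma diff_eq_zeroD:
  assumes "x \<in> carrier A" "y \<in> carrier A" "x \<ominus> y = \<zero>"
  shows "x = y"
proof -
  have "x = (x \<ominus> y) \<oplus> y" using assms(1,2) by (simp add: a_minus_def a_assoc l_neg)
  then show ?thesis using assms by simp
qed

lemma smult_diff_right:
  "x \<in> carrier A \<Longrightarrow> y \<in> carrier A \<Longrightarrow> c \<odot> (x \<ominus> y) = c \<odot> x \<ominus> c \<odot> y"
  by (simp add: a_minus_def smult_add_right uminus_smult smult_smult)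

lemma smult_diff_left:
  "x \<in> carrier A \<Longrightarrow> (b - c) \<odot> x = b \<odot> x \<ominus> c \<odot> x"
  by (simp add: a_minus_def uminus_smult smult_smult flip: smult_add_left)

end

locale cstar_seminormed = comm_star_algebra +
  fixes p
  assumes cstar_seminorm: "cstar_seminorm A p"
begin

lemma nonneg [simp]: "x \<in> carrier A \<Longrightarrow> 0 \<le> p x"
  and smult: "x \<in> carrier A \<Longrightarrow> p (c \<odot> x) = cmod c * p x"
  and add_le: "x \<in> carrier A \<Longrightarrow> y \<in> carrier A \<Longrightarrow> p (x \<oplus> y) \<le> p x + p y"
  and mult_le: "x \<in> carrier A \<Longrightarrow> y \<in> carrier A \<Longrightarrow> p (x \<otimes> y) \<le> p x * p y"
  and star_mult_self: "x \<in> carrier A \<Longrightarrow> p (star A x \<otimes> x) = (p x)\<^sup>2"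
  using cstar_seminorm by (auto simp: cstar_seminorm_def)

lemma zero [simp]: "p \<zero> = 0"
  using smult[of \<zero> 0] by simp

lemma uminus: "x \<in> carrier A \<Longrightarrow> p (\<ominus> x) = p x"
  by (simp add: uminus_smult smult)

lemma diff_le: "x \<in> carrier A \<Longrightarrow> y \<in> carrier A \<Longrightarrow> p (x \<ominus> y) \<le> p x + p y"
  using add_le[of x "\<ominus> y"] by (simp add: a_minus_def uminus)

lemma diff_commute: "x \<in> carrier A \<Longrightarrow> y \<in> carrier A \<Longrightarrow> p (x \<ominus> y) = p (y \<ominus> x)"
  using uminus[of "y \<ominus> x"] by (simp add: a_minus_def minus_add a_comm)

lemma diff_triangle:
  "x \<in> carrier A \<Longrightarrow> y \<in> carrier A \<Longrightarrow> z \<in> carrier A \<Longrightarrow> p (x \<ominus> z) \<le> p (x \<ominus> y) + p (y \<ominus> z)"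
  using add_le[of "x \<ominus> y" "y \<ominus> z"] by (simp add: diff_add_diff)

lemma le_diff_add: "x \<in> carrier A \<Longrightarrow> y \<in> carrier A \<Longrightarrow> p x \<le> p (x \<ominus> y) + p y"
  using diff_triangle[of x y \<zero>] by (simp add: a_minus_def)

lemma abs_diff_le:
  assumes "x \<in> carrier A" "y \<in> carrier A" shows "\<bar>p x - p y\<bar> \<le> p (x \<ominus> y)"
  using le_diff_add[OF assms] le_diff_add[OF assms(2,1)] diff_commute[OF assms] by linarith

text \<open>The C*-identity and submultiplicativity give
  \<open>(p y)\<^sup>2 \<le> p (star A y) * p y\<close>. Cancelling a nonzero \<open>p y\<close> and
  taking \<open>y\<close> to be \<open>x\<close> and then \<open>star A x\<close> gives both
  inequalities.\<close>

lemma star: assumes x: "x \<in> carrier A" shows "p (star A x) = p x"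
proof -
  have *: "p y \<le> p (star A y)" if y: "y \<in> carrier A" for y
  proof (cases "p y = 0")
    case False
    have "p y * p y \<le> p (star A y) * p y"
      using star_mult_self[OF y] mult_le[of "star A y" y] y by (simp add: power2_eq_square)
    then show ?thesis using False nonneg[OF y] by simp
  qed (use y in simp)
  show ?thesis using *[of x] *[of "star A x"] x by (simp add: star_star)
qed

text \<open>By commutativity \<open>x\<close> is normal: with
  \<open>?h = star A x \<otimes> x\<close>, the elements \<open>x \<otimes> x\<close> and
  \<open>?h\<close> have the same product with their own adjoints, so the C*-identity can be applied
  to \<open>x \<otimes> x\<close>, \<open>?h\<close> and \<open>x\<close>.\<close>

lemma square: assumes x: "x \<in> carrier A" shows "p (x \<otimes> x) = (p x)\<^sup>2"
proof -
  let ?h = "star A x \<otimes> x"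
  have "star A (x \<otimes> x) \<otimes> (x \<otimes> x) = star A ?h \<otimes> ?h"
    using x by (simp add: star_mult star_star m_ac)
  then have "(p (x \<otimes> x))\<^sup>2 = ((p x)\<^sup>2)\<^sup>2"
    using x star_mult_self[of "x \<otimes> x"] star_mult_self[of ?h] star_mult_self[of x] by simp
  then show ?thesis using x by (metis nonneg power2_eq_iff_nonneg zero_le_power2 m_closed)
qed

text \<open>Exponents are restricted to powers of two because they arise by repeated squaring; the
  limits taken later can be computed along this subsequence.\<close>

lemma power_two_power: "x \<in> carrier A \<Longrightarrow> p (x [^] ((2::nat) ^ k)) = p x ^ (2 ^ k)"
proof (induction k)
  case (Suc k)
  have "x [^] ((2::nat) ^ Suc k) = x [^] ((2::nat) ^ k) \<otimes> x [^] ((2::nat) ^ k)"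
    using Suc.prems by (simp add: nat_pow_mult mult_2)
  then show ?case using Suc square[of "x [^] ((2::nat) ^ k)"]
    by (simp add: power_mult[symmetric] mult.commute)
qed simp

text \<open>Powers turn a bound on a ball into domination: a \<open>C\<^sup>*\<close>-seminorm satisfies \<open>p (x\<^sup>2) = (p x)\<^sup>2\<close>.\<close>

lemma dominated:
  assumes q: "cstar_seminorm A q" and r: "0 < r"
    and bound: "\<And>x. x \<in> carrier A \<Longrightarrow> p x < r \<Longrightarrow> q x < C" and x: "x \<in> carrier A"
  shows "q x \<le> p x"
proof (rule ccontr)
  interpret q: cstar_seminormed A q by unfold_locales (rule q)
  assume "\<not> q x \<le> p x"
  then obtain s where s: "p x < s" "s < q x" using dense[of "p x" "q x"] by auto
  then have s0: "0 < s" using nonneg[OF x] by linarith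
  define y where "y = complex_of_real (1 / s) \<odot> x"
  have y: "y \<in> carrier A" "p y < 1" "1 < q y"
    using x s s0 by (simp_all add: y_def smult q.smult norm_divide)
  obtain n1 where n1: "p y ^ n1 < r" using real_arch_pow_inv[OF r y(2)] by blast
  obtain n2 where n2: "C < q y ^ n2" using real_arch_pow[OF y(3)] by blast
  define n where "n = max n1 n2"
  \<comment> \<open>\<open>power_two_power\<close> evaluates exponents of the form
    \<open>2 ^ n\<close>, so both thresholds are passed at one such exponent, using
    \<open>n < 2 ^ n\<close>.\<close>
  have n: "n1 \<le> 2 ^ n" "n2 \<le> 2 ^ n"
    using less_exp[of n] unfolding n_def by linarith+
  have "p y ^ (2 ^ n) < r"
    using power_decreasing[OF n(1), of "p y"] n1 y by simp
  moreover have "C < q y ^ (2 ^ n)"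
    using power_increasing[OF n(2), of "q y"] n2 y by linarith
  ultimately show False
    using bound[of "y [^] ((2::nat) ^ n)"] y(1) by (simp add: power_two_power q.power_two_power)
qed

end

section \<open>The commutative Gelfand--Naimark theorem for seminorms\<close>

text \<open>Each clause of \<open>cstar_seminorm\<close> is an equation or a weak inequality between
  continuous expressions in finitely many values of the seminorm, so it survives a pointwise limit.
  This supplies lower bounds of chains for Zorn's lemma.\<close>

lemma (in comm_star_algebra) cstar_seminorm_tendsto:
  assumes F: "F \<noteq> bot" and q: "eventually (\<lambda>i. cstar_seminorm A (q i)) F"
    and lim: "\<And>x. x \<in> carrier A \<Longrightarrow> ((\<lambda>i. q i x) \<longlongrightarrow> l x) F"
  shows "cstar_seminorm A l"
  unfolding cstar_seminorm_def
proof (intro conjI ballI allI)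
  have ev: "eventually (\<lambda>i. R (q i)) F" if "\<And>q. cstar_seminorm A q \<Longrightarrow> R q" for R
    using q by eventually_elim (rule that)
  fix x y c assume x: "x \<in> carrier A"
  show "0 \<le> l x"
    by (rule tendsto_lowerbound[OF lim[OF x] ev F]) (use x in \<open>auto simp: cstar_seminorm_def\<close>)
  have "eventually (\<lambda>i. q i (c \<odot> x) = cmod c * q i x) F"
    by (rule ev) (use x in \<open>auto simp: cstar_seminorm_def\<close>)
  from tendsto_cong[OF this] show "l (c \<odot> x) = cmod c * l x"
    using tendsto_unique[OF F lim] tendsto_mult_left[OF lim[OF x]] x by blast
  have "eventually (\<lambda>i. q i (star A x \<otimes> x) = (q i x)\<^sup>2) F"
    by (rule ev) (use x in \<open>auto simp: cstar_seminorm_def\<close>)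
  from tendsto_cong[OF this] show "l (star A x \<otimes> x) = (l x)\<^sup>2"
    using tendsto_unique[OF F lim[of "star A x \<otimes> x"]] tendsto_power[OF lim[OF x]] x by blast
  assume y: "y \<in> carrier A"
  show "l (x \<oplus> y) \<le> l x + l y"
    by (rule tendsto_le[OF F tendsto_add[OF lim[OF x] lim[OF y]] lim ev])
      (use x y in \<open>auto simp: cstar_seminorm_def\<close>)
  show "l (x \<otimes> y) \<le> l x * l y"
    by (rule tendsto_le[OF F tendsto_mult[OF lim[OF x] lim[OF y]] lim ev])
      (use x y in \<open>auto simp: cstar_seminorm_def\<close>)
qed

section \<open>Shrinking a seminorm towards the points where an element is largest\<close>

context cstar_seminormed
begin

text \<open>For the sup-norm over a nonempty compact set, this is the sup-norm over the part where
  the modulus of \<open>h\<close> is maximal: the normalised powers of \<open>h\<close> die out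
  elsewhere. Repeated shrinking of this kind aims at a single point, that is, at the modulus of a
  character. The value 0 off the carrier lets the pointwise order on functions compare values on the
  carrier alone.\<close>

definition shift :: "'a \<Rightarrow> 'a \<Rightarrow> real" where
  "shift h x = (if x \<in> carrier A then lim (\<lambda>n::nat. p (h [^] n \<otimes> x) / p h ^ n) else 0)"

text \<open>One more factor \<open>h\<close> costs at most \<open>p h\<close>, so the sequence
  decreases; its term at index 0 is \<open>p x\<close>.\<close>

lemma shift_tendsto_le:
  assumes h: "h \<in> carrier A" "0 < p h" and x: "x \<in> carrier A"
  shows "(\<lambda>n::nat. p (h [^] n \<otimes> x) / p h ^ n) \<longlonglongrightarrow> shift h x" and "shift h x \<le> p x"
proof -
  let ?X = "\<lambda>n::nat. p (h [^] n \<otimes> x) / p h ^ n"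
  have dec: "decseq ?X"
  proof (rule decseq_SucI)
    fix n
    have "h [^] Suc n \<otimes> x = h \<otimes> (h [^] n \<otimes> x)" using h x by (simp add: m_ac)
    then show "?X (Suc n) \<le> ?X n"
      using mult_le[of h "h [^] n \<otimes> x"] h x by (simp add: divide_simps mult.commute)
  qed
  have "\<forall>n. 0 \<le> ?X n" using h x by simp
  from decseq_convergent[OF dec this] obtain L where L: "?X \<longlonglongrightarrow> L" by blast
  then show *: "?X \<longlonglongrightarrow> shift h x" using x by (simp add: shift_def limI)
  show "shift h x \<le> p x" using decseq_ge[OF dec *, of 0] x by simp
qed

text \<open>Multiplying by \<open>h\<close> advances the sequence by one index, and the
  normalisation contributes the factor \<open>p h\<close>.\<close>

lemma shift_mult:
  assumes h: "h \<in> carrier A" "0 < p h" and x: "x \<in> carrier A"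
  shows "shift h (h \<otimes> x) = p h * shift h x"
proof (rule LIMSEQ_unique[OF shift_tendsto_le(1)[OF h]])
  have "p (h [^] n \<otimes> (h \<otimes> x)) / p h ^ n = p h * (p (h [^] Suc n \<otimes> x) / p h ^ Suc n)" for n :: nat
    using h x by (simp add: m_assoc)
  then show "(\<lambda>n::nat. p (h [^] n \<otimes> (h \<otimes> x)) / p h ^ n) \<longlonglongrightarrow> p h * shift h x"
    using LIMSEQ_Suc[OF shift_tendsto_le(1)[OF h x]] by (simp only: tendsto_mult_left)
qed (use h x in simp)

text \<open>An exact multiplier of \<open>p\<close> stays exact after a shift by another element, so
  a shift does not leave the set to which Zorn's lemma is applied.\<close>

lemma shift_mult_eq:
  assumes h: "h \<in> carrier A" "0 < p h" and a: "a \<in> carrier A" and x: "x \<in> carrier A"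
    and mult: "\<And>x. x \<in> carrier A \<Longrightarrow> p (a \<otimes> x) = \<alpha> * p x"
  shows "shift h (a \<otimes> x) = \<alpha> * shift h x"
proof (rule LIMSEQ_unique[OF shift_tendsto_le(1)[OF h]])
  have "p (h [^] n \<otimes> (a \<otimes> x)) / p h ^ n = \<alpha> * (p (h [^] n \<otimes> x) / p h ^ n)" for n :: nat
    using h a x mult[of "h [^] n \<otimes> x"] by (simp add: m_lcomm)
  then show "(\<lambda>n::nat. p (h [^] n \<otimes> (a \<otimes> x)) / p h ^ n) \<longlonglongrightarrow> \<alpha> * shift h x"
    using shift_tendsto_le(1)[OF h x] by (simp only: tendsto_mult_left)
qed (use a x in simp)

text \<open>The limit is already known to exist, so it may be computed along the exponents
  \<open>2 ^ k\<close>, where every term equals 1.\<close>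

lemma shift_one:
  assumes h: "h \<in> carrier A" "0 < p h"
  shows "shift h \<one> = 1"
proof (rule LIMSEQ_unique)
  have "strict_mono (\<lambda>k. (2::nat) ^ k)" by (simp add: strict_mono_def)
  from LIMSEQ_subseq_LIMSEQ[OF shift_tendsto_le(1)[OF h one_closed] this]
  show "(\<lambda>k. p (h [^] ((2::nat) ^ k)) / p h ^ (2 ^ k)) \<longlonglongrightarrow> shift h \<one>"
    using h by (simp add: o_def)
  show "(\<lambda>k. p (h [^] ((2::nat) ^ k)) / p h ^ (2 ^ k)) \<longlonglongrightarrow> 1"
    using h by (simp add: power_two_power)
qed

text \<open>The two product clauses compare different indices:
  \<open>h [^] (n + n) \<otimes> (x \<otimes> y)\<close> is the product of
  \<open>h [^] n \<otimes> x\<close> and \<open>h [^] n \<otimes> y\<close>, so even-indexed terms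
  are used for products. Self-adjointness of \<open>h\<close> makes the C*-identity applicable to
  \<open>h [^] n \<otimes> x\<close>.\<close>

lemma cstar_seminorm_shift:
  assumes h: "h \<in> carrier A" "star A h = h" "0 < p h"
  shows "cstar_seminorm A (shift h)"
proof -
  let ?X = "\<lambda>x n. p (h [^] (n::nat) \<otimes> x) / p h ^ n"
  note lim = shift_tendsto_le(1)[OF h(1,3)]
  have even: "(\<lambda>n. ?X x (n + n)) \<longlonglongrightarrow> shift h x" if "x \<in> carrier A" for x
    using LIMSEQ_subseq_LIMSEQ[OF lim[OF that], of "\<lambda>n. n + n"] by (simp add: o_def strict_mono_def)
  have double: "h [^] (n + n) \<otimes> (x \<otimes> y) = (h [^] n \<otimes> x) \<otimes> (h [^] n \<otimes> y)"
    if "x \<in> carrier A" "y \<in> carrier A" for n :: nat and x y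
    using h that by (simp add: nat_pow_mult[symmetric] m_ac)
  have star_pow: "star A (h [^] n) = h [^] n" for n :: nat
    by (induction n) (use h in \<open>simp_all add: star_mult nat_pow_Suc2 m_comm\<close>)
  show ?thesis
    unfolding cstar_seminorm_def
  proof (intro conjI ballI allI)
    fix x y c assume x: "x \<in> carrier A"
    show "0 \<le> shift h x"
      by (rule LIMSEQ_le_const[OF lim[OF x]]) (use h x in auto)
    have "?X (c \<odot> x) n = cmod c * ?X x n" for n
      using h x by (simp add: smult_mult_right smult)
    then have "?X (c \<odot> x) \<longlonglongrightarrow> cmod c * shift h x"
      using lim[OF x] by (simp only: tendsto_mult_left)
    with lim[of "c \<odot> x"] x show "shift h (c \<odot> x) = cmod c * shift h x"
      by (blast intro: LIMSEQ_unique)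
    have "?X (star A x \<otimes> x) (n + n) = (?X x n)\<^sup>2" for n
      using double[of "star A x" x n] star_mult_self[of "h [^] n \<otimes> x"] h x
      by (simp add: star_mult star_pow m_comm power_divide power_add flip: power2_eq_square)
    then have "(\<lambda>n. ?X (star A x \<otimes> x) (n + n)) \<longlonglongrightarrow> (shift h x)\<^sup>2"
      using lim[OF x] by (simp only: tendsto_power)
    with even[of "star A x \<otimes> x"] x show "shift h (star A x \<otimes> x) = (shift h x)\<^sup>2"
      by (blast intro: LIMSEQ_unique)
    assume y: "y \<in> carrier A"
    have "?X (x \<oplus> y) n \<le> ?X x n + ?X y n" for n
      using add_le[of "h [^] n \<otimes> x" "h [^] n \<otimes> y"] h x y
      by (simp add: r_distr divide_simps flip: add_divide_distrib)
    with x y show "shift h (x \<oplus> y) \<le> shift h x + shift h y"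
      by (intro LIMSEQ_le[OF lim tendsto_add[OF lim lim]]) auto
    have "?X (x \<otimes> y) (n + n) \<le> ?X x n * ?X y n" for n
      using mult_le[of "h [^] n \<otimes> x" "h [^] n \<otimes> y"] h x y double[of x y n]
      by (simp add: divide_simps power_add)
    with x y show "shift h (x \<otimes> y) \<le> shift h x * shift h y"
      by (intro LIMSEQ_le[OF even tendsto_mult[OF lim lim]]) auto
  qed
qed

text \<open>The shift is by \<open>?h = star A a \<otimes> a\<close>, which is self-adjoint even
  when \<open>a\<close> is not. By the C*-identity, the square of the value at
  \<open>a \<otimes> x\<close> is the value at \<open>?h \<otimes> (star A x \<otimes> x)\<close>,
  where \<open>shift_mult\<close> gives the factor \<open>p ?h = (p a)\<^sup>2\<close>.\<close>

lemma shift_self_mult: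
  assumes a: "a \<in> carrier A" "0 < p a" and x: "x \<in> carrier A"
  shows "shift (star A a \<otimes> a) (a \<otimes> x) = p a * shift (star A a \<otimes> a) x"
proof -
  let ?h = "star A a \<otimes> a"
  have h: "?h \<in> carrier A" "star A ?h = ?h" "0 < p ?h"
    using a by (simp_all add: star_mult star_star star_mult_self)
  interpret s: cstar_seminormed A "shift ?h" by unfold_locales (rule cstar_seminorm_shift[OF h])
  have "(shift ?h (a \<otimes> x))\<^sup>2 = shift ?h (?h \<otimes> (star A x \<otimes> x))"
    using s.star_mult_self[of "a \<otimes> x"] a x by (simp add: star_mult m_ac)
  also have "\<dots> = (p a * shift ?h x)\<^sup>2"
    using shift_mult[OF h(1,3), of "star A x \<otimes> x"] a x
    by (simp add: star_mult_self s.star_mult_self power_mult_distrib)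
  finally show ?thesis
    using a x by (simp add: power2_eq_iff_nonneg)
qed

text \<open>Zorn's lemma; a minimal element cannot be shrunk by \<open>shift\<close>, which forces multiplicativity.\<close>

lemma multiplicative_minorant:
  assumes a: "a \<in> carrier A" "0 < p a"
  obtains q where "cstar_seminorm A q" "q \<one> = 1" "q a = p a"
    "\<And>x. x \<in> carrier A \<Longrightarrow> q x \<le> p x"
    "\<And>x y. x \<in> carrier A \<Longrightarrow> y \<in> carrier A \<Longrightarrow> q (x \<otimes> y) = q x * q y"
proof -
  \<comment> \<open>With \<open>q \<one> = 1\<close>, the clause on \<open>a \<otimes> x\<close>
    yields \<open>q a = p a\<close>; unlike that single equation, it is inherited by shifts. The
    clause off the carrier makes a comparison of functions a comparison on the carrier.\<close>
  define S where "S = {q. cstar_seminorm A q \<and> q \<one> = 1 \<and>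
    (\<forall>x\<in>carrier A. q x \<le> p x \<and> q (a \<otimes> x) = p a * q x) \<and> (\<forall>x. x \<notin> carrier A \<longrightarrow> q x = 0)}"
  have shift_S: "cstar_seminormed.shift A q (star A b \<otimes> b) \<in> S"
    if "q \<in> S" and b: "b \<in> carrier A" "0 < q b" for q b
  proof -
    interpret q: cstar_seminormed A q using that(1) by unfold_locales (simp add: S_def)
    have h: "star A b \<otimes> b \<in> carrier A" "star A (star A b \<otimes> b) = star A b \<otimes> b" "0 < q (star A b \<otimes> b)"
      using b by (simp_all add: star_mult star_star q.star_mult_self)
    have "q.shift (star A b \<otimes> b) (a \<otimes> x) = p a * q.shift (star A b \<otimes> b) x" if "x \<in> carrier A" for x
      by (rule q.shift_mult_eq[OF h(1,3) a(1) that]) (use \<open>q \<in> S\<close> in \<open>simp add: S_def\<close>)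
    then show ?thesis
      using q.cstar_seminorm_shift[OF h] q.shift_one[OF h(1,3)] q.shift_tendsto_le(2)[OF h(1,3)] that(1)
      by (force simp: S_def q.shift_def)
  qed
  \<comment> \<open>\<open>p\<close> itself need not multiply exactly by \<open>a\<close>; its shift
    by \<open>star A a \<otimes> a\<close> does.\<close>
  have S_nonempty: "shift (star A a \<otimes> a) \<in> S"
  proof -
    have h: "star A a \<otimes> a \<in> carrier A" "star A (star A a \<otimes> a) = star A a \<otimes> a" "0 < p (star A a \<otimes> a)"
      using a by (simp_all add: star_mult star_star star_mult_self)
    show ?thesis
      using cstar_seminorm_shift[OF h] shift_one[OF h(1,3)] shift_tendsto_le(2)[OF h(1,3)]
        shift_self_mult[OF a]
      by (simp add: S_def shift_def)
  qed
  \<comment> \<open>Zorn's lemma for the reversed order: a maximal element there is a minimal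
    seminorm, and upper bounds of chains are pointwise infima.\<close>
  have "\<exists>m\<in>S. \<forall>q\<in>S. q \<le> m \<longrightarrow> q = m"
  proof (rule predicate_Zorn)
    show "partial_order_on S (relation_of (\<lambda>q q'. q' \<le> q) S)"
      by (rule partial_order_on_relation_ofI) auto
    fix C assume "C \<in> Chains (relation_of (\<lambda>q q'. q' \<le> q) S)"
    then have CS: "C \<subseteq> S" and chain: "\<And>q q'. q \<in> C \<Longrightarrow> q' \<in> C \<Longrightarrow> q \<le> q' \<or> q' \<le> q"
      by (auto simp: Chains_def relation_of_def)
    show "\<exists>u\<in>S. \<forall>q\<in>C. u \<le> q"
    proof (cases "C = {}")
      case False
      \<comment> \<open>The filter of lower tails of the chain. The pointwise infimum is a limit
        along it, so the clauses of \<open>S\<close> pass to the infimum as limits.\<close>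
      define F where "F = (INF q\<in>C. principal {q'\<in>C. q' \<le> q})"
      have ev: "eventually P F \<longleftrightarrow> (\<exists>q\<in>C. \<forall>q'\<in>C. q' \<le> q \<longrightarrow> P q')" for P
      proof -
        have "\<exists>x\<in>C. principal {q'\<in>C. q' \<le> x} \<le> inf (principal {q'\<in>C. q' \<le> q1}) (principal {q'\<in>C. q' \<le> q2})"
          if "q1 \<in> C" "q2 \<in> C" for q1 q2
          using chain[OF that] that
          by (elim disjE; intro bexI[of _ q1] bexI[of _ q2]) (auto intro: order_trans)
        from eventually_INF_base[OF False this] show ?thesis
          unfolding F_def by (auto simp: eventually_principal)
      qed
      have F: "F \<noteq> bot" by (auto simp: trivial_limit_def ev)
      have evS: "eventually (\<lambda>q. q \<in> S) F" using False CS by (auto simp: ev)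
      define u where "u x = (INF q\<in>C. q x)" for x
      have nn: "0 \<le> q x" if "q \<in> C" for q x
        using that CS by (cases "x \<in> carrier A") (auto simp: S_def cstar_seminorm_def)
      have bdd: "bdd_below ((\<lambda>q. q x) ` C)" for x using nn by (auto intro!: bdd_belowI2)
      have lower: "u \<le> q" if "q \<in> C" for q
        unfolding u_def by (rule le_funI) (rule cINF_lower[OF bdd that])
      have lim: "((\<lambda>q. q x) \<longlongrightarrow> u x) F" for x
      proof (rule order_tendstoI)
        fix r assume "r < u x"
        then have "r < q x" if "q \<in> C" for q
          using le_funD[OF lower[OF that], of x] by linarith
        then show "\<forall>\<^sub>F q in F. r < q x" using False by (auto simp: ev)
      next
        fix r assume "u x < r"
        then obtain q where "q \<in> C" "q x < r" using cInf_lessD[of "(\<lambda>q. q x) ` C" r] False by (auto simp: u_def)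
        then show "\<forall>\<^sub>F q in F. q x < r" unfolding ev by (meson le_funD le_less_trans)
      qed
      have 1: "cstar_seminorm A u"
        by (rule cstar_seminorm_tendsto[OF F _ lim]) (use evS in eventually_elim, simp add: S_def)
      have 2: "u \<one> = 1" "x \<notin> carrier A \<Longrightarrow> u x = 0" for x
        by (rule tendsto_unique[OF F lim tendsto_eventually], use evS in eventually_elim, simp add: S_def)+
      have 3: "u x \<le> p x" if x: "x \<in> carrier A" for x
        by (rule tendsto_upperbound[OF lim _ F]) (use evS in eventually_elim, simp add: S_def x)
      have 4: "u (a \<otimes> x) = p a * u x" if x: "x \<in> carrier A" for x
      proof (rule tendsto_unique[OF F lim])
        show "((\<lambda>q. q (a \<otimes> x)) \<longlongrightarrow> p a * u x) F"
        proof (rule Lim_transform_eventually[OF tendsto_mult_left[OF lim]])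
          show "\<forall>\<^sub>F q in F. p a * q x = q (a \<otimes> x)"
            using evS by eventually_elim (simp add: S_def x)
        qed
      qed
      have "u \<in> S" using 1 2 3 4 by (simp add: S_def)
      then show ?thesis using lower by blast
    qed (use S_nonempty in auto)
  qed
  then obtain m where m: "m \<in> S" and min: "\<And>q. q \<in> S \<Longrightarrow> q \<le> m \<Longrightarrow> q = m" by blast
  interpret m: cstar_seminormed A m using m by unfold_locales (simp add: S_def)
  have "m (x \<otimes> y) = m x * m y" if x: "x \<in> carrier A" and y: "y \<in> carrier A" for x y
  proof (cases "m x = 0")
    case True
    then show ?thesis using m.mult_le[OF x y] x y by (simp add: antisym)
  next
    case False
    then have pos: "0 < m x" using m.nonneg[OF x] by linarith
    let ?h = "star A x \<otimes> x"
    have h: "?h \<in> carrier A" "0 < m ?h" using x pos by (simp_all add: m.star_mult_self)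
    have "m.shift ?h \<le> m"
      using m.shift_tendsto_le(2)[OF h] m by (intro le_funI) (auto simp: m.shift_def S_def)
    then have "m.shift ?h = m" by (rule min[OF shift_S[OF m x pos]])
    then show ?thesis using m.shift_self_mult[OF x pos y] by simp
  qed
  moreover have "m (a \<otimes> \<one>) = p a * m \<one>" "m \<one> = 1" "\<And>x. x \<in> carrier A \<Longrightarrow> m x \<le> p x"
    using m by (simp_all add: S_def)
  ultimately show ?thesis
    using that[of m] m.cstar_seminorm a(1) by simp
qed

end

text \<open>
  Gelfand--Mazur without holomorphy: suppose \<open>p (x - z)\<close> has a positive minimum \<open>m\<close> over \<open>z\<close>, attained
  at \<open>z\<^sub>0\<close>. For \<open>y = x - z\<^sub>0\<close>, factoring \<open>y\<^bsup>N\<^esup> - z\<^bsup>N\<^esup>\<close> with \<open>N = 2\<^bsup>k\<^esup>\<close> into linear factors shows that the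
  minimum is attained on the whole disc of radius \<open>m\<close> around \<open>z\<^sub>0\<close>, hence everywhere.
\<close>

locale multiplicative_cstar_seminormed = cstar_seminormed +
  assumes one_eq: "p \<one> = 1"
    and mult_eq: "x \<in> carrier A \<Longrightarrow> y \<in> carrier A \<Longrightarrow> p (x \<otimes> y) = p x * p y"
begin

lemma scalar [simp]: "p (c \<odot> \<one>) = cmod c"
  by (simp add: smult one_eq)

lemma diff_squares:
  assumes y: "y \<in> carrier A"
  shows "p (y \<otimes> y \<ominus> (v * v) \<odot> \<one>) = p (y \<ominus> v \<odot> \<one>) * p (y \<ominus> (- v) \<odot> \<one>)"
proof -
  have "(y \<ominus> v \<odot> \<one>) \<otimes> (y \<ominus> (- v) \<odot> \<one>) = (y \<ominus> v \<odot> \<one>) \<otimes> (y \<oplus> v \<odot> \<one>)"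
    using y by (simp add: a_minus_def uminus_smult smult_smult)
  also have "\<dots> = (y \<otimes> y \<ominus> v \<odot> y) \<oplus> (v \<odot> y \<ominus> (v * v) \<odot> \<one>)"
    using y by (simp add: a_minus_def uminus_smult l_distr r_distr smult_mult_left smult_mult_right
        smult_smult smult_add_right a_ac)
  also have "\<dots> = y \<otimes> y \<ominus> (v * v) \<odot> \<one>"
    using y by (simp add: diff_add_diff)
  finally show ?thesis using y by (simp flip: mult_eq)
qed

context
  fixes y m
  assumes y: "y \<in> carrier A" and m: "0 < m" and lower: "\<And>w. m \<le> p (y \<ominus> w \<odot> \<one>)"
begin

text \<open>Subtracting \<open>w\<close> from the square of a power of \<open>y\<close> leaves a
  difference of squares, factored with \<open>csqrt w\<close> and its negative. The scalars change
  from step to step, so the induction has to treat all \<open>w\<close> at once.\<close>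

lemma power_diff_ge: "m ^ 2 ^ k \<le> p (y [^] ((2::nat) ^ k) \<ominus> w \<odot> \<one>)"
proof (induction k arbitrary: w)
  case (Suc k)
  have eq: "y [^] ((2::nat) ^ Suc k) = y [^] ((2::nat) ^ k) \<otimes> y [^] ((2::nat) ^ k)"
    using y by (simp add: nat_pow_mult mult_2)
  have "m ^ 2 ^ k * m ^ 2 ^ k \<le> p (y [^] ((2::nat) ^ k) \<ominus> csqrt w \<odot> \<one>) * p (y [^] ((2::nat) ^ k) \<ominus> (- csqrt w) \<odot> \<one>)"
    by (rule mult_mono[OF Suc Suc]) (use m y in auto)
  then show ?case
    using diff_squares[of "y [^] ((2::nat) ^ k)" "csqrt w"] y unfolding eq
    by (simp add: mult_2 power_add power2_csqrt flip: power2_eq_square)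
qed (use y lower in simp)

text \<open>Of the \<open>2 ^ k\<close> linear factors of the difference on the right, one is
  \<open>y \<ominus> z \<odot> \<one>\<close> and the others have value at least \<open>m\<close>.
  The additional \<open>m\<close> on both sides avoids the exponent \<open>2 ^ k - 1\<close>. In the
  induction, \<open>power_diff_ge\<close> bounds the whole second factor of the difference of
  squares.\<close>

lemma power_diff_power_ge:
  "p (y \<ominus> z \<odot> \<one>) * m ^ 2 ^ k \<le> m * p (y [^] ((2::nat) ^ k) \<ominus> (z ^ 2 ^ k) \<odot> \<one>)"
proof (induction k)
  case (Suc k)
  let ?y = "y [^] ((2::nat) ^ k)" and ?z = "z ^ 2 ^ k"
  have eq: "y [^] ((2::nat) ^ Suc k) = ?y \<otimes> ?y" "z ^ 2 ^ Suc k = ?z * ?z"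
    using y by (simp_all add: nat_pow_mult mult_2 power_add)
  have "(p (y \<ominus> z \<odot> \<one>) * m ^ 2 ^ k) * m ^ 2 ^ k \<le> (m * p (?y \<ominus> ?z \<odot> \<one>)) * p (?y \<ominus> (- ?z) \<odot> \<one>)"
    by (rule mult_mono[OF Suc power_diff_ge]) (use m y in auto)
  then show ?case
    using y unfolding eq by (simp add: diff_squares mult_2 power_add mult.assoc)
qed (use y in \<open>simp add: mult.commute\<close>)

text \<open>The triangle inequality bounds the difference of powers by
  \<open>m ^ 2 ^ k + cmod z ^ 2 ^ k\<close>. The value at \<open>z\<close> is thus at most
  \<open>m * (1 + ?t ^ 2 ^ k)\<close> with \<open>?t < 1\<close>, and \<open>k\<close> tends to
  infinity.\<close>

lemma minimum_on_disc:
  assumes attained: "p y = m" and z: "cmod z < m"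
  shows "p (y \<ominus> z \<odot> \<one>) = m"
proof (rule antisym)
  let ?t = "cmod z / m"
  have "p (y \<ominus> z \<odot> \<one>) \<le> m * (1 + ?t ^ 2 ^ k)" for k :: nat
  proof -
    have "p (y [^] ((2::nat) ^ k) \<ominus> (z ^ 2 ^ k) \<odot> \<one>) \<le> m ^ 2 ^ k + cmod z ^ 2 ^ k"
      using diff_le[of "y [^] ((2::nat) ^ k)" "(z ^ 2 ^ k) \<odot> \<one>"] y attained
      by (simp add: power_two_power norm_power)
    with power_diff_power_ge[of z k] m
    have "p (y \<ominus> z \<odot> \<one>) * m ^ 2 ^ k \<le> m * (m ^ 2 ^ k + cmod z ^ 2 ^ k)"
      by (meson mult_left_mono order_trans less_imp_le)
    then show ?thesis
      using m by (simp add: field_simps power_divide)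
  qed
  moreover have "(\<lambda>k::nat. m * (1 + ?t ^ 2 ^ k)) \<longlonglongrightarrow> m * (1 + 0)"
  proof (intro tendsto_intros)
    have "strict_mono (\<lambda>k. (2::nat) ^ k)" by (simp add: strict_mono_def)
    moreover have "(\<lambda>n. ?t ^ n) \<longlonglongrightarrow> 0" using m z by (intro LIMSEQ_realpow_zero) auto
    ultimately show "(\<lambda>k. ?t ^ 2 ^ k) \<longlonglongrightarrow> 0" by (auto dest: LIMSEQ_subseq_LIMSEQ simp: o_def)
  qed
  ultimately show "p (y \<ominus> z \<odot> \<one>) \<le> m"
    by (intro LIMSEQ_le_const) auto
qed (rule lower)

end

lemma Gelfand_Mazur:
  assumes x: "x \<in> carrier A"
  shows "\<exists>z. p (x \<ominus> z \<odot> \<one>) = 0"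
proof -
  let ?f = "\<lambda>z. p (x \<ominus> z \<odot> \<one>)"
  have shift: "(x \<ominus> a \<odot> \<one>) \<ominus> b \<odot> \<one> = x \<ominus> (a + b) \<odot> \<one>" for a b
    using x by (simp add: a_minus_def uminus_smult smult_smult a_assoc flip: smult_add_left)
  have lip: "\<bar>?f z - ?f w\<bar> \<le> cmod (z - w)" for z w
  proof -
    have "(x \<ominus> z \<odot> \<one>) \<ominus> (x \<ominus> w \<odot> \<one>) = (w - z) \<odot> \<one>"
    proof -
      have "(x \<ominus> z \<odot> \<one>) \<ominus> (x \<ominus> w \<odot> \<one>) = (\<ominus> (z \<odot> \<one>) \<oplus> w \<odot> \<one>) \<oplus> (x \<ominus> x)"
        using x by (simp add: a_minus_def minus_add a_ac)
      moreover have "x \<ominus> x = \<zero>" using x by (simp add: a_minus_def r_neg)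
      ultimately show ?thesis
        using x by (simp add: uminus_smult smult_smult flip: smult_add_left)
    qed
    then show ?thesis
      using abs_diff_le[of "x \<ominus> z \<odot> \<one>" "x \<ominus> w \<odot> \<one>"] x by (simp add: norm_minus_commute)
  qed
  have growth: "cmod z - p x \<le> ?f z" for z
    using diff_triangle[of "z \<odot> \<one>" x \<zero>] diff_commute[of "z \<odot> \<one>" x] x by (simp add: a_minus_def)
  have "continuous_on UNIV ?f"
  proof (rule continuous_onI)
    fix z :: complex and e :: real assume "0 < e"
    moreover have "dist (?f w) (?f z) \<le> e" if "dist w z < e" for w
      using lip[of w z] that unfolding dist_norm real_norm_def by linarith
    ultimately show "\<exists>d>0. \<forall>w\<in>UNIV. dist w z < d \<longrightarrow> dist (?f w) (?f z) \<le> e"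
      by blast
  qed
  \<comment> \<open>Outside the ball of radius \<open>2 * p x\<close>, \<open>growth\<close> gives
    values above \<open>p x\<close>, the value at 0, so a minimum over the ball is global.\<close>
  then have "continuous_on (cball 0 (2 * p x)) ?f" by (rule continuous_on_subset) simp
  moreover have "0 \<in> cball (0::complex) (2 * p x)" using nonneg[OF x] by simp
  ultimately obtain a where a: "\<And>z. z \<in> cball 0 (2 * p x) \<Longrightarrow> ?f a \<le> ?f z"
    using continuous_attains_inf[OF compact_cball, of 0 "2 * p x" ?f] by blast
  have min: "?f a \<le> ?f z" for z
  proof (cases "z \<in> cball 0 (2 * p x)")
    case False
    then show ?thesis using a[of 0] growth[of z] x by (simp add: a_minus_def)
  qed (rule a)
  have "?f a = 0"
  proof (rule ccontr)
    assume "?f a \<noteq> 0"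
    define m where "m = ?f a"
    have m: "0 < m" using \<open>?f a \<noteq> 0\<close> x by (simp add: m_def less_le)
    \<comment> \<open>A step of length \<open>m / 2\<close> stays inside the open disc of radius
      \<open>m\<close> around the previous point, so the minimum is attained again; walking on along
      the real direction contradicts \<open>growth\<close>.\<close>
    have along: "?f (a + of_real (n * (m / 2))) = m" for n :: nat
    proof (induction n)
      case (Suc n)
      let ?y = "x \<ominus> (a + of_real (n * (m / 2))) \<odot> \<one>"
      have "p (?y \<ominus> of_real (m / 2) \<odot> \<one>) = m"
        by (rule minimum_on_disc) (use x m Suc min in \<open>auto simp: shift m_def norm_divide\<close>)
      moreover have "a + complex_of_real (n * (m / 2)) + of_real (m / 2) = a + of_real (Suc n * (m / 2))"
        by (simp add: algebra_simps)
      ultimately show ?case by (simp only: shift)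
    qed (simp add: m_def)
    obtain n :: nat where n: "m + p x + cmod a < n * (m / 2)"
      using reals_Archimedean3[OF half_gt_zero[OF m]] by blast
    have "cmod (of_real (n * (m / 2))) = n * (m / 2)" using m unfolding norm_of_real by simp
    then have "n * (m / 2) - cmod a \<le> cmod (a + of_real (n * (m / 2)))"
      using norm_diff_ineq[of "complex_of_real (n * (m / 2))" a] by (simp only: add.commute)
    then show False
      using growth[of "a + of_real (n * (m / 2))"] along[of n] n by linarith
  qed
  then show ?thesis by blast
qed

lemma scalar_unique:
  assumes x: "x \<in> carrier A" and "p (x \<ominus> z \<odot> \<one>) = 0" "p (x \<ominus> w \<odot> \<one>) = 0"
  shows "z = w"
proof -
  have "p (z \<odot> \<one> \<ominus> w \<odot> \<one>) \<le> 0"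
    using diff_triangle[of "z \<odot> \<one>" x "w \<odot> \<one>"] diff_commute[of "z \<odot> \<one>" x] assms by simp
  then show ?thesis by (simp flip: smult_diff_left)
qed

text \<open>The character of which \<open>p\<close> is the modulus: modulo the kernel of
  \<open>p\<close>, each element is a scalar. It is restricted to the carrier because characters are
  extensional.\<close>

definition eigenvalue :: "'a \<Rightarrow> complex" where
  "eigenvalue = (\<lambda>x\<in>carrier A. SOME z. p (x \<ominus> z \<odot> \<one>) = 0)"

lemma eigenvalue: "x \<in> carrier A \<Longrightarrow> p (x \<ominus> eigenvalue x \<odot> \<one>) = 0"
  using someI_ex[OF Gelfand_Mazur] by (simp add: eigenvalue_def)

lemma eigenvalue_eqI: "x \<in> carrier A \<Longrightarrow> p (x \<ominus> z \<odot> \<one>) \<le> 0 \<Longrightarrow> eigenvalue x = z"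
  using scalar_unique[OF _ eigenvalue] by (simp add: antisym)

lemma cmod_eigenvalue: "x \<in> carrier A \<Longrightarrow> cmod (eigenvalue x) = p x"
  using abs_diff_le[of x "eigenvalue x \<odot> \<one>"] by (simp add: eigenvalue)

text \<open>Each identity follows from uniqueness of the scalar: the residual of the combined
  element is built from the residuals of \<open>x\<close> and \<open>y\<close>, on which
  \<open>p\<close> vanishes.\<close>

lemma eigenvalue_hom:
  assumes x: "x \<in> carrier A" and y: "y \<in> carrier A"
  shows "eigenvalue (x \<oplus> y) = eigenvalue x + eigenvalue y"
    and "eigenvalue (x \<otimes> y) = eigenvalue x * eigenvalue y"
    and "eigenvalue \<one> = 1"
    and "eigenvalue (c \<odot> x) = c * eigenvalue x"
    and "eigenvalue (star A x) = cnj (eigenvalue x)"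
proof -
  let ?a = "eigenvalue x" and ?b = "eigenvalue y"
  let ?x = "x \<ominus> ?a \<odot> \<one>" and ?y = "y \<ominus> ?b \<odot> \<one>"
  have xy: "?x \<in> carrier A" "?y \<in> carrier A" "p ?x = 0" "p ?y = 0" using x y by (auto simp: eigenvalue)
  have "(x \<oplus> y) \<ominus> (?a + ?b) \<odot> \<one> = ?x \<oplus> ?y"
    using x y by (simp add: a_minus_def uminus_smult smult_smult smult_add_left smult_add_right a_ac)
  then show "eigenvalue (x \<oplus> y) = ?a + ?b"
    using add_le[OF xy(1,2)] x y xy by (intro eigenvalue_eqI) auto
  have "x \<otimes> y \<ominus> (?a * ?b) \<odot> \<one> = (x \<otimes> y \<ominus> ?b \<odot> x) \<oplus> (?b \<odot> x \<ominus> (?a * ?b) \<odot> \<one>)"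
    using x y by (simp add: diff_add_diff)
  also have "x \<otimes> y \<ominus> ?b \<odot> x = x \<otimes> ?y"
    using x y by (simp add: a_minus_def uminus_smult smult_smult r_distr smult_mult_right)
  also have "?b \<odot> x \<ominus> (?a * ?b) \<odot> \<one> = ?b \<odot> ?x"
    using x by (simp add: smult_diff_right smult_smult mult.commute)
  finally have "x \<otimes> y \<ominus> (?a * ?b) \<odot> \<one> = x \<otimes> ?y \<oplus> ?b \<odot> ?x" .
  then show "eigenvalue (x \<otimes> y) = ?a * ?b"
    using add_le[of "x \<otimes> ?y" "?b \<odot> ?x"] x y xy by (intro eigenvalue_eqI) (auto simp: mult_eq smult)
  show "eigenvalue \<one> = 1"
    by (rule eigenvalue_eqI) (simp_all add: a_minus_def r_neg)
  have "c \<odot> x \<ominus> (c * ?a) \<odot> \<one> = c \<odot> ?x"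
    using x by (simp add: smult_diff_right smult_smult)
  then show "eigenvalue (c \<odot> x) = c * ?a"
    using x xy by (intro eigenvalue_eqI) (auto simp: smult)
  have "star A x \<ominus> cnj ?a \<odot> \<one> = star A ?x"
    using x by (simp add: star_diff star_smult)
  then show "eigenvalue (star A x) = cnj ?a"
    using x xy by (intro eigenvalue_eqI) (auto simp: star)
qed

end

section \<open>Topologies generated by \<open>C\<^sup>*\<close>-seminorms\<close>

text \<open>General enough to cover both the set of all continuous C*-seminorms and the sup-norms
  over compact sets. Directedness makes the balls of single seminorms a neighbourhood base.\<close>

locale cstar_family = comm_star_algebra +
  fixes P
  assumes cstar: "p \<in> P \<Longrightarrow> cstar_seminorm A p"
    and nonempty: "P \<noteq> {}"
    and directed: "p \<in> P \<Longrightarrow> q \<in> P \<Longrightarrow> \<exists>s\<in>P. \<forall>x\<in>carrier A. p x \<le> s x \<and> q x \<le> s x"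
begin

lemma seminormed: "p \<in> P \<Longrightarrow> cstar_seminormed A p"
  by unfold_locales (rule cstar)

definition generated_topology :: "'a topology" where
  "generated_topology = topology_generated_by
     {{y \<in> carrier A. p (y \<ominus> x) < r} |p x r. p \<in> P \<and> x \<in> carrier A \<and> 0 < r}"

lemma openin_generated_topology_iff:
  "openin generated_topology U \<longleftrightarrow> U \<subseteq> carrier A \<and>
     (\<forall>x\<in>U. \<exists>p\<in>P. \<exists>r>0. \<forall>y\<in>carrier A. p (y \<ominus> x) < r \<longrightarrow> y \<in> U)"
  (is "?L \<longleftrightarrow> ?R U")
proof
  have "generate_topology_on
      {{y \<in> carrier A. p (y \<ominus> x) < r} |p x r. p \<in> P \<and> x \<in> carrier A \<and> 0 < r} U \<Longrightarrow> ?R U" for U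
  proof (induction rule: generate_topology_on.induct)
    case (Int U V)
    have "\<exists>p\<in>P. \<exists>r>0. \<forall>y\<in>carrier A. p (y \<ominus> x) < r \<longrightarrow> y \<in> U \<inter> V" if x: "x \<in> U \<inter> V" for x
    proof -
      obtain p r where p: "p \<in> P" "0 < r" "\<And>y. y \<in> carrier A \<Longrightarrow> p (y \<ominus> x) < r \<Longrightarrow> y \<in> U"
        using Int x by blast
      obtain q r' where q: "q \<in> P" "0 < r'" "\<And>y. y \<in> carrier A \<Longrightarrow> q (y \<ominus> x) < r' \<Longrightarrow> y \<in> V"
        using Int x by blast
      obtain s where s: "s \<in> P" "\<And>y. y \<in> carrier A \<Longrightarrow> p y \<le> s y" "\<And>y. y \<in> carrier A \<Longrightarrow> q y \<le> s y"
        using directed[OF p(1) q(1)] by blast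
      have "y \<in> U \<inter> V" if "y \<in> carrier A" "s (y \<ominus> x) < min r r'" for y
        using p(3)[of y] q(3)[of y] s(2,3)[of "y \<ominus> x"] that x Int by fastforce
      then show ?thesis using s(1) p(2) q(2) by (intro bexI[of _ s] exI[of _ "min r r'"]) auto
    qed
    with Int show ?case by blast
  next
    case (UN \<U>)
    have "\<exists>p\<in>P. \<exists>r>0. \<forall>y\<in>carrier A. p (y \<ominus> x) < r \<longrightarrow> y \<in> \<Union>\<U>" if x: "x \<in> \<Union>\<U>" for x
    proof -
      obtain V where V: "V \<in> \<U>" "x \<in> V" using x by blast
      then have "\<exists>p\<in>P. \<exists>r>0. \<forall>y\<in>carrier A. p (y \<ominus> x) < r \<longrightarrow> y \<in> V" using UN by blast
      with V(1) show ?thesis by (meson UnionI)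
    qed
    moreover have "\<Union>\<U> \<subseteq> carrier A" using UN by blast
    ultimately show ?case by blast
  next
    case (Basis U)
    then obtain p x r where U: "U = {y \<in> carrier A. p (y \<ominus> x) < r}" and p: "p \<in> P"
      and x: "x \<in> carrier A" and r: "0 < r" by blast
    interpret cstar_seminormed A p by (rule seminormed[OF p])
    have "y \<in> U" if "z \<in> U" "y \<in> carrier A" "p (y \<ominus> z) < r - p (z \<ominus> x)" for y z
      using that diff_triangle[of y z x] x by (auto simp: U)
    moreover have "0 < r - p (z \<ominus> x)" if "z \<in> U" for z
      using that by (simp add: U)
    ultimately show ?case using p U by blast
  qed auto
  then show "?L \<Longrightarrow> ?R U"
    unfolding generated_topology_def openin_topology_generated_by_iff .
next
  assume R: "?R U"
  show ?L
  proof (subst openin_subopen, intro ballI)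
    fix x assume x: "x \<in> U"
    then obtain p r where p: "p \<in> P" "0 < r" "\<And>y. y \<in> carrier A \<Longrightarrow> p (y \<ominus> x) < r \<Longrightarrow> y \<in> U"
      using R by blast
    interpret cstar_seminormed A p by (rule seminormed[OF p(1)])
    have xc: "x \<in> carrier A" using R x by blast
    have "openin generated_topology {y \<in> carrier A. p (y \<ominus> x) < r}"
      unfolding generated_topology_def by (rule topology_generated_by_Basis) (use p xc in blast)
    moreover have "x \<in> {y \<in> carrier A. p (y \<ominus> x) < r}" using xc p(2) by (simp add: a_minus_def r_neg)
    moreover have "{y \<in> carrier A. p (y \<ominus> x) < r} \<subseteq> U" using p by blast
    ultimately show "\<exists>T. openin generated_topology T \<and> x \<in> T \<and> T \<subseteq> U" by blast
  qed
qed

end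

locale cstar_family_topology = cstar_family +
  assumes topo_eq: "topo A = generated_topology"
begin

lemma openin_topo_iff:
  "openin (topo A) U \<longleftrightarrow> U \<subseteq> carrier A \<and>
     (\<forall>x\<in>U. \<exists>p\<in>P. \<exists>r>0. \<forall>y\<in>carrier A. p (y \<ominus> x) < r \<longrightarrow> y \<in> U)"
  by (simp add: topo_eq openin_generated_topology_iff)

lemma topspace_eq: "topspace (topo A) = carrier A"
proof (rule antisym)
  show "topspace (topo A) \<subseteq> carrier A" using openin_topo_iff[of "topspace (topo A)"] by simp
  have "openin (topo A) (carrier A)"
    using nonempty unfolding openin_topo_iff by (auto intro: exI[of _ 1])
  then show "carrier A \<subseteq> topspace (topo A)" by (rule openin_subset)
qed

lemma openin_ball:
  assumes "p \<in> P" "x \<in> carrier A" "0 < r"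
  shows "openin (topo A) {y \<in> carrier A. p (y \<ominus> x) < r}"
  unfolding topo_eq generated_topology_def by (rule topology_generated_by_Basis) (use assms in blast)

text \<open>Reduces continuity into \<open>A\<close> to estimates with one seminorm at a time; this
  serves the algebra operations as well as homomorphisms.\<close>

lemma continuous_map_into_iff:
  "continuous_map T (topo A) f \<longleftrightarrow> f \<in> topspace T \<rightarrow> carrier A \<and>
     (\<forall>t\<in>topspace T. \<forall>p\<in>P. \<forall>r>0. \<exists>U. openin T U \<and> t \<in> U \<and> (\<forall>u\<in>U. p (f u \<ominus> f t) < r))"
  (is "?L \<longleftrightarrow> ?R")
proof
  assume L: ?L
  have f: "f \<in> topspace T \<rightarrow> carrier A"
    using continuous_map_funspace[OF L] by (simp add: topspace_eq)
  have "\<exists>U. openin T U \<and> t \<in> U \<and> (\<forall>u\<in>U. p (f u \<ominus> f t) < r)"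
    if t: "t \<in> topspace T" and p: "p \<in> P" and r: "0 < r" for t p r
  proof -
    interpret cstar_seminormed A p by (rule seminormed[OF p])
    have ft: "f t \<in> carrier A" using f t by blast
    have "openin T {u \<in> topspace T. f u \<in> {y \<in> carrier A. p (y \<ominus> f t) < r}}"
      by (rule openin_continuous_map_preimage[OF L openin_ball[OF p ft r]])
    then show ?thesis using t ft r
      by (intro exI[of _ "{u \<in> topspace T. f u \<in> {y \<in> carrier A. p (y \<ominus> f t) < r}}"])
        (auto simp: a_minus_def r_neg)
  qed
  with f show ?R by blast
next
  assume R: ?R
  show ?L
    unfolding continuous_map_alt
  proof (intro conjI allI impI)
    show "f \<in> topspace T \<rightarrow> topspace (topo A)" using R by (simp add: topspace_eq)
    fix V assume V: "openin (topo A) V"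
    show "openin T (f -` V \<inter> topspace T)"
    proof (subst openin_subopen, intro ballI)
      fix t assume t: "t \<in> f -` V \<inter> topspace T"
      then obtain p r where "p \<in> P" "0 < r" and pr: "\<And>y. y \<in> carrier A \<Longrightarrow> p (y \<ominus> f t) < r \<Longrightarrow> y \<in> V"
        using V unfolding openin_topo_iff by blast
      then obtain U where U: "openin T U" "t \<in> U" "\<forall>u\<in>U. p (f u \<ominus> f t) < r"
        using R t by blast
      have "f u \<in> V" if "u \<in> U" for u
        using pr[of "f u"] U(3) R openin_subset[OF U(1)] that by blast
      then have "U \<subseteq> f -` V \<inter> topspace T" using openin_subset[OF U(1)] by blast
      then show "\<exists>W. openin T W \<and> t \<in> W \<and> W \<subseteq> f -` V \<inter> topspace T" using U by blast
    qed
  qed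
qed

text \<open>Continuity bounds \<open>q\<close> by 1 on a ball of some \<open>p\<close> in
  \<open>P\<close>, and \<open>dominated\<close> turns this into \<open>q \<le> p\<close> without a
  constant. This is how the continuous C*-seminorms of \<open>FC X\<close> are traced back to
  members of the compact family.\<close>

lemma continuous_cstar_seminorm_iff:
  "continuous_cstar_seminorm A q \<longleftrightarrow>
     cstar_seminorm A q \<and> (\<exists>p\<in>P. \<forall>x\<in>carrier A. q x \<le> p x)"
proof
  assume q: "continuous_cstar_seminorm A q"
  then interpret q: cstar_seminormed A q by unfold_locales (simp add: continuous_cstar_seminorm_def)
  have "openin (topo A) {x \<in> topspace (topo A). q x \<in> {..<1}}"
    by (rule openin_continuous_map_preimage)
      (use q in \<open>auto simp: continuous_cstar_seminorm_def\<close>)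
  moreover have "\<zero> \<in> {x \<in> topspace (topo A). q x \<in> {..<1}}" by (simp add: topspace_eq)
  ultimately obtain p r where p: "p \<in> P" "0 < r"
      "\<And>y. y \<in> carrier A \<Longrightarrow> p (y \<ominus> \<zero>) < r \<Longrightarrow> y \<in> {x \<in> topspace (topo A). q x \<in> {..<1}}"
    unfolding openin_topo_iff by blast
  interpret cstar_seminormed A p by (rule seminormed[OF p(1)])
  have "q x \<le> p x" if "x \<in> carrier A" for x
    by (rule dominated[OF q.cstar_seminorm p(2) _ that]) (use p(3) in \<open>auto simp: a_minus_def\<close>)
  then show "cstar_seminorm A q \<and> (\<exists>p\<in>P. \<forall>x\<in>carrier A. q x \<le> p x)"
    using p(1) q.cstar_seminorm by blast
next
  assume R: "cstar_seminorm A q \<and> (\<exists>p\<in>P. \<forall>x\<in>carrier A. q x \<le> p x)"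
  then interpret q: cstar_seminormed A q by unfold_locales simp
  obtain p where p: "p \<in> P" "\<And>x. x \<in> carrier A \<Longrightarrow> q x \<le> p x" using R by blast
  have "continuous_map (topo A) euclideanreal q"
    unfolding continuous_map_def
  proof (intro conjI allI impI)
    fix V :: "real set" assume "openin euclideanreal V"
    then have V: "open V" by simp
    have "\<exists>p\<in>P. \<exists>r>0. \<forall>y\<in>carrier A. p (y \<ominus> x) < r \<longrightarrow> y \<in> {x \<in> carrier A. q x \<in> V}"
      if x: "x \<in> {x \<in> carrier A. q x \<in> V}" for x
    proof -
      obtain e where e: "0 < e" "\<And>v. dist v (q x) < e \<Longrightarrow> v \<in> V"
        using V x unfolding open_dist by blast
      have "q y \<in> V" if "y \<in> carrier A" "p (y \<ominus> x) < e" for y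
        using e(2)[of "q y"] q.abs_diff_le[of y x] p(2)[of "y \<ominus> x"] that x by (simp add: dist_real_def)
      with e(1) p(1) show ?thesis by blast
    qed
    then show "openin (topo A) {x \<in> topspace (topo A). q x \<in> V}"
      unfolding openin_topo_iff topspace_eq by blast
  qed auto
  with R show "continuous_cstar_seminorm A q" by (simp add: continuous_cstar_seminorm_def)
qed

sublocale topological_comm_star_algebra A
proof unfold_locales
  show "topspace (topo A) = carrier A" by (rule topspace_eq)
  have nbhd: "\<exists>U. openin (topo A) U \<and> x \<in> U \<and> (\<forall>u\<in>U. u \<in> carrier A \<and> p (u \<ominus> x) < r)"
    if "p \<in> P" "x \<in> carrier A" "0 < r" for p x r
  proof -
    interpret cstar_seminormed A p by (rule seminormed[OF that(1)])
    show ?thesis using openin_ball[OF that] that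
      by (intro exI[of _ "{y \<in> carrier A. p (y \<ominus> x) < r}"]) (simp add: a_minus_def r_neg)
  qed
  show "continuous_map (prod_topology (topo A) (topo A)) (topo A) (\<lambda>(x, y). x \<oplus> y)"
    unfolding continuous_map_into_iff
  proof (intro conjI ballI allI impI)
    fix t p and r :: real
    assume t: "t \<in> topspace (prod_topology (topo A) (topo A))" and p: "p \<in> P" and r: "0 < r"
    interpret cstar_seminormed A p by (rule seminormed[OF p])
    obtain x y where xy: "t = (x, y)" "x \<in> carrier A" "y \<in> carrier A" using t by (auto simp: topspace_eq)
    obtain U where U: "openin (topo A) U" "x \<in> U" "\<forall>u\<in>U. u \<in> carrier A \<and> p (u \<ominus> x) < r / 2"
      using nbhd[OF p xy(2), of "r / 2"] r by auto
    obtain V where V: "openin (topo A) V" "y \<in> V" "\<forall>v\<in>V. v \<in> carrier A \<and> p (v \<ominus> y) < r / 2"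
      using nbhd[OF p xy(3), of "r / 2"] r by auto
    have "p ((u \<oplus> v) \<ominus> (x \<oplus> y)) < r" if "u \<in> U" "v \<in> V" for u v
    proof -
      have uv: "u \<in> carrier A" "v \<in> carrier A" "p (u \<ominus> x) < r / 2" "p (v \<ominus> y) < r / 2" using U V that by auto
      have "(u \<oplus> v) \<ominus> (x \<oplus> y) = (u \<ominus> x) \<oplus> (v \<ominus> y)"
        using uv xy by (simp add: a_minus_def minus_add a_ac)
      then show ?thesis using add_le[of "u \<ominus> x" "v \<ominus> y"] uv xy by simp
    qed
    then show "\<exists>W. openin (prod_topology (topo A) (topo A)) W \<and> t \<in> W \<and>
        (\<forall>u\<in>W. p ((case u of (x, y) \<Rightarrow> x \<oplus> y) \<ominus> (case t of (x, y) \<Rightarrow> x \<oplus> y)) < r)"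
      using U V xy by (intro exI[of _ "U \<times> V"]) (auto simp: openin_prod_Times_iff)
  qed (auto simp: topspace_eq)
  show "continuous_map (prod_topology (topo A) (topo A)) (topo A) (\<lambda>(x, y). x \<otimes> y)"
    unfolding continuous_map_into_iff
  proof (intro conjI ballI allI impI)
    fix t p and r :: real
    assume t: "t \<in> topspace (prod_topology (topo A) (topo A))" and p: "p \<in> P" and r: "0 < r"
    interpret cstar_seminormed A p by (rule seminormed[OF p])
    obtain x y where xy: "t = (x, y)" "x \<in> carrier A" "y \<in> carrier A" using t by (auto simp: topspace_eq)
    \<comment> \<open>Chosen for the splitting \<open>(u \<ominus> x) \<otimes> v \<oplus> x
      \<otimes> (v \<ominus> y)\<close>: \<open>e \<le> 1\<close> gives
      \<open>p v \<le> 1 + p y\<close>, so the two terms contribute at most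
      \<open>e * (1 + p x + p y)\<close>.\<close>
    define e where "e = min 1 (r / (2 * (1 + p x + p y)))"
    have pos: "0 < 1 + p x + p y" using nonneg[OF xy(2)] nonneg[OF xy(3)] by linarith
    have e: "0 < e" "e \<le> 1" "e * (1 + p x + p y) < r"
    proof -
      have "e \<le> r / (2 * (1 + p x + p y))" by (simp add: e_def)
      then have "e * (1 + p x + p y) \<le> r / 2" using pos by (simp add: field_simps)
      then show "e * (1 + p x + p y) < r" using r by linarith
    qed (use pos r in \<open>auto simp: e_def\<close>)
    obtain U where U: "openin (topo A) U" "x \<in> U" "\<forall>u\<in>U. u \<in> carrier A \<and> p (u \<ominus> x) < e"
      using nbhd[OF p xy(2) e(1)] by auto
    obtain V where V: "openin (topo A) V" "y \<in> V" "\<forall>v\<in>V. v \<in> carrier A \<and> p (v \<ominus> y) < e"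
      using nbhd[OF p xy(3) e(1)] by auto
    have "p (u \<otimes> v \<ominus> x \<otimes> y) < r" if "u \<in> U" "v \<in> V" for u v
    proof -
      have uv: "u \<in> carrier A" "v \<in> carrier A" "p (u \<ominus> x) < e" "p (v \<ominus> y) < e" using U V that by auto
      have "(u \<otimes> v \<ominus> x \<otimes> v) \<oplus> (x \<otimes> v \<ominus> x \<otimes> y) = u \<otimes> v \<ominus> x \<otimes> y"
        using uv xy by (intro diff_add_diff) auto
      moreover have "u \<otimes> v \<ominus> x \<otimes> v = (u \<ominus> x) \<otimes> v" "x \<otimes> v \<ominus> x \<otimes> y = x \<otimes> (v \<ominus> y)"
        using uv xy by (simp_all add: a_minus_def l_distr r_distr l_minus r_minus)
      ultimately have "p (u \<otimes> v \<ominus> x \<otimes> y) \<le> p (u \<ominus> x) * p v + p x * p (v \<ominus> y)"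
        using add_le[of "(u \<ominus> x) \<otimes> v" "x \<otimes> (v \<ominus> y)"] mult_le[of "u \<ominus> x" v] mult_le[of x "v \<ominus> y"] uv xy
        by simp
      also have "p (u \<ominus> x) * p v \<le> e * (1 + p y)"
        by (rule mult_mono) (use uv xy e le_diff_add[of v y] in auto)
      also have "p x * p (v \<ominus> y) \<le> p x * e"
        by (rule mult_left_mono) (use uv xy in auto)
      also have "e * (1 + p y) + p x * e = e * (1 + p x + p y)" by (simp add: algebra_simps)
      finally show ?thesis using e(3) by simp
    qed
    then show "\<exists>W. openin (prod_topology (topo A) (topo A)) W \<and> t \<in> W \<and>
        (\<forall>u\<in>W. p ((case u of (x, y) \<Rightarrow> x \<otimes> y) \<ominus> (case t of (x, y) \<Rightarrow> x \<otimes> y)) < r)"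
      using U V xy by (intro exI[of _ "U \<times> V"]) (auto simp: openin_prod_Times_iff)
  qed (auto simp: topspace_eq)
  show "continuous_map (prod_topology euclidean (topo A)) (topo A) (\<lambda>(c, x). c \<odot> x)"
    unfolding continuous_map_into_iff
  proof (intro conjI ballI allI impI)
    fix t p and r :: real
    assume t: "t \<in> topspace (prod_topology (euclidean :: complex topology) (topo A))" and p: "p \<in> P" and r: "0 < r"
    interpret cstar_seminormed A p by (rule seminormed[OF p])
    obtain c x where cx: "t = (c, x)" "x \<in> carrier A" using t by (auto simp: topspace_eq)
    \<comment> \<open>The analogous choice for
      \<open>d \<odot> (v \<ominus> x) \<oplus> (d - c) \<odot> x\<close>, with
      \<open>cmod d \<le> cmod c + 1\<close>.\<close>
    define e where "e = min 1 (r / (2 * (1 + cmod c + p x)))"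
    have pos: "0 < 1 + cmod c + p x" using nonneg[OF cx(2)] norm_ge_zero[of c] by linarith
    have e: "0 < e" "e \<le> 1" "e * (1 + cmod c + p x) < r"
    proof -
      have "e \<le> r / (2 * (1 + cmod c + p x))" by (simp add: e_def)
      then have "e * (1 + cmod c + p x) \<le> r / 2" using pos by (simp add: field_simps)
      then show "e * (1 + cmod c + p x) < r" using r by linarith
    qed (use pos r in \<open>auto simp: e_def\<close>)
    obtain V where V: "openin (topo A) V" "x \<in> V" "\<forall>v\<in>V. v \<in> carrier A \<and> p (v \<ominus> x) < e"
      using nbhd[OF p cx(2) e(1)] by auto
    have "p (d \<odot> v \<ominus> c \<odot> x) < r" if "d \<in> ball c e" "v \<in> V" for d v
    proof -
      have v: "v \<in> carrier A" "p (v \<ominus> x) < e" and d: "cmod (d - c) < e"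
        using V that by (auto simp: dist_norm norm_minus_commute)
      have "(d \<odot> v \<ominus> d \<odot> x) \<oplus> (d \<odot> x \<ominus> c \<odot> x) = d \<odot> v \<ominus> c \<odot> x"
        using v cx by (intro diff_add_diff) auto
      moreover have "d \<odot> v \<ominus> d \<odot> x = d \<odot> (v \<ominus> x)" "d \<odot> x \<ominus> c \<odot> x = (d - c) \<odot> x"
        using v cx by (simp_all add: smult_diff_right smult_diff_left)
      ultimately have "p (d \<odot> v \<ominus> c \<odot> x) \<le> cmod d * p (v \<ominus> x) + cmod (d - c) * p x"
        using add_le[of "d \<odot> (v \<ominus> x)" "(d - c) \<odot> x"] v cx by (simp add: smult)
      also have "cmod d * p (v \<ominus> x) \<le> (cmod c + 1) * e"
        using norm_triangle_sub[of d c] d e(2) v cx by (intro mult_mono) auto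
      also have "cmod (d - c) * p x \<le> e * p x"
        by (rule mult_right_mono) (use d cx in auto)
      also have "(cmod c + 1) * e + e * p x = e * (1 + cmod c + p x)" by (simp add: algebra_simps)
      finally show ?thesis using e(3) by simp
    qed
    then show "\<exists>W. openin (prod_topology euclidean (topo A)) W \<and> t \<in> W \<and>
        (\<forall>u\<in>W. p ((case u of (c, x) \<Rightarrow> c \<odot> x) \<ominus> (case t of (c, x) \<Rightarrow> c \<odot> x)) < r)"
      using V cx e by (intro exI[of _ "ball c e \<times> V"]) (auto simp: openin_prod_Times_iff)
  qed (auto simp: topspace_eq)
  show "continuous_map (topo A) (topo A) (star A)"
    unfolding continuous_map_into_iff
  proof (intro conjI ballI allI impI)
    fix x p and r :: real
    assume "x \<in> topspace (topo A)" and p: "p \<in> P" and r: "0 < r"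
    then have x: "x \<in> carrier A" by (simp add: topspace_eq)
    interpret cstar_seminormed A p by (rule seminormed[OF p])
    obtain V where V: "openin (topo A) V" "x \<in> V" "\<forall>v\<in>V. v \<in> carrier A \<and> p (v \<ominus> x) < r"
      using nbhd[OF p x r] by auto
    have "p (star A v \<ominus> star A x) < r" if "v \<in> V" for v
      using V that x star[of "v \<ominus> x"] by (simp add: star_diff)
    with V show "\<exists>U. openin (topo A) U \<and> x \<in> U \<and> (\<forall>u\<in>U. p (star A u \<ominus> star A x) < r)" by blast
  qed (auto simp: topspace_eq)
qed

text \<open>Members of \<open>P\<close> are continuous, and passing to all continuous C*-seminorms
  adds no open sets because each of them lies below a member of \<open>P\<close>.\<close>

lemma generated_by_continuous_cstar_seminorms:
  "topo A = topology_generated_by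
     {{y \<in> carrier A. p (y \<ominus> x) < r} |p x r. continuous_cstar_seminorm A p \<and> x \<in> carrier A \<and> 0 < r}"
proof -
  interpret all: cstar_family A "Collect (continuous_cstar_seminorm A)"
  proof
    show "Collect (continuous_cstar_seminorm A) \<noteq> {}"
      using nonempty cstar unfolding continuous_cstar_seminorm_iff by blast
    fix p q assume "p \<in> Collect (continuous_cstar_seminorm A)" "q \<in> Collect (continuous_cstar_seminorm A)"
    then obtain p' q' where p': "p' \<in> P" "\<forall>x\<in>carrier A. p x \<le> p' x" and q': "q' \<in> P" "\<forall>x\<in>carrier A. q x \<le> q' x"
      unfolding continuous_cstar_seminorm_iff by blast
    obtain s where s: "s \<in> P" "\<forall>x\<in>carrier A. p' x \<le> s x \<and> q' x \<le> s x"
      using directed[OF p'(1) q'(1)] by blast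
    then have "s \<in> Collect (continuous_cstar_seminorm A)"
      using cstar unfolding continuous_cstar_seminorm_iff by blast
    moreover have "\<forall>x\<in>carrier A. p x \<le> s x \<and> q x \<le> s x"
      using p'(2) q'(2) s(2) by (meson order_trans)
    ultimately show "\<exists>s\<in>Collect (continuous_cstar_seminorm A). \<forall>x\<in>carrier A. p x \<le> s x \<and> q x \<le> s x"
      by blast
  qed (simp add: continuous_cstar_seminorm_def)
  have "openin (topo A) U \<longleftrightarrow> openin all.generated_topology U" for U
    unfolding openin_topo_iff all.openin_generated_topology_iff
  proof (intro conj_cong refl ball_cong iffI)
    fix x assume "U \<subseteq> carrier A" "x \<in> U"
    then have x: "x \<in> carrier A" by blast
    {
      assume "\<exists>p\<in>P. \<exists>r>0. \<forall>y\<in>carrier A. p (y \<ominus> x) < r \<longrightarrow> y \<in> U"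
      moreover have "P \<subseteq> Collect (continuous_cstar_seminorm A)"
        using cstar continuous_cstar_seminorm_iff by blast
      ultimately show "\<exists>p\<in>Collect (continuous_cstar_seminorm A). \<exists>r>0. \<forall>y\<in>carrier A. p (y \<ominus> x) < r \<longrightarrow> y \<in> U"
        by blast
    next
      assume "\<exists>p\<in>Collect (continuous_cstar_seminorm A). \<exists>r>0. \<forall>y\<in>carrier A. p (y \<ominus> x) < r \<longrightarrow> y \<in> U"
      then obtain q r p where "0 < r" "\<forall>y\<in>carrier A. q (y \<ominus> x) < r \<longrightarrow> y \<in> U"
        and "p \<in> P" "\<forall>x\<in>carrier A. q x \<le> p x"
        unfolding mem_Collect_eq Bex_def continuous_cstar_seminorm_iff by blast
      moreover from this have "y \<in> U" if "y \<in> carrier A" "p (y \<ominus> x) < r" for y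
        using that x by (meson le_less_trans minus_closed)
      ultimately show "\<exists>p\<in>P. \<exists>r>0. \<forall>y\<in>carrier A. p (y \<ominus> x) < r \<longrightarrow> y \<in> U" by blast
    }
  qed
  then show ?thesis
    unfolding all.generated_topology_def topology_eq by simp
qed

lemma Hausdorff_spaceI:
  assumes "\<And>x. x \<in> carrier A \<Longrightarrow> x \<noteq> \<zero> \<Longrightarrow> \<exists>p\<in>P. p x \<noteq> 0"
  shows "Hausdorff_space (topo A)"
  unfolding Hausdorff_space_def
proof (intro allI impI)
  fix x y assume "x \<in> topspace (topo A) \<and> y \<in> topspace (topo A) \<and> x \<noteq> y"
  then have xy: "x \<in> carrier A" "y \<in> carrier A" "x \<noteq> y" by (auto simp: topspace_eq)
  then have "x \<ominus> y \<noteq> \<zero>" using diff_eq_zeroD by blast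
  then obtain p where p: "p \<in> P" "p (x \<ominus> y) \<noteq> 0" using assms[of "x \<ominus> y"] xy by auto
  interpret cstar_seminormed A p by (rule seminormed[OF p(1)])
  define r where "r = p (x \<ominus> y) / 2"
  have r: "0 < r" using p(2) xy by (simp add: r_def less_le)
  have "disjnt {z \<in> carrier A. p (z \<ominus> x) < r} {z \<in> carrier A. p (z \<ominus> y) < r}"
    unfolding disjnt_iff
  proof (intro allI notI)
    fix z assume "z \<in> {z \<in> carrier A. p (z \<ominus> x) < r} \<and> z \<in> {z \<in> carrier A. p (z \<ominus> y) < r}"
    then show False
      using diff_triangle[of x z y] diff_commute[of x z] xy by (simp add: r_def)
  qed
  then show "\<exists>U V. openin (topo A) U \<and> openin (topo A) V \<and> x \<in> U \<and> y \<in> V \<and> disjnt U V"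
    using openin_ball[OF p(1) _ r] xy r
    by (intro exI[of _ "{z \<in> carrier A. p (z \<ominus> x) < r}"] exI[of _ "{z \<in> carrier A. p (z \<ominus> y) < r}"])
      (simp add: a_minus_def r_neg)
qed

end

section \<open>Characters\<close>

text \<open>
  \<open>Stone_Weierstrass_basic\<close> needs a \<open>t2_space\<close>, here a type of functions. The two weaker instances come first because the
  library already has the whole chain for countable index types, and arities must be coregular.
\<close>

lemma open_coordinate_vimage:
  "open U \<Longrightarrow> open ((\<lambda>h :: 'a \<Rightarrow> 'b::topological_space. h i) -` U)"
  by (intro open_vimage continuous_on_product_coordinates)

instance "fun" :: (type, t0_space) t0_space
proof
  fix f g :: "'a \<Rightarrow> 'b" assume "f \<noteq> g"
  then obtain i where "f i \<noteq> g i" by blast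
  from t0_space_class.t0_space[OF this] obtain U where "open U" "(f i \<in> U) \<noteq> (g i \<in> U)" by blast
  then show "\<exists>U. open U \<and> \<not> (f \<in> U) = (g \<in> U)"
    using open_coordinate_vimage by (intro exI[of _ "(\<lambda>h. h i) -` U"]) simp
qed

instance "fun" :: (type, t1_space) t1_space
proof
  fix f g :: "'a \<Rightarrow> 'b" assume "f \<noteq> g"
  then obtain i where "f i \<noteq> g i" by blast
  from t1_space[OF this] obtain U where "open U" "f i \<in> U" "g i \<notin> U" by blast
  then show "\<exists>U. open U \<and> f \<in> U \<and> g \<notin> U"
    using open_coordinate_vimage by (intro exI[of _ "(\<lambda>h. h i) -` U"]) simp
qed

instance "fun" :: (type, t2_space) t2_space
proof
  fix f g :: "'a \<Rightarrow> 'b" assume "f \<noteq> g"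
  then obtain i where "f i \<noteq> g i" by blast
  from hausdorff[OF this] obtain U V
    where UV: "open U" "open V" "f i \<in> U" "g i \<in> V" "U \<inter> V = {}" by blast
  show "\<exists>U V. open U \<and> open V \<and> f \<in> U \<and> g \<in> V \<and> U \<inter> V = {}"
  proof (intro exI conjI)
    show "open ((\<lambda>h::'a\<Rightarrow>'b. h i) -` U)" "open ((\<lambda>h::'a\<Rightarrow>'b. h i) -` V)"
      using UV by (auto intro: open_coordinate_vimage)
  qed (use UV in auto)
qed


text \<open>Characters without the continuity clause: the remaining conditions are pointwise
  equations, hence closed under pointwise convergence, and domination by a continuous seminorm
  supplies continuity afterwards.\<close>

definition star_characters :: "'a star_algebra \<Rightarrow> ('a \<Rightarrow> complex) set" where
  "star_characters A = {\<omega> \<in> extensional (carrier A).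
     (\<forall>x\<in>carrier A. \<forall>y\<in>carrier A.
        \<omega> (x \<oplus>\<^bsub>A\<^esub> y) = \<omega> x + \<omega> y \<and> \<omega> (x \<otimes>\<^bsub>A\<^esub> y) = \<omega> x * \<omega> y) \<and>
     \<omega> \<one>\<^bsub>A\<^esub> = 1 \<and>
     (\<forall>c. \<forall>x\<in>carrier A. \<omega> (c \<odot>\<^bsub>A\<^esub> x) = c * \<omega> x \<and> \<omega> (star A x) = cnj (\<omega> x))}"

text \<open>For a seminorm \<open>p\<close>, these are the star characters in the polar of its unit
  ball.\<close>

definition dominated_characters :: "'a star_algebra \<Rightarrow> ('a \<Rightarrow> real) \<Rightarrow> ('a \<Rightarrow> complex) set" where
  "dominated_characters A p = {\<omega> \<in> star_characters A. \<forall>x\<in>carrier A. cmod (\<omega> x) \<le> p x}"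

lemma characters_eq_star_characters:
  "characters A = {\<omega> \<in> star_characters A. continuous_map (topo A) euclidean \<omega>}"
  by (auto simp: characters_def star_characters_def pro_cstar_hom_def ring_hom_def complex_star_algebra_def)

lemma star_characterD:
  assumes "\<omega> \<in> star_characters A"
  shows "\<omega> \<in> extensional (carrier A)" "\<omega> \<one>\<^bsub>A\<^esub> = 1"
    "\<And>x y. x \<in> carrier A \<Longrightarrow> y \<in> carrier A \<Longrightarrow> \<omega> (x \<oplus>\<^bsub>A\<^esub> y) = \<omega> x + \<omega> y"
    "\<And>x y. x \<in> carrier A \<Longrightarrow> y \<in> carrier A \<Longrightarrow> \<omega> (x \<otimes>\<^bsub>A\<^esub> y) = \<omega> x * \<omega> y"
    "\<And>c x. x \<in> carrier A \<Longrightarrow> \<omega> (c \<odot>\<^bsub>A\<^esub> x) = c * \<omega> x"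
    "\<And>x. x \<in> carrier A \<Longrightarrow> \<omega> (star A x) = cnj (\<omega> x)"
  using assms by (auto simp: star_characters_def)

lemma (in comm_star_algebra) star_character_diff:
  assumes "\<omega> \<in> star_characters A" "x \<in> carrier A" "y \<in> carrier A"
  shows "\<omega> (x \<ominus> y) = \<omega> x - \<omega> y"
  using assms by (simp add: a_minus_def uminus_smult star_characterD)

lemma (in comm_star_algebra) cstar_seminorm_star_character:
  assumes "\<omega> \<in> star_characters A"
  shows "cstar_seminorm A (\<lambda>x. cmod (\<omega> x))"
  using star_characterD[OF assms]
  by (auto simp: cstar_seminorm_def norm_mult norm_triangle_ineq power2_eq_square)

lemma (in multiplicative_cstar_seminormed) eigenvalue_star_character:
  "eigenvalue \<in> star_characters A"
proof -
  have "eigenvalue \<in> extensional (carrier A)" by (simp add: eigenvalue_def)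
  then show ?thesis
    using eigenvalue_hom eigenvalue_hom(3)[OF one_closed one_closed] by (simp add: star_characters_def)
qed

lemma (in cstar_seminormed) norming_character:
  assumes "a \<in> carrier A" "0 < p a"
  obtains \<omega> where "\<omega> \<in> dominated_characters A p" "cmod (\<omega> a) = p a"
proof -
  obtain q where q: "cstar_seminorm A q" "q \<one> = 1" "q a = p a"
    "\<And>x. x \<in> carrier A \<Longrightarrow> q x \<le> p x"
    "\<And>x y. x \<in> carrier A \<Longrightarrow> y \<in> carrier A \<Longrightarrow> q (x \<otimes> y) = q x * q y"
    using multiplicative_minorant[OF assms] by blast
  then interpret q: multiplicative_cstar_seminormed A q by unfold_locales
  show ?thesis
    using that[of q.eigenvalue] q.eigenvalue_star_character q.cmod_eigenvalue q(3,4) assms(1)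
    by (simp add: dominated_characters_def)
qed

text \<open>The modulus of a continuous character is a continuous C*-seminorm and so lies below a
  member of \<open>P\<close>; conversely, domination controls differences by linearity.\<close>

lemma (in cstar_family_topology) character_iff:
  "\<omega> \<in> characters A \<longleftrightarrow> (\<exists>p\<in>P. \<omega> \<in> dominated_characters A p)"
proof
  assume "\<omega> \<in> characters A"
  then have \<omega>: "\<omega> \<in> star_characters A" "continuous_map (topo A) euclidean \<omega>"
    by (auto simp: characters_eq_star_characters)
  have "continuous_cstar_seminorm A (\<lambda>x. cmod (\<omega> x))"
    using cstar_seminorm_star_character[OF \<omega>(1)] continuous_map_norm[OF \<omega>(2)]
    by (simp add: continuous_cstar_seminorm_def)
  then show "\<exists>p\<in>P. \<omega> \<in> dominated_characters A p"
    using \<omega>(1) by (auto simp: continuous_cstar_seminorm_iff dominated_characters_def)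
next
  assume "\<exists>p\<in>P. \<omega> \<in> dominated_characters A p"
  then obtain p where p: "p \<in> P" and \<omega>: "\<omega> \<in> star_characters A"
    and le: "\<And>x. x \<in> carrier A \<Longrightarrow> cmod (\<omega> x) \<le> p x"
    by (auto simp: dominated_characters_def)
  have "continuous_map (topo A) euclidean \<omega>"
    unfolding continuous_map_def
  proof (intro conjI allI impI)
    fix V :: "complex set" assume "openin euclidean V"
    then have V: "open V" by simp
    have "\<exists>p\<in>P. \<exists>r>0. \<forall>y\<in>carrier A. p (y \<ominus> x) < r \<longrightarrow> y \<in> {x \<in> carrier A. \<omega> x \<in> V}"
      if x: "x \<in> {x \<in> carrier A. \<omega> x \<in> V}" for x
    proof -
      obtain e where e: "0 < e" "\<And>v. dist v (\<omega> x) < e \<Longrightarrow> v \<in> V"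
        using V x unfolding open_dist by blast
      have "\<omega> y \<in> V" if "y \<in> carrier A" "p (y \<ominus> x) < e" for y
        using e(2)[of "\<omega> y"] le[of "y \<ominus> x"] that x by (simp add: dist_norm star_character_diff[OF \<omega>])
      with e(1) p show ?thesis by blast
    qed
    then show "openin (topo A) {x \<in> topspace (topo A). \<omega> x \<in> V}"
      unfolding openin_topo_iff topspace_eq by blast
  qed auto
  with \<omega> show "\<omega> \<in> characters A" by (simp add: characters_eq_star_characters)
qed

text \<open>Coordinates outside \<open>I\<close> are constant on extensional functions, so the
  product topology over \<open>I\<close> is induced from the full function type. This makes
  \<open>compact\<close>, \<open>continuous_on\<close> and Stone-Weierstrass available for sets of
  characters.\<close>

lemma product_topology_euclidean_eq:
  "product_topology (\<lambda>_. euclidean :: 'b::topological_space topology) I = top_of_set (extensional I)"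
  (is "?P = ?E")
proof -
  have top: "topspace ?P = extensional I" by (auto simp: PiE_def)
  have "continuous_map ?P ?E (\<lambda>x. x)"
    unfolding continuous_map_in_subtopology euclidean_product_topology[symmetric]
      continuous_map_componentwise_UNIV
  proof (intro conjI allI)
    fix i
    show "continuous_map ?P euclidean (\<lambda>x. x i)"
    proof (cases "i \<in> I")
      case False
      show ?thesis
        by (rule continuous_map_eq[of _ _ "\<lambda>_. undefined"])
          (use False in \<open>auto simp: extensional_def PiE_def\<close>)
    qed (rule continuous_map_product_projection)
  qed (use top in auto)
  moreover have "continuous_map ?E ?P (\<lambda>x. x)"
    unfolding continuous_map_componentwise
    by (auto intro: continuous_on_product_coordinates continuous_on_subset)
  ultimately have "homeomorphic_map ?P ?E (\<lambda>x. x)"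
    unfolding homeomorphic_map_maps homeomorphic_maps_def by blast
  then have "openin ?P U \<longleftrightarrow> U \<subseteq> extensional I \<and> openin ?E U" for U
    using homeomorphic_map_openness_eq[of ?P ?E "\<lambda>x. x" U] top by simp
  then show ?thesis
    unfolding topology_eq using openin_subset[of ?E] by auto
qed

lemma character_space_eq: "character_space A = top_of_set (characters A)"
proof -
  have "characters A \<subseteq> extensional (carrier A)"
    by (auto simp: characters_def pro_cstar_hom_def)
  then show ?thesis
    by (simp add: character_space_def product_topology_euclidean_eq subtopology_subtopology Int_absorb1)
qed

lemma points_Spec [simp]: "points (Spec A) = characters A"
  by (simp add: Spec_def character_space_eq)

text \<open>Complete regularity and the Hausdorff property pass from the complex plane to products
  and subspaces.\<close>

lemma Tychonoff_character_space: "Tychonoff_space (character_space A)"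
proof -
  have "completely_regular_space (euclidean :: complex topology)"
    by (simp add: metrizable_imp_completely_regular_space metrizable_space_euclidean)
  then have "completely_regular_space (character_space A)"
    unfolding character_space_def
    by (intro completely_regular_space_subtopology) (simp add: completely_regular_space_product_topology)
  moreover have "Hausdorff_space (character_space A)"
    unfolding character_space_def
    by (intro Hausdorff_space_subtopology) (simp add: Hausdorff_space_product_topology)
  ultimately show ?thesis by (simp add: Tychonoff_space_def Hausdorff_imp_t1_space)
qed

text \<open>As in the Banach-Alaoglu theorem: a closed subset of a product of discs, which is
  compact by Tychonoff's theorem. Closedness holds because star characters are given by pointwise
  equations.\<close>

lemma compact_dominated_characters: "compact (dominated_characters A p)"
proof -
  define B where "B = PiE (carrier A) (\<lambda>x. cball (0::complex) (p x))"
  have "compactin (product_topology (\<lambda>_. euclidean) (carrier A)) B"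
    unfolding B_def compactin_PiE by auto
  then have "compact B"
    unfolding product_topology_euclidean_eq by (simp add: compactin_subtopology)
  moreover have "closed {\<omega> :: 'a \<Rightarrow> complex.
     (\<forall>x\<in>carrier A. \<forall>y\<in>carrier A.
        \<omega> (x \<oplus>\<^bsub>A\<^esub> y) = \<omega> x + \<omega> y \<and> \<omega> (x \<otimes>\<^bsub>A\<^esub> y) = \<omega> x * \<omega> y) \<and>
     \<omega> \<one>\<^bsub>A\<^esub> = 1 \<and>
     (\<forall>c. \<forall>x\<in>carrier A. \<omega> (c \<odot>\<^bsub>A\<^esub> x) = c * \<omega> x \<and> \<omega> (star A x) = cnj (\<omega> x))}" (is "closed ?C")
    unfolding Ball_def
    by (intro closed_Collect_conj closed_Collect_all closed_Collect_imp closed_Collect_eq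
        open_Collect_const continuous_intros continuous_on_product_coordinates)
  ultimately have "compact (B \<inter> ?C)" by (rule compact_Int_closed)
  moreover have "dominated_characters A p = B \<inter> ?C"
    by (auto simp: dominated_characters_def star_characters_def B_def PiE_def)
  ultimately show ?thesis by simp
qed

section \<open>Stone-Weierstrass approximation on dominated characters\<close>

lemma continuous_on_evaluation: "continuous_on S (\<lambda>\<omega>. \<omega> x)"
  by (rule continuous_on_subset[OF continuous_on_product_coordinates]) simp

text \<open>The function ring consists of the continuous real functions that some algebra element
  represents exactly on \<open>?K\<close>; sums, products and constants come from the algebra
  operations, point separation from self-adjoint parts.\<close>

lemma (in cstar_seminormed) dominated_characters_approx_real:
  assumes f: "continuous_on (dominated_characters A p) f" and e: "0 < e"
  shows "\<exists>a\<in>carrier A. \<forall>\<omega>\<in>dominated_characters A p. cmod (\<omega> a - complex_of_real (f \<omega>)) < e"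
proof -
  let ?K = "dominated_characters A p"
  have K: "\<omega> \<in> star_characters A" if "\<omega> \<in> ?K" for \<omega>
    using that by (simp add: dominated_characters_def)
  interpret function_ring_on "{f. \<exists>a\<in>carrier A. \<forall>\<omega>\<in>?K. \<omega> a = complex_of_real (f \<omega>)}
      \<inter> {f. continuous_on ?K f}" ?K
  proof
    show "compact ?K" by (rule compact_dominated_characters)
    fix f g assume f: "f \<in> {f. \<exists>a\<in>carrier A. \<forall>\<omega>\<in>?K. \<omega> a = complex_of_real (f \<omega>)} \<inter> {f. continuous_on ?K f}"
    then show "continuous_on ?K f" by simp
    assume g: "g \<in> {f. \<exists>a\<in>carrier A. \<forall>\<omega>\<in>?K. \<omega> a = complex_of_real (f \<omega>)} \<inter> {f. continuous_on ?K f}"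
    obtain a b where ab: "a \<in> carrier A" "b \<in> carrier A"
      "\<And>\<omega>. \<omega> \<in> ?K \<Longrightarrow> \<omega> a = complex_of_real (f \<omega>)" "\<And>\<omega>. \<omega> \<in> ?K \<Longrightarrow> \<omega> b = complex_of_real (g \<omega>)"
      using f g by auto
    then have "\<omega> (a \<oplus> b) = complex_of_real (f \<omega> + g \<omega>)" "\<omega> (a \<otimes> b) = complex_of_real (f \<omega> * g \<omega>)"
      if "\<omega> \<in> ?K" for \<omega>
      using that star_characterD[OF K[OF that]] by simp_all
    with f g ab(1,2) show
      "(\<lambda>x. f x + g x) \<in> {f. \<exists>a\<in>carrier A. \<forall>\<omega>\<in>?K. \<omega> a = complex_of_real (f \<omega>)} \<inter> {f. continuous_on ?K f}"
      "(\<lambda>x. f x * g x) \<in> {f. \<exists>a\<in>carrier A. \<forall>\<omega>\<in>?K. \<omega> a = complex_of_real (f \<omega>)} \<inter> {f. continuous_on ?K f}"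
      by (auto intro: continuous_on_add continuous_on_mult)
  next
    fix c :: real
    have "\<omega> (complex_of_real c \<odot> \<one>) = complex_of_real c" if "\<omega> \<in> ?K" for \<omega>
      using star_characterD[OF K[OF that]] by simp
    then show "(\<lambda>_. c) \<in> {f. \<exists>a\<in>carrier A. \<forall>\<omega>\<in>?K. \<omega> a = complex_of_real (f \<omega>)} \<inter> {f. continuous_on ?K f}"
      by (auto intro!: bexI[of _ "complex_of_real c \<odot> \<one>"])
  next
    fix \<phi> \<psi> assume \<phi>: "\<phi> \<in> ?K" and \<psi>: "\<psi> \<in> ?K" and ne: "\<phi> \<noteq> \<psi>"
    have sep: "\<exists>f\<in>{f. \<exists>a\<in>carrier A. \<forall>\<omega>\<in>?K. \<omega> a = complex_of_real (f \<omega>)} \<inter> {f. continuous_on ?K f}. f \<phi> \<noteq> f \<psi>"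
      if a: "a \<in> carrier A" and ne: "Re (\<phi> a) \<noteq> Re (\<psi> a)" for a
    proof (rule bexI[of _ "\<lambda>\<omega>. Re (\<omega> a)"], rule ne, intro IntI CollectI)
      \<comment> \<open>The self-adjoint part of \<open>a\<close>, on which a character takes the
        real value \<open>Re (\<omega> a)\<close>.\<close>
      let ?h = "(1 / 2) \<odot> (a \<oplus> star A a)"
      have "\<omega> ?h = complex_of_real (Re (\<omega> a))" if "\<omega> \<in> ?K" for \<omega>
        using star_characterD[OF K[OF that]] a by (simp add: complex_add_cnj)
      then show "\<exists>b\<in>carrier A. \<forall>\<omega>\<in>?K. \<omega> b = complex_of_real (Re (\<omega> a))"
        using a by (intro bexI[of _ ?h]) auto
    qed (intro continuous_intros continuous_on_evaluation)
    have ext: "\<phi> \<in> extensional (carrier A)" "\<psi> \<in> extensional (carrier A)"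
      using \<phi> \<psi> K star_characterD(1) by blast+
    obtain x where x: "x \<in> carrier A" "\<phi> x \<noteq> \<psi> x"
      using extensionalityI[OF ext] ne by blast
    show "\<exists>f\<in>{f. \<exists>a\<in>carrier A. \<forall>\<omega>\<in>?K. \<omega> a = complex_of_real (f \<omega>)} \<inter> {f. continuous_on ?K f}. f \<phi> \<noteq> f \<psi>"
    proof (cases "Re (\<phi> x) = Re (\<psi> x)")
      case True
      \<comment> \<open>Equal real parts force different imaginary parts, and multiplication by
        \<open>\<i>\<close> turns these into real parts up to sign.\<close>
      then have "Re (\<phi> (\<i> \<odot> x)) \<noteq> Re (\<psi> (\<i> \<odot> x))"
        using x K \<phi> \<psi> by (simp add: star_characterD complex_eq_iff)
      then show ?thesis using sep[of "\<i> \<odot> x"] x by blast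
    qed (use sep x in blast)
  qed
  obtain g where "\<exists>a\<in>carrier A. \<forall>\<omega>\<in>?K. \<omega> a = complex_of_real (g \<omega>)" "\<And>\<omega>. \<omega> \<in> ?K \<Longrightarrow> \<bar>f \<omega> - g \<omega>\<bar> < e"
    using Stone_Weierstrass_basic[OF f e] by blast
  then obtain a where "a \<in> carrier A" and a: "\<And>\<omega>. \<omega> \<in> ?K \<Longrightarrow> \<omega> a = complex_of_real (g \<omega>) \<and> \<bar>f \<omega> - g \<omega>\<bar> < e"
    by blast
  moreover have "cmod (\<omega> a - complex_of_real (f \<omega>)) < e" if "\<omega> \<in> ?K" for \<omega>
    using a[OF that] by (simp add: abs_minus_commute flip: of_real_diff)
  ultimately show ?thesis by blast
qed

lemma (in cstar_seminormed) dominated_characters_approx: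
  assumes f: "continuous_on (dominated_characters A p) f" and e: "0 < e"
  shows "\<exists>a\<in>carrier A. \<forall>\<omega>\<in>dominated_characters A p. cmod (\<omega> a - f \<omega>) < e"
proof -
  obtain a where a: "a \<in> carrier A"
      "\<And>\<omega>. \<omega> \<in> dominated_characters A p \<Longrightarrow> cmod (\<omega> a - complex_of_real (Re (f \<omega>))) < e / 2"
    using dominated_characters_approx_real[OF continuous_on_Re[OF f], of "e / 2"] e by auto
  obtain b where b: "b \<in> carrier A"
      "\<And>\<omega>. \<omega> \<in> dominated_characters A p \<Longrightarrow> cmod (\<omega> b - complex_of_real (Im (f \<omega>))) < e / 2"
    using dominated_characters_approx_real[OF continuous_on_Im[OF f], of "e / 2"] e by auto
  have "cmod (\<omega> (a \<oplus> \<i> \<odot> b) - f \<omega>) < e" if \<omega>: "\<omega> \<in> dominated_characters A p" for \<omega>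
  proof -
    have "\<omega> \<in> star_characters A" using \<omega> by (simp add: dominated_characters_def)
    then have "\<omega> (a \<oplus> \<i> \<odot> b) - f \<omega> =
        (\<omega> a - complex_of_real (Re (f \<omega>))) + \<i> * (\<omega> b - complex_of_real (Im (f \<omega>)))"
      using a b by (subst complex_eq[of "f \<omega>"]) (simp add: star_characterD algebra_simps)
    also have "cmod \<dots> \<le> cmod (\<omega> a - complex_of_real (Re (f \<omega>))) + cmod (\<omega> b - complex_of_real (Im (f \<omega>)))"
      by (rule order_trans[OF norm_triangle_ineq]) (simp add: norm_mult)
    finally show ?thesis using a(2)[OF \<omega>] b(2)[OF \<omega>] by linarith
  qed
  then show ?thesis using a b by (intro bexI[of _ "a \<oplus> \<i> \<odot> b"]) auto
qed

lemma (in cstar_seminormed) le_if_dominated_characters_le: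
  assumes x: "x \<in> carrier A" and c: "0 \<le> c"
    and le: "\<And>\<omega>. \<omega> \<in> dominated_characters A p \<Longrightarrow> cmod (\<omega> x) \<le> c"
  shows "p x \<le> c"
proof (cases "0 < p x")
  case True
  then show ?thesis using norming_character[OF x] le by metis
qed (use c in linarith)

text \<open>The zero seminorm makes the set of continuous C*-seminorms nonempty, and pointwise
  maxima make it directed: a maximum inherits the C*-identity because squaring is monotone on
  nonnegative reals.\<close>

sublocale comm_pro_cstar_algebra \<subseteq> cstar_family_topology A "Collect (continuous_cstar_seminorm A)"
proof
  show fam: "cstar_seminorm A p" if "p \<in> Collect (continuous_cstar_seminorm A)" for p
    using that by (simp add: continuous_cstar_seminorm_def)
  have "continuous_cstar_seminorm A (\<lambda>x. 0)"
    by (simp add: continuous_cstar_seminorm_def cstar_seminorm_def)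
  then show "Collect (continuous_cstar_seminorm A) \<noteq> {}" by blast
  show dir: "\<exists>s\<in>Collect (continuous_cstar_seminorm A). \<forall>x\<in>carrier A. p x \<le> s x \<and> q x \<le> s x"
    if "p \<in> Collect (continuous_cstar_seminorm A)" "q \<in> Collect (continuous_cstar_seminorm A)" for p q
  proof -
    interpret p: cstar_seminormed A p by unfold_locales (rule fam[OF that(1)])
    interpret q: cstar_seminormed A q by unfold_locales (rule fam[OF that(2)])
    let ?s = "\<lambda>x. max (p x) (q x)"
    have "cstar_seminorm A ?s"
      unfolding cstar_seminorm_def
    proof (intro conjI ballI allI)
      fix x y c assume x: "x \<in> carrier A"
      show "0 \<le> ?s x" using p.nonneg[OF x] by linarith
      show "?s (c \<odot> x) = cmod c * ?s x"
        using x by (simp add: p.smult q.smult max_mult_distrib_left)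
      show "?s (star A x \<otimes> x) = (?s x)\<^sup>2"
        using x p.nonneg[OF x] q.nonneg[OF x] unfolding p.star_mult_self[OF x] q.star_mult_self[OF x]
        by (auto simp: max_def power2_le_iff_abs_le abs_le_square_iff intro: power2_le_imp_le dest: power2_le_imp_le)
      assume y: "y \<in> carrier A"
      show "?s (x \<oplus> y) \<le> ?s x + ?s y"
        using p.add_le[OF x y] q.add_le[OF x y] by linarith
      have "p x * p y \<le> ?s x * ?s y" "q x * q y \<le> ?s x * ?s y"
        using x y p.nonneg[OF x] p.nonneg[OF y] q.nonneg[OF x] q.nonneg[OF y] by (auto intro!: mult_mono simp: le_max_iff_disj)
      then show "?s (x \<otimes> y) \<le> ?s x * ?s y"
        using p.mult_le[OF x y] q.mult_le[OF x y] by linarith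
    qed
    moreover have "continuous_map (topo A) euclideanreal ?s"
      using that by (intro continuous_map_real_max) (auto simp: continuous_cstar_seminorm_def)
    ultimately show ?thesis
      by (intro bexI[of _ ?s]) (auto simp: continuous_cstar_seminorm_def)
  qed
  interpret cstar_family A "Collect (continuous_cstar_seminorm A)"
    by unfold_locales (use fam dir \<open>Collect _ \<noteq> {}\<close> in auto)
  show "topo A = generated_topology"
    using generated by (simp add: generated_topology_def)
qed

section \<open>The spectrum of a pro-C*-algebra\<close>

context comm_pro_cstar_algebra
begin

lemma dominated_characters_subset:
  "continuous_cstar_seminorm A p \<Longrightarrow> dominated_characters A p \<subseteq> characters A"
  using character_iff by blast

lemma separating_seminorm:
  assumes x: "x \<in> carrier A" "x \<noteq> \<zero>"
  obtains p where "continuous_cstar_seminorm A p" "0 < p x"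
proof -
  obtain U where U: "openin (topo A) U" "\<zero> \<in> U" "x \<notin> U"
    using Hausdorff x unfolding Hausdorff_space_def disjnt_iff by (metis topspace_eq zero_closed)
  then obtain p r where p: "continuous_cstar_seminorm A p" "0 < r"
      "\<And>y. y \<in> carrier A \<Longrightarrow> p (y \<ominus> \<zero>) < r \<Longrightarrow> y \<in> U"
    unfolding openin_topo_iff by blast
  have "\<not> p x < r" using p(3)[of x] x U(3) by (auto simp: a_minus_def)
  then show ?thesis using that[OF p(1)] p(2) by linarith
qed

text \<open>
  Stone--Weierstrass approximates \<open>f\<close> by Gelfand transforms uniformly on each set of characters
  dominated by a seminorm; since the Gelfand transform is isometric there, the approximants form
  a Cauchy filter.
\<close>

lemma represent_locally_continuous:
  assumes f: "\<And>p. continuous_cstar_seminorm A p \<Longrightarrow> continuous_on (dominated_characters A p) f"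
  obtains a where "a \<in> carrier A" "\<And>\<omega>. \<omega> \<in> characters A \<Longrightarrow> \<omega> a = f \<omega>"
proof -
  define S where "S p e = {a \<in> carrier A. \<forall>\<omega>\<in>dominated_characters A p. cmod (\<omega> a - f \<omega>) < e}" for p e
  define I where "I = {(p, e). continuous_cstar_seminorm A p \<and> (0::real) < e}"
  \<comment> \<open>The sets of approximants form a filter base: a common upper bound of two
    seminorms together with the smaller tolerance refines two of them.\<close>
  define \<Phi> where "\<Phi> = (INF (p, e)\<in>I. principal (S p e))"
  have I_nonempty: "I \<noteq> {}" using nonempty by (auto simp: I_def intro: exI[of _ 1])
  have S_mono: "S s c \<subseteq> S p e" if "\<forall>x\<in>carrier A. p x \<le> s x" "c \<le> e" for p s c e
  proof -
    have "dominated_characters A p \<subseteq> dominated_characters A s"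
      using that(1) by (auto simp: dominated_characters_def intro: order_trans)
    then show ?thesis using that(2) by (force simp: S_def)
  qed
  have ev: "eventually Q \<Phi> \<longleftrightarrow> (\<exists>(p, e)\<in>I. \<forall>a\<in>S p e. Q a)" for Q
  proof -
    have "\<exists>k\<in>I. (case k of (p, e) \<Rightarrow> principal (S p e)) \<le>
        inf (case i of (p, e) \<Rightarrow> principal (S p e)) (case j of (p, e) \<Rightarrow> principal (S p e))"
      if ij: "i \<in> I" "j \<in> I" for i j
    proof -
      obtain p e q d where pq: "i = (p, e)" "j = (q, d)" "continuous_cstar_seminorm A p" "0 < e"
          "continuous_cstar_seminorm A q" "0 < d"
        using ij by (auto simp: I_def)
      obtain s where s: "continuous_cstar_seminorm A s" "\<forall>x\<in>carrier A. p x \<le> s x" "\<forall>x\<in>carrier A. q x \<le> s x"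
        using directed[of p q] pq by auto
      show ?thesis
        using S_mono[OF s(2), of "min e d" e] S_mono[OF s(3), of "min e d" d] s(1) pq
        by (intro bexI[of _ "(s, min e d)"]) (auto simp: I_def)
    qed
    from eventually_INF_base[OF I_nonempty this] show ?thesis
      unfolding \<Phi>_def by (auto simp: eventually_principal split_beta)
  qed
  have S_nonempty: "\<exists>a. a \<in> S p e" if "continuous_cstar_seminorm A p" "0 < e" for p e
  proof -
    interpret cstar_seminormed A p using that by unfold_locales (simp add: continuous_cstar_seminorm_def)
    show ?thesis using dominated_characters_approx[OF f[OF that(1)] that(2)] by (auto simp: S_def)
  qed
  have ev_S: "eventually (\<lambda>a. a \<in> S p e) \<Phi>" if "continuous_cstar_seminorm A p" "0 < e" for p e
    unfolding ev using that by (intro bexI[of _ "(p, e)"]) (auto simp: I_def)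
  have \<Phi>: "\<Phi> \<noteq> bot"
    using S_nonempty by (fastforce simp: trivial_limit_def ev I_def)
  have "cauchy_filter_in A \<Phi>"
    unfolding cauchy_filter_in_def
  proof (intro conjI allI impI)
    show "\<forall>\<^sub>F x in \<Phi>. x \<in> carrier A"
      using I_nonempty by (auto simp: ev S_def)
    fix U assume "openin (topo A) U \<and> \<zero> \<in> U"
    then obtain p r where p: "continuous_cstar_seminorm A p" "0 < r"
        "\<And>y. y \<in> carrier A \<Longrightarrow> p (y \<ominus> \<zero>) < r \<Longrightarrow> y \<in> U"
      unfolding openin_topo_iff by blast
    interpret cstar_seminormed A p using p(1) by unfold_locales (simp add: continuous_cstar_seminorm_def)
    \<comment> \<open>Thirds are taken because \<open>le_if_dominated_characters_le\<close> returns
      a weak inequality: two errors give \<open>2 * (r / 3)\<close>, still strictly below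
      \<open>r\<close>.\<close>
    have "x \<ominus> y \<in> U" if "x \<in> S p (r / 3)" "y \<in> S p (r / 3)" for x y
    proof -
      have xy: "x \<in> carrier A" "y \<in> carrier A" using that by (auto simp: S_def)
      have "cmod (\<omega> (x \<ominus> y)) \<le> 2 * (r / 3)" if \<omega>: "\<omega> \<in> dominated_characters A p" for \<omega>
      proof -
        have "cmod (\<omega> x - f \<omega>) < r / 3" "cmod (\<omega> y - f \<omega>) < r / 3"
          using \<open>x \<in> S p (r / 3)\<close> \<open>y \<in> S p (r / 3)\<close> \<omega> by (auto simp: S_def)
        then have "cmod (\<omega> x - \<omega> y) \<le> 2 * (r / 3)"
          using norm_triangle_ineq4[of "\<omega> x - f \<omega>" "\<omega> y - f \<omega>"] by simp
        moreover have "\<omega> \<in> star_characters A" using \<omega> by (simp add: dominated_characters_def)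
        ultimately show ?thesis using xy by (simp add: star_character_diff)
      qed
      then have "p (x \<ominus> y) \<le> 2 * (r / 3)"
        using xy p(2) by (intro le_if_dominated_characters_le) auto
      then show ?thesis using p(2) p(3)[of "x \<ominus> y"] xy by (simp add: a_minus_def)
    qed
    moreover have "S p (r / 3) \<subseteq> carrier A" by (auto simp: S_def)
    ultimately show "\<exists>S\<subseteq>carrier A. (\<forall>\<^sub>F x in \<Phi>. x \<in> S) \<and> (\<forall>x\<in>S. \<forall>y\<in>S. x \<ominus> y \<in> U)"
      using ev_S[OF p(1), of "r / 3"] p(2) by (intro exI[of _ "S p (r / 3)"]) simp
  qed (rule \<Phi>)
  then obtain l where l: "limitin (topo A) (\<lambda>x. x) l \<Phi>" using complete by blast
  have l_carrier: "l \<in> carrier A" using l by (simp add: limitin_def topspace_eq)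
  moreover have "\<omega> l = f \<omega>" if \<omega>: "\<omega> \<in> characters A" for \<omega>
  proof -
    obtain p where p: "continuous_cstar_seminorm A p" and \<omega>p: "\<omega> \<in> dominated_characters A p"
      using \<omega> character_iff by blast
    have \<omega>s: "\<omega> \<in> star_characters A" using \<omega>p by (simp add: dominated_characters_def)
    have "cmod (\<omega> l - f \<omega>) \<le> e" if e: "0 < e" for e
    proof -
      have "openin (topo A) {y \<in> carrier A. p (y \<ominus> l) < e / 2}"
        using p l_carrier e by (intro openin_ball) auto
      moreover have "p (l \<ominus> l) < e / 2"
      proof -
        interpret cstar_seminormed A p using p by unfold_locales (simp add: continuous_cstar_seminorm_def)
        show ?thesis using l_carrier e by (simp add: a_minus_def r_neg)
      qed
      ultimately have "\<forall>\<^sub>F a in \<Phi>. a \<in> {y \<in> carrier A. p (y \<ominus> l) < e / 2}"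
        using l l_carrier unfolding limitin_def by blast
      moreover have "\<forall>\<^sub>F a in \<Phi>. a \<in> S p (e / 2)" using ev_S[OF p] e by simp
      ultimately have "\<forall>\<^sub>F a in \<Phi>. a \<in> {y \<in> carrier A. p (y \<ominus> l) < e / 2} \<and> a \<in> S p (e / 2)"
        by (rule eventually_conj)
      from eventually_happens'[OF \<Phi> this]
      obtain a where a: "a \<in> carrier A" "p (a \<ominus> l) < e / 2" "cmod (\<omega> a - f \<omega>) < e / 2"
        using \<omega>p by (auto simp: S_def)
      have "cmod (\<omega> (a \<ominus> l)) \<le> p (a \<ominus> l)"
        using \<omega>p a(1) l_carrier by (simp add: dominated_characters_def)
      then have "cmod (\<omega> a - \<omega> l) < e / 2"
        using a(2) by (simp add: star_character_diff[OF \<omega>s a(1) l_carrier])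
      then show ?thesis using a(3) norm_triangle_ineq4[of "\<omega> a - f \<omega>" "\<omega> a - \<omega> l"] by simp
    qed
    then have "cmod (\<omega> l - f \<omega>) \<le> 0" by (rule field_le_epsilon) simp
    then show ?thesis by simp
  qed
  ultimately show ?thesis by (rule that)
qed

lemma Spec_family_iff:
  "K \<in> snd (Spec A) \<longleftrightarrow>
     compact K \<and> (\<exists>p. continuous_cstar_seminorm A p \<and> K \<subseteq> dominated_characters A p)"
proof
  assume "K \<in> snd (Spec A)"
  then obtain p where "compact K" "K \<subseteq> characters A" "continuous_cstar_seminorm A p"
    "\<forall>\<omega>\<in>K. \<forall>a\<in>carrier A. cmod (\<omega> a) \<le> p a"
    by (auto simp: Spec_def character_space_eq compactin_subtopology)
  then show "compact K \<and> (\<exists>p. continuous_cstar_seminorm A p \<and> K \<subseteq> dominated_characters A p)"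
    by (auto simp: dominated_characters_def characters_eq_star_characters)
next
  assume "compact K \<and> (\<exists>p. continuous_cstar_seminorm A p \<and> K \<subseteq> dominated_characters A p)"
  then obtain p where p: "compact K" "continuous_cstar_seminorm A p" "K \<subseteq> dominated_characters A p" by blast
  then have "K \<subseteq> characters A" using dominated_characters_subset by blast
  with p show "K \<in> snd (Spec A)"
    by (auto simp: Spec_def character_space_eq compactin_subtopology dominated_characters_def)
qed

lemma Spec_fd_space: "Spec A \<in> fd_spaces"
proof -
  have "functionally_distinguished (character_space A) (snd (Spec A))"
    unfolding functionally_distinguished_def
  proof (intro conjI ballI allI impI)
    show "compactin (character_space A) K" if "K \<in> snd (Spec A)" for K
      using that by (simp add: Spec_def)
    show "{\<omega>} \<in> snd (Spec A)" if "\<omega> \<in> topspace (character_space A)" for \<omega>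
      using that character_iff unfolding Spec_family_iff by (simp add: character_space_eq)
    show "\<Union>\<K> \<in> snd (Spec A)" if "finite \<K> \<and> \<K> \<subseteq> snd (Spec A)" for \<K>
    proof -
      have "finite \<K>" "\<K> \<subseteq> snd (Spec A)" using that by auto
      then show ?thesis
      proof (induction \<K>)
        case empty
        then show ?case using nonempty by (auto simp: Spec_family_iff)
      next
        case (insert K \<K>)
        then obtain p q where pq: "continuous_cstar_seminorm A p" "K \<subseteq> dominated_characters A p"
          "continuous_cstar_seminorm A q" "\<Union>\<K> \<subseteq> dominated_characters A q" "compact K" "compact (\<Union>\<K>)"
          by (auto simp: Spec_family_iff)
        obtain s where s: "continuous_cstar_seminorm A s" "\<forall>x\<in>carrier A. p x \<le> s x \<and> q x \<le> s x"
          using directed[of p q] pq by auto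
        then have "dominated_characters A p \<subseteq> dominated_characters A s"
          "dominated_characters A q \<subseteq> dominated_characters A s"
          by (auto simp: dominated_characters_def intro: order_trans)
        then show ?case
          using pq s(1) compact_Un[OF pq(5,6)] unfolding Spec_family_iff Union_insert by blast
      qed
    qed
    show "L \<in> snd (Spec A)" if "K \<in> snd (Spec A)" "L \<subseteq> K \<and> compactin (character_space A) L" for K L
      using that by (auto simp: Spec_def)
    fix f :: "('a \<Rightarrow> complex) \<Rightarrow> real"
    show "continuous_map (character_space A) euclideanreal f \<longleftrightarrow>
      (\<forall>K\<in>snd (Spec A). continuous_map (subtopology (character_space A) K) euclideanreal f)"
    proof
      assume R: "\<forall>K\<in>snd (Spec A). continuous_map (subtopology (character_space A) K) euclideanreal f"
      have "continuous_on (dominated_characters A p) (\<lambda>\<omega>. complex_of_real (f \<omega>))"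
        if p: "continuous_cstar_seminorm A p" for p
      proof -
        \<comment> \<open>The whole dominated set is compact and hence itself a member of the
          family, so \<open>R\<close> applies to the sets required by
          \<open>represent_locally_continuous\<close>.\<close>
        have "dominated_characters A p \<in> snd (Spec A)"
          using p compact_dominated_characters unfolding Spec_family_iff by blast
        then have "continuous_on (dominated_characters A p) f"
          using R dominated_characters_subset[OF p]
          by (auto simp: character_space_eq subtopology_subtopology Int_absorb1)
        then show ?thesis by (rule continuous_on_of_real)
      qed
      then obtain a where a: "a \<in> carrier A" "\<And>\<omega>. \<omega> \<in> characters A \<Longrightarrow> \<omega> a = complex_of_real (f \<omega>)"
        using represent_locally_continuous by blast
      have "continuous_on (characters A) (\<lambda>\<omega>. Re (\<omega> a))"
        by (intro continuous_intros continuous_on_evaluation)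
      then have "continuous_on (characters A) f"
        by (rule continuous_on_eq) (simp add: a)
      then show "continuous_map (character_space A) euclideanreal f" by (simp add: character_space_eq)
    qed (rule ballI, rule continuous_map_from_subtopology)
  qed
  then show ?thesis
    using Tychonoff_character_space[of A] by (simp add: fd_spaces_def Spec_def)
qed

end

section \<open>Algebras of continuous functions\<close>

lemma continuous_map_complex_intros:
  fixes f g :: "'a \<Rightarrow> complex"
  assumes "continuous_map X euclidean f"
  shows "continuous_map X euclidean g \<Longrightarrow> continuous_map X euclidean (\<lambda>x. f x * g x)"
    and "continuous_map X euclidean (\<lambda>x. cnj (f x))"
    and "continuous_map X euclidean (\<lambda>x. Re (f x))"
    and "continuous_map X euclidean (\<lambda>x. Im (f x))"
  using assms by (simp_all add: continuous_map_atin tendsto_mult tendsto_cnj tendsto_Re tendsto_Im)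

lemma continuous_map_of_real:
  "continuous_map X euclideanreal f \<Longrightarrow> continuous_map X euclidean (\<lambda>x. complex_of_real (f x))"
  by (simp add: continuous_map_atin tendsto_of_real)

lemma
  shows carrier_FC: "carrier (FC X) = {f \<in> extensional (points X). continuous_map (fst X) euclidean f}"
    and mult_FC: "f \<otimes>\<^bsub>FC X\<^esub> g = (\<lambda>x\<in>points X. f x * g x)"
    and one_FC: "\<one>\<^bsub>FC X\<^esub> = (\<lambda>x\<in>points X. 1)"
    and zero_FC: "\<zero>\<^bsub>FC X\<^esub> = (\<lambda>x\<in>points X. 0)"
    and add_FC: "f \<oplus>\<^bsub>FC X\<^esub> g = (\<lambda>x\<in>points X. f x + g x)"
    and smult_FC: "c \<odot>\<^bsub>FC X\<^esub> f = (\<lambda>x\<in>points X. c * f x)"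
    and star_FC: "star (FC X) f = (\<lambda>x\<in>points X. cnj (f x))"
  by (simp_all add: FC_def Let_def)

lemma restrict_in_FC:
  "continuous_map (fst X) euclidean f \<Longrightarrow> (\<lambda>x\<in>points X. f x) \<in> carrier (FC X)"
  by (auto simp: carrier_FC intro: continuous_map_eq)

lemma FC_eqI:
  "f \<in> carrier (FC X) \<Longrightarrow> g \<in> carrier (FC X) \<Longrightarrow> (\<And>x. x \<in> points X \<Longrightarrow> f x = g x) \<Longrightarrow> f = g"
  by (auto simp: carrier_FC intro: extensionalityI)

lemma FC_closed:
  assumes "f \<in> carrier (FC X)"
  shows "g \<in> carrier (FC X) \<Longrightarrow> f \<otimes>\<^bsub>FC X\<^esub> g \<in> carrier (FC X)"
    and "g \<in> carrier (FC X) \<Longrightarrow> f \<oplus>\<^bsub>FC X\<^esub> g \<in> carrier (FC X)"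
    and "c \<odot>\<^bsub>FC X\<^esub> f \<in> carrier (FC X)"
    and "star (FC X) f \<in> carrier (FC X)"
  unfolding mult_FC add_FC smult_FC star_FC using assms
  by (auto intro!: restrict_in_FC continuous_map_complex_intros continuous_map_add simp: carrier_FC)

lemma FC_one_zero_closed: "\<one>\<^bsub>FC X\<^esub> \<in> carrier (FC X)" "\<zero>\<^bsub>FC X\<^esub> \<in> carrier (FC X)"
  unfolding one_FC zero_FC by (intro restrict_in_FC; simp)+

lemma cring_complex_ring: "cring complex_ring"
  by (rule cringI; (intro abelian_groupI comm_monoidI)?)
    (auto simp: complex_ring_def algebra_simps intro: exI[of _ "- _"] left_minus)

lemma cring_FC: "cring (FC X)"
proof (rule cringI)
  show "abelian_group (FC X)"
  proof (rule abelian_groupI)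
    fix f assume f: "f \<in> carrier (FC X)"
    then have "(-1) \<odot>\<^bsub>FC X\<^esub> f \<oplus>\<^bsub>FC X\<^esub> f = \<zero>\<^bsub>FC X\<^esub>"
      by (intro FC_eqI[OF FC_closed(2)] FC_closed FC_one_zero_closed)
        (auto simp: add_FC smult_FC zero_FC)
    then show "\<exists>g\<in>carrier (FC X). g \<oplus>\<^bsub>FC X\<^esub> f = \<zero>\<^bsub>FC X\<^esub>" using FC_closed(3)[OF f] by blast
  qed ((rule FC_eqI[where X = X])?;
      ((intro FC_closed FC_one_zero_closed; assumption) | simp add: add_FC zero_FC))+
  show "comm_monoid (FC X)"
    by (rule comm_monoidI; (rule FC_eqI[where X = X])?;
        ((intro FC_closed FC_one_zero_closed; assumption) | simp add: mult_FC one_FC))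
  show "(f \<oplus>\<^bsub>FC X\<^esub> g) \<otimes>\<^bsub>FC X\<^esub> h = f \<otimes>\<^bsub>FC X\<^esub> h \<oplus>\<^bsub>FC X\<^esub> g \<otimes>\<^bsub>FC X\<^esub> h"
    for f g h by (rule ext) (simp add: mult_FC add_FC algebra_simps)
qed

lemma comm_star_algebra_FC: "comm_star_algebra (FC X)"
proof (intro comm_star_algebra.intro comm_star_algebra_axioms.intro)
  show "algebra complex_ring (FC X)"
    by (rule algebraI[OF cring_complex_ring cring_FC]; (rule FC_eqI[where X = X])?;
        ((intro FC_closed FC_one_zero_closed; assumption) |
         simp add: complex_ring_def add_FC smult_FC mult_FC one_FC algebra_simps))
qed ((rule FC_eqI[where X = X])?; ((intro FC_closed FC_one_zero_closed; assumption) |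
    simp add: star_FC add_FC smult_FC mult_FC))+

interpretation FC: comm_star_algebra "FC X" for X :: "'a fd_space"
  by (rule comm_star_algebra_FC)

lemma diff_FC:
  assumes "f \<in> carrier (FC X)" "g \<in> carrier (FC X)"
  shows "f \<ominus>\<^bsub>FC X\<^esub> g = (\<lambda>x\<in>points X. f x - g x)"
proof (rule FC_eqI)
  show "(\<lambda>x\<in>points X. f x - g x) \<in> carrier (FC X)"
    using assms by (intro restrict_in_FC continuous_map_diff) (auto simp: carrier_FC)
  show "f \<ominus>\<^bsub>FC X\<^esub> g \<in> carrier (FC X)" using assms by simp
qed (use assms in \<open>simp_all add: a_minus_def FC.uminus_smult add_FC smult_FC\<close>)

text \<open>Inserting 0 gives the empty set norm 0 and does not change the supremum of a nonempty
  bounded set of moduli.\<close>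

definition sup_norm :: "'a set \<Rightarrow> ('a \<Rightarrow> complex) \<Rightarrow> real" where
  "sup_norm K f = Sup (insert 0 ((\<lambda>x. cmod (f x)) ` K))"

lemma sup_norm_le:
  "0 \<le> c \<Longrightarrow> (\<And>x. x \<in> K \<Longrightarrow> cmod (f x) \<le> c) \<Longrightarrow> sup_norm K f \<le> c"
  unfolding sup_norm_def by (rule cSup_least) auto

text \<open>The moduli on \<open>K\<close> together with 0 form a compact set, which contains its
  supremum. Hence strict bounds at all points amount to a strict bound on the norm, and this makes
  the basic open sets of \<open>FC X\<close> balls.\<close>

lemma
  assumes K: "compactin X K" and f: "continuous_map X euclidean f"
  shows le_sup_norm: "x \<in> K \<Longrightarrow> cmod (f x) \<le> sup_norm K f"
    and sup_norm_nonneg: "0 \<le> sup_norm K f"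
    and sup_norm_less_iff: "0 < r \<Longrightarrow> sup_norm K f < r \<longleftrightarrow> (\<forall>x\<in>K. cmod (f x) < r)"
proof -
  have "compactin euclideanreal ((\<lambda>x. cmod (f x)) ` K)"
    by (rule image_compactin[OF K continuous_map_norm[OF f]])
  then have c: "compact (insert 0 ((\<lambda>x. cmod (f x)) ` K))" by (simp add: compact_insert)
  then have bdd: "bdd_above (insert 0 ((\<lambda>x. cmod (f x)) ` K))"
    by (intro bounded_imp_bdd_above compact_imp_bounded)
  show le: "x \<in> K \<Longrightarrow> cmod (f x) \<le> sup_norm K f" for x
    unfolding sup_norm_def by (rule cSup_upper[OF _ bdd]) simp
  show "0 \<le> sup_norm K f"
    unfolding sup_norm_def by (rule cSup_upper[OF _ bdd]) simp
  have "sup_norm K f \<in> insert 0 ((\<lambda>x. cmod (f x)) ` K)"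
    unfolding sup_norm_def by (rule closed_contains_Sup[OF _ bdd compact_imp_closed[OF c]]) simp
  then show "0 < r \<Longrightarrow> sup_norm K f < r \<longleftrightarrow> (\<forall>x\<in>K. cmod (f x) < r)"
    using le by (auto intro: le_less_trans)
qed

lemma cstar_seminorm_sup_norm:
  assumes K: "compactin (fst X) K"
  shows "cstar_seminorm (FC X) (sup_norm K)"
  unfolding cstar_seminorm_def
proof (intro conjI ballI allI)
  have KX: "K \<subseteq> points X" using K by (rule compactin_subset_topspace)
  have le: "cmod (f x) \<le> sup_norm K f" if "f \<in> carrier (FC X)" "x \<in> K" for f x
    using le_sup_norm[OF K] that by (simp add: carrier_FC)
  have nonneg: "0 \<le> sup_norm K f" if "f \<in> carrier (FC X)" for f
    using sup_norm_nonneg[OF K] that by (simp add: carrier_FC)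
  fix f g c assume f: "f \<in> carrier (FC X)"
  show "0 \<le> sup_norm K f" by (rule nonneg[OF f])
  show "sup_norm K (c \<odot>\<^bsub>FC X\<^esub> f) = cmod c * sup_norm K f"
  proof (rule antisym)
    show "sup_norm K (c \<odot>\<^bsub>FC X\<^esub> f) \<le> cmod c * sup_norm K f"
      using KX nonneg[OF f] le[OF f]
      by (intro sup_norm_le) (auto simp: smult_FC norm_mult intro: mult_left_mono)
    show "cmod c * sup_norm K f \<le> sup_norm K (c \<odot>\<^bsub>FC X\<^esub> f)"
    proof (cases "c = 0")
      case False
      have "sup_norm K f \<le> sup_norm K (c \<odot>\<^bsub>FC X\<^esub> f) / cmod c"
      proof (rule sup_norm_le)
        show "cmod (f x) \<le> sup_norm K (c \<odot>\<^bsub>FC X\<^esub> f) / cmod c" if "x \<in> K" for x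
          using le[OF FC_closed(3)[OF f, of c] that] KX that False
          by (auto simp: smult_FC norm_mult field_simps)
      qed (simp add: nonneg FC_closed f)
      then show ?thesis using False by (simp add: field_simps)
    qed (simp add: nonneg FC_closed f)
  qed
  let ?s = "sup_norm K (star (FC X) f \<otimes>\<^bsub>FC X\<^esub> f)"
  have sq: "cmod ((star (FC X) f \<otimes>\<^bsub>FC X\<^esub> f) x) = (cmod (f x))\<^sup>2" if "x \<in> K" for x
    using that KX by (auto simp: mult_FC star_FC norm_mult power2_eq_square)
  show "?s = (sup_norm K f)\<^sup>2"
  proof (rule antisym)
    show "?s \<le> (sup_norm K f)\<^sup>2"
      by (rule sup_norm_le) (auto simp: sq intro!: power_mono le f)
    have "sup_norm K f \<le> sqrt ?s"
    proof (rule sup_norm_le)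
      show "cmod (f x) \<le> sqrt ?s" if "x \<in> K" for x
        using le[OF FC_closed(1)[OF FC_closed(4)[OF f] f] that] sq[OF that] by (simp add: real_le_rsqrt)
    qed (simp add: nonneg FC_closed f)
    then show "(sup_norm K f)\<^sup>2 \<le> ?s"
      using power_mono[of "sup_norm K f" "sqrt ?s" 2] nonneg f by (simp add: FC_closed)
  qed
  assume g: "g \<in> carrier (FC X)"
  show "sup_norm K (f \<oplus>\<^bsub>FC X\<^esub> g) \<le> sup_norm K f + sup_norm K g"
  proof (rule sup_norm_le)
    show "cmod ((f \<oplus>\<^bsub>FC X\<^esub> g) x) \<le> sup_norm K f + sup_norm K g" if "x \<in> K" for x
      using le[OF f that] le[OF g that] norm_triangle_ineq[of "f x" "g x"] KX that
      by (auto simp: add_FC)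
  qed (simp add: nonneg f g)
  show "sup_norm K (f \<otimes>\<^bsub>FC X\<^esub> g) \<le> sup_norm K f * sup_norm K g"
  proof (rule sup_norm_le)
    show "cmod ((f \<otimes>\<^bsub>FC X\<^esub> g) x) \<le> sup_norm K f * sup_norm K g" if "x \<in> K" for x
      using le[OF f that] le[OF g that] KX that nonneg f
      by (auto simp: mult_FC norm_mult intro!: mult_mono)
  qed (simp add: nonneg f g)
qed

lemma fd_spaceD:
  assumes "X \<in> fd_spaces"
  shows "Tychonoff_space (fst X)"
    and "K \<in> snd X \<Longrightarrow> compactin (fst X) K"
    and "x \<in> points X \<Longrightarrow> {x} \<in> snd X"
    and "{} \<in> snd X"
    and "K \<in> snd X \<Longrightarrow> L \<in> snd X \<Longrightarrow> K \<union> L \<in> snd X"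
    and "K \<in> snd X \<Longrightarrow> L \<subseteq> K \<Longrightarrow> compactin (fst X) L \<Longrightarrow> L \<in> snd X"
    and "(\<And>K. K \<in> snd X \<Longrightarrow> continuous_map (subtopology (fst X) K) euclideanreal f) \<Longrightarrow>
      continuous_map (fst X) euclideanreal f"
proof -
  have fd: "Tychonoff_space (fst X)" "functionally_distinguished (fst X) (snd X)"
    using assms by (auto simp: fd_spaces_def)
  show "Tychonoff_space (fst X)" by (rule fd)
  show "K \<in> snd X \<Longrightarrow> compactin (fst X) K" "x \<in> points X \<Longrightarrow> {x} \<in> snd X"
    "K \<in> snd X \<Longrightarrow> L \<subseteq> K \<Longrightarrow> compactin (fst X) L \<Longrightarrow> L \<in> snd X"
    "(\<And>K. K \<in> snd X \<Longrightarrow> continuous_map (subtopology (fst X) K) euclideanreal f) \<Longrightarrow>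
      continuous_map (fst X) euclideanreal f"
    using fd(2) unfolding functionally_distinguished_def by blast+
  have Union: "finite \<K> \<Longrightarrow> \<K> \<subseteq> snd X \<Longrightarrow> \<Union>\<K> \<in> snd X" for \<K>
    using fd(2) unfolding functionally_distinguished_def by blast
  show "{} \<in> snd X" using Union[of "{}"] by simp
  show "K \<in> snd X \<Longrightarrow> L \<in> snd X \<Longrightarrow> K \<union> L \<in> snd X" using Union[of "{K, L}"] by simp
qed

lemma sup_norm_mono:
  assumes "compactin X L" "continuous_map X euclidean f" "K \<subseteq> L"
  shows "sup_norm K f \<le> sup_norm L f"
proof (rule sup_norm_le)
  show "0 \<le> sup_norm L f" by (rule sup_norm_nonneg[OF assms(1,2)])
  show "cmod (f x) \<le> sup_norm L f" if "x \<in> K" for x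
    using that assms(3) by (intro le_sup_norm[OF assms(1,2)]) auto
qed

text \<open>Closure of the family under finite unions gives directedness, its empty member
  nonemptiness; compactness of the members identifies the defining basic sets with seminorm
  balls.\<close>

lemma cstar_family_topology_FC:
  assumes X: "X \<in> fd_spaces"
  shows "cstar_family_topology (FC X) (sup_norm ` snd X)"
proof -
  interpret cstar_family "FC X" "sup_norm ` snd X"
  proof
    show "cstar_seminorm (FC X) p" if "p \<in> sup_norm ` snd X" for p
      using that cstar_seminorm_sup_norm fd_spaceD(2)[OF X] by blast
    show "sup_norm ` snd X \<noteq> {}" using fd_spaceD(4)[OF X] by blast
    fix p q assume "p \<in> sup_norm ` snd X" "q \<in> sup_norm ` snd X"
    then obtain K L where KL: "p = sup_norm K" "q = sup_norm L" "K \<in> snd X" "L \<in> snd X" by blast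
    have KL': "K \<union> L \<in> snd X" by (rule fd_spaceD(5)[OF X KL(3,4)])
    then have "sup_norm K f \<le> sup_norm (K \<union> L) f \<and> sup_norm L f \<le> sup_norm (K \<union> L) f"
      if "f \<in> carrier (FC X)" for f
      using fd_spaceD(2)[OF X KL'] that by (auto simp: carrier_FC intro!: sup_norm_mono)
    with KL KL' show "\<exists>s\<in>sup_norm ` snd X. \<forall>x\<in>carrier (FC X). p x \<le> s x \<and> q x \<le> s x" by blast
  qed
  have ball: "{g \<in> carrier (FC X). \<forall>x\<in>K. cmod (g x - f x) < r} =
      {g \<in> carrier (FC X). sup_norm K (g \<ominus>\<^bsub>FC X\<^esub> f) < r}"
    if K: "K \<in> snd X" and f: "f \<in> carrier (FC X)" and r: "0 < r" for K f r
  proof (intro Collect_cong conj_cong refl)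
    fix g assume g: "g \<in> carrier (FC X)"
    have "g \<ominus>\<^bsub>FC X\<^esub> f \<in> carrier (FC X)" using f g by simp
    then have "continuous_map (fst X) euclidean (g \<ominus>\<^bsub>FC X\<^esub> f)" by (simp add: carrier_FC)
    then have "sup_norm K (g \<ominus>\<^bsub>FC X\<^esub> f) < r \<longleftrightarrow> (\<forall>x\<in>K. cmod ((g \<ominus>\<^bsub>FC X\<^esub> f) x) < r)"
      by (rule sup_norm_less_iff[OF fd_spaceD(2)[OF X K] _ r])
    moreover have "(g \<ominus>\<^bsub>FC X\<^esub> f) x = g x - f x" if "x \<in> K" for x
      using fd_spaces_subset_points[OF X K] that f g by (auto simp: diff_FC)
    ultimately show "(\<forall>x\<in>K. cmod (g x - f x) < r) \<longleftrightarrow> sup_norm K (g \<ominus>\<^bsub>FC X\<^esub> f) < r"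
      by simp
  qed
  have "{{g \<in> carrier (FC X). \<forall>x\<in>K. cmod (g x - f x) < r} |K f r.
        K \<in> snd X \<and> f \<in> carrier (FC X) \<and> 0 < r} =
      {{g \<in> carrier (FC X). p (g \<ominus>\<^bsub>FC X\<^esub> f) < r} |p f r.
        p \<in> sup_norm ` snd X \<and> f \<in> carrier (FC X) \<and> 0 < r}" (is "?L = ?R")
  proof (intro equalityI subsetI)
    fix B assume "B \<in> ?L"
    then obtain K f r where "B = {g \<in> carrier (FC X). \<forall>x\<in>K. cmod (g x - f x) < r}"
      and Kfr: "K \<in> snd X" "f \<in> carrier (FC X)" "0 < r" by blast
    then have "B = {g \<in> carrier (FC X). sup_norm K (g \<ominus>\<^bsub>FC X\<^esub> f) < r}" using ball by simp
    with Kfr show "B \<in> ?R" by blast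
  next
    fix B assume "B \<in> ?R"
    then obtain K f r where "B = {g \<in> carrier (FC X). sup_norm K (g \<ominus>\<^bsub>FC X\<^esub> f) < r}"
      and Kfr: "K \<in> snd X" "f \<in> carrier (FC X)" "0 < r" by blast
    then have "B = {g \<in> carrier (FC X). \<forall>x\<in>K. cmod (g x - f x) < r}" using ball by simp
    with Kfr show "B \<in> ?L" by blast
  qed
  then show ?thesis
    by unfold_locales (simp add: generated_topology_def, simp add: FC_def Let_def)
qed

text \<open>Completeness is where the family must determine the continuous functions: a Cauchy
  filter converges uniformly on each member, so its limit is continuous there and therefore on the
  whole space.\<close>

lemma FC_pro_cstar_algebra:
  assumes X: "X \<in> fd_spaces"
  shows "comm_pro_cstar_algebra (FC X)"
proof -
  interpret cstar_family_topology "FC X" "sup_norm ` snd X" by (rule cstar_family_topology_FC[OF X])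
  show ?thesis
  proof
    show "topo (FC X) = topology_generated_by
       {{y \<in> carrier (FC X). p (y \<ominus>\<^bsub>FC X\<^esub> x) < r} |p x r.
          continuous_cstar_seminorm (FC X) p \<and> x \<in> carrier (FC X) \<and> 0 < r}"
      by (rule generated_by_continuous_cstar_seminorms)
    show "Hausdorff_space (topo (FC X))"
    proof (rule Hausdorff_spaceI)
      fix f assume f: "f \<in> carrier (FC X)" "f \<noteq> \<zero>\<^bsub>FC X\<^esub>"
      then obtain x where x: "x \<in> points X" "f x \<noteq> 0"
        using FC_eqI[OF f(1) FC_one_zero_closed(2)] by (auto simp: zero_FC)
      then have "cmod (f x) \<le> sup_norm {x} f"
        using f fd_spaceD(2)[OF X fd_spaceD(3)[OF X]] by (intro le_sup_norm[of "fst X"]) (auto simp: carrier_FC)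
      then have "sup_norm {x} f \<noteq> 0" using x by auto
      then show "\<exists>p\<in>sup_norm ` snd X. p f \<noteq> 0" using fd_spaceD(3)[OF X x(1)] by blast
    qed
    fix \<Phi> assume \<Phi>: "cauchy_filter_in (FC X) \<Phi>"
    then have \<Phi>_ne: "\<Phi> \<noteq> bot" and ev_carrier: "\<forall>\<^sub>F f in \<Phi>. f \<in> carrier (FC X)"
      by (auto simp: cauchy_filter_in_def)
    have cauchy: "\<exists>S\<subseteq>carrier (FC X). (\<forall>\<^sub>F f in \<Phi>. f \<in> S) \<and> (\<forall>f\<in>S. \<forall>g\<in>S. \<forall>x\<in>K. cmod (f x - g x) < e)"
      if K: "K \<in> snd X" and e: "0 < e" for K e
    proof -
      let ?U = "{g \<in> carrier (FC X). sup_norm K (g \<ominus>\<^bsub>FC X\<^esub> \<zero>\<^bsub>FC X\<^esub>) < e}"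
      interpret cstar_seminormed "FC X" "sup_norm K"
        by unfold_locales (rule cstar_seminorm_sup_norm[OF fd_spaceD(2)[OF X K]])
      have "openin (topo (FC X)) ?U" using K e by (intro openin_ball) auto
      moreover have "\<zero>\<^bsub>FC X\<^esub> \<in> ?U" using e by (simp add: a_minus_def)
      moreover have z: "h \<ominus>\<^bsub>FC X\<^esub> \<zero>\<^bsub>FC X\<^esub> = h" if "h \<in> carrier (FC X)" for h
        using that by (simp add: a_minus_def)
      ultimately obtain S where S: "S \<subseteq> carrier (FC X)" "\<forall>\<^sub>F f in \<Phi>. f \<in> S"
          "\<And>f g. f \<in> S \<Longrightarrow> g \<in> S \<Longrightarrow> f \<ominus>\<^bsub>FC X\<^esub> g \<in> ?U"
        using \<Phi>[unfolded cauchy_filter_in_def, THEN conjunct2, THEN conjunct2, rule_format, of ?U]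
        by blast
      have "cmod (f x - g x) < e" if fg: "f \<in> S" "g \<in> S" and x: "x \<in> K" for f g x
      proof -
        have c: "f \<in> carrier (FC X)" "g \<in> carrier (FC X)" using S(1) fg by auto
        then have d: "f \<ominus>\<^bsub>FC X\<^esub> g \<in> carrier (FC X)" by simp
        have "cmod ((f \<ominus>\<^bsub>FC X\<^esub> g) x) \<le> sup_norm K (f \<ominus>\<^bsub>FC X\<^esub> g)"
          using d by (intro le_sup_norm[OF fd_spaceD(2)[OF X K] _ x]) (simp add: carrier_FC)
        also have "\<dots> < e" using S(3)[OF fg] z[OF d] by simp
        finally show ?thesis
          using fd_spaces_subset_points[OF X K] x c by (auto simp: diff_FC)
      qed
      with S(1,2) show ?thesis by blast
    qed
    \<comment> \<open>Singletons belong to the family, so the filter is Cauchy at each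
      point.\<close>
    have "\<exists>c. ((\<lambda>f. f x) \<longlongrightarrow> c) \<Phi>" if x: "x \<in> points X" for x
    proof -
      have "cauchy_filter (filtermap (\<lambda>f. f x) \<Phi>)"
        unfolding cauchy_filter_metric_filtermap
      proof (intro allI impI)
        fix e :: real assume "0 < e"
        from cauchy[OF fd_spaceD(3)[OF X x] this]
        obtain S where "\<forall>\<^sub>F f in \<Phi>. f \<in> S" "\<forall>f\<in>S. \<forall>g\<in>S. cmod (f x - g x) < e" by auto
        then show "\<exists>P. eventually P \<Phi> \<and> (\<forall>f g. P f \<and> P g \<longrightarrow> dist (f x) (g x) < e)"
          by (intro exI[of _ "\<lambda>f. f \<in> S"]) (auto simp: dist_norm)
      qed
      moreover have "filtermap (\<lambda>f. f x) \<Phi> \<noteq> bot" using \<Phi>_ne by (simp add: filtermap_bot_iff)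
      ultimately show ?thesis
        using cauchy_filter_complete_converges[OF _ complete_UNIV] by (auto simp: filterlim_def)
    qed
    then obtain l where l: "\<And>x. x \<in> points X \<Longrightarrow> ((\<lambda>f. f x) \<longlongrightarrow> l x) \<Phi>" by metis
    have uniform: "\<forall>\<^sub>F f in \<Phi>. f \<in> carrier (FC X) \<and> (\<forall>x\<in>K. cmod (f x - l x) < e)"
      if K: "K \<in> snd X" and e: "0 < e" for K e
    proof -
      obtain S where S: "S \<subseteq> carrier (FC X)" "\<forall>\<^sub>F f in \<Phi>. f \<in> S"
        "\<forall>f\<in>S. \<forall>g\<in>S. \<forall>x\<in>K. cmod (f x - g x) < e / 2"
        using cauchy[OF K, of "e / 2"] e by auto
      \<comment> \<open>For fixed \<open>f\<close>, let \<open>g\<close> run to the limit;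
        strictness is lost, which the tolerance \<open>e / 2\<close> absorbs.\<close>
      have bound: "cmod (f x - l x) \<le> e / 2" if f: "f \<in> S" and x: "x \<in> K" for f x
      proof (rule tendsto_upperbound[OF _ _ \<Phi>_ne])
        have "x \<in> points X" using fd_spaces_subset_points[OF X K] x by blast
        then show "((\<lambda>g. cmod (f x - g x)) \<longlongrightarrow> cmod (f x - l x)) \<Phi>"
          by (intro tendsto_intros l)
        show "\<forall>\<^sub>F g in \<Phi>. cmod (f x - g x) \<le> e / 2"
          using S(2) by eventually_elim (use S(3) f x in \<open>auto intro: less_imp_le\<close>)
      qed
      have "cmod (f x - l x) < e" if "f \<in> S" "x \<in> K" for f x
        using bound[OF that] e by linarith
      with S(1) have "f \<in> carrier (FC X) \<and> (\<forall>x\<in>K. cmod (f x - l x) < e)" if "f \<in> S" for f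
        using that by blast
      from eventually_mono[OF S(2) this] show ?thesis .
    qed
    have "continuous_map (subtopology (fst X) K) euclidean l" if K: "K \<in> snd X" for K
    proof -
      have "continuous_map (subtopology (fst X) K) Met_TC.mtopology l"
      proof (rule Met_TC.continuous_map_uniform_limit[OF _ _ \<Phi>_ne])
        show "\<forall>\<^sub>F f in \<Phi>. continuous_map (subtopology (fst X) K) Met_TC.mtopology f"
          using ev_carrier
          by eventually_elim (simp add: carrier_FC continuous_map_from_subtopology)
        show "\<forall>\<^sub>F f in \<Phi>. \<forall>x\<in>topspace (subtopology (fst X) K). l x \<in> UNIV \<and> dist (f x) (l x) < e"
          if "0 < e" for e
          using uniform[OF K that] by eventually_elim (simp add: dist_norm)
      qed
      then show ?thesis by simp
    qed
    \<comment> \<open>The determination property speaks of real functions, so real and imaginary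
      parts are treated separately and then recombined.\<close>
    then have "continuous_map (fst X) euclideanreal (\<lambda>x. Re (l x))"
      "continuous_map (fst X) euclideanreal (\<lambda>x. Im (l x))"
      by (intro fd_spaceD(7)[OF X] continuous_map_complex_intros; simp)+
    then have "continuous_map (fst X) euclidean (\<lambda>x. complex_of_real (Re (l x)) + \<i> * complex_of_real (Im (l x)))"
      by (intro continuous_map_add continuous_map_complex_intros(1) continuous_map_of_real)
        (assumption | rule continuous_map_const[THEN iffD2], simp)+
    then have "continuous_map (fst X) euclidean l" by (simp flip: complex_eq)
    then have lC: "restrict l (points X) \<in> carrier (FC X)" by (rule restrict_in_FC)
    show "\<exists>l. limitin (topo (FC X)) (\<lambda>x. x) l \<Phi>"
      unfolding limitin_def
    proof (intro exI conjI allI impI)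
      show "restrict l (points X) \<in> topspace (topo (FC X))" using lC by (simp add: topspace_eq)
      fix U assume "openin (topo (FC X)) U \<and> restrict l (points X) \<in> U"
      then obtain K r where K: "K \<in> snd X" "0 < r"
        and U: "\<And>f. f \<in> carrier (FC X) \<Longrightarrow> sup_norm K (f \<ominus>\<^bsub>FC X\<^esub> restrict l (points X)) < r \<Longrightarrow> f \<in> U"
        unfolding openin_topo_iff by blast
      have "f \<in> U" if f: "f \<in> carrier (FC X)" and close: "\<forall>x\<in>K. cmod (f x - l x) < r / 2" for f
      proof (rule U[OF f])
        have "sup_norm K (f \<ominus>\<^bsub>FC X\<^esub> restrict l (points X)) \<le> r / 2"
        proof (rule sup_norm_le)
          show "cmod ((f \<ominus>\<^bsub>FC X\<^esub> restrict l (points X)) x) \<le> r / 2" if "x \<in> K" for x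
            using close fd_spaces_subset_points[OF X K(1)] that by (auto simp: diff_FC[OF f lC] intro: less_imp_le)
        qed (use K in simp)
        then show "sup_norm K (f \<ominus>\<^bsub>FC X\<^esub> restrict l (points X)) < r" using K(2) by simp
      qed
      then show "\<forall>\<^sub>F f in \<Phi>. f \<in> U"
        by (intro eventually_mono[OF uniform[OF K(1) half_gt_zero[OF K(2)]]]) blast
    qed
  qed
qed

text \<open>By linearity, continuity follows from domination between the generating seminorms, so
  sup-norms can be used directly on the function algebras.\<close>

lemma pro_cstar_homI:
  assumes A: "cstar_family_topology A P" and B: "cstar_family_topology B Q"
    and ext: "h \<in> extensional (carrier A)" and h: "h \<in> ring_hom A B"
    and smult: "\<And>c x. x \<in> carrier A \<Longrightarrow> h (c \<odot>\<^bsub>A\<^esub> x) = c \<odot>\<^bsub>B\<^esub> h x"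
    and star: "\<And>x. x \<in> carrier A \<Longrightarrow> h (star A x) = star B (h x)"
    and bound: "\<And>q. q \<in> Q \<Longrightarrow> \<exists>p\<in>P. \<forall>x\<in>carrier A. q (h x) \<le> p x"
  shows "h \<in> pro_cstar_hom A B"
proof -
  interpret A: cstar_family_topology A P by (rule A)
  interpret B: cstar_family_topology B Q by (rule B)
  have closed: "h x \<in> carrier B" if "x \<in> carrier A" for x by (rule ring_hom_closed[OF h that])
  have diff: "h (x \<ominus>\<^bsub>A\<^esub> y) = h x \<ominus>\<^bsub>B\<^esub> h y" if "x \<in> carrier A" "y \<in> carrier A" for x y
    using that closed
    by (simp add: a_minus_def A.uminus_smult B.uminus_smult ring_hom_add[OF h] smult)
  have "continuous_map (topo A) (topo B) h"
    unfolding B.continuous_map_into_iff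
  proof (intro conjI ballI allI impI)
    show "h \<in> topspace (topo A) \<rightarrow> carrier B" using closed by (simp add: A.topspace_eq)
    fix x q and r :: real assume x: "x \<in> topspace (topo A)" and q: "q \<in> Q" and r: "0 < r"
    obtain p where p: "p \<in> P" "\<And>x. x \<in> carrier A \<Longrightarrow> q (h x) \<le> p x" using bound[OF q] by blast
    interpret p: cstar_seminormed A p by (rule A.seminormed[OF p(1)])
    have xA: "x \<in> carrier A" using x by (simp add: A.topspace_eq)
    have "q (h y \<ominus>\<^bsub>B\<^esub> h x) < r" if "y \<in> carrier A" "p (y \<ominus>\<^bsub>A\<^esub> x) < r" for y
      using p(2)[of "y \<ominus>\<^bsub>A\<^esub> x"] that xA by (simp add: diff)
    moreover have "p (x \<ominus>\<^bsub>A\<^esub> x) < r" using xA r by (simp add: a_minus_def A.r_neg)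
    ultimately show "\<exists>U. openin (topo A) U \<and> x \<in> U \<and> (\<forall>u\<in>U. q (h u \<ominus>\<^bsub>B\<^esub> h x) < r)"
      using A.openin_ball[OF p(1) xA r] xA
      by (intro exI[of _ "{y \<in> carrier A. p (y \<ominus>\<^bsub>A\<^esub> x) < r}"]) simp
  qed
  then show ?thesis using ext h smult star by (simp add: pro_cstar_hom_def)
qed

section \<open>Characters of the algebra of continuous functions\<close>

lemma FC_separating:
  assumes X: "X \<in> fd_spaces" and U: "openin (fst X) U" "x \<in> U"
  obtains \<phi> where "\<phi> \<in> carrier (FC X)" "\<phi> x = 0" "\<And>y. y \<in> points X \<Longrightarrow> y \<notin> U \<Longrightarrow> \<phi> y = 1"
proof -
  have "completely_regular_space (fst X)"
    using fd_spaceD(1)[OF X] by (simp add: Tychonoff_space_def)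
  then obtain f where f: "continuous_map (fst X) euclideanreal f" "f x = 0" "f ` (points X - U) \<subseteq> {1}"
    unfolding completely_regular_space_alt' using U by blast
  have "(\<lambda>x\<in>points X. complex_of_real (f x)) \<in> carrier (FC X)"
    by (intro restrict_in_FC continuous_map_of_real f)
  moreover have "x \<in> points X" using U openin_subset by blast
  ultimately show ?thesis
    using that[of "\<lambda>x\<in>points X. complex_of_real (f x)"] f by (auto simp: image_subset_iff)
qed

lemma point_evaluation_apply:
  "x \<in> points X \<Longrightarrow> \<phi> \<in> carrier (FC X) \<Longrightarrow> point_evaluation X x \<phi> = \<phi> x"
  by (simp add: point_evaluation_def)

lemma point_evaluation_dominated:
  assumes X: "X \<in> fd_spaces" and K: "K \<in> snd X" and x: "x \<in> K"
  shows "point_evaluation X x \<in> dominated_characters (FC X) (sup_norm K)"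
proof -
  have xX: "x \<in> points X" using fd_spaces_subset_points[OF X K] x by blast
  have "cmod (\<phi> x) \<le> sup_norm K \<phi>" if "\<phi> \<in> carrier (FC X)" for \<phi>
    using le_sup_norm[OF fd_spaceD(2)[OF X K] _ x] that by (simp add: carrier_FC)
  moreover have "point_evaluation X x \<in> star_characters (FC X)"
    unfolding star_characters_def using xX
    by (simp add: point_evaluation_apply FC_closed FC_one_zero_closed)
      (simp add: point_evaluation_def add_FC mult_FC one_FC smult_FC star_FC)
  ultimately show ?thesis
    using xX by (simp add: dominated_characters_def point_evaluation_apply)
qed

lemma point_evaluation_character:
  assumes "X \<in> fd_spaces" "x \<in> points X"
  shows "point_evaluation X x \<in> characters (FC X)"
  using point_evaluation_dominated[OF assms(1) fd_spaceD(3)[OF assms], of x] fd_spaceD(3)[OF assms]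
    cstar_family_topology.character_iff[OF cstar_family_topology_FC[OF assms(1)]] by blast

text \<open>
  If \<open>\<omega>\<close> differed from every evaluation at a point of \<open>K\<close>, compactness would give \<open>\<psi> > 0\<close> on \<open>K\<close>
  with \<open>\<omega> \<psi> = 0\<close>; with \<open>c\<close> the maximum of \<open>\<psi>\<close> on \<open>K\<close>, the function \<open>c - \<psi>\<close> has norm less than \<open>c\<close> on \<open>K\<close>,
  but \<open>\<omega> (c - \<psi>) = c\<close>.
\<close>

lemma dominated_character_is_evaluation:
  assumes X: "X \<in> fd_spaces" and K: "K \<in> snd X"
    and \<omega>: "\<omega> \<in> dominated_characters (FC X) (sup_norm K)"
  obtains x where "x \<in> K" "\<omega> = point_evaluation X x"
proof (rule ccontr)
  assume "\<not> thesis"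
  with that have ne: "\<omega> \<noteq> point_evaluation X x" if "x \<in> K" for x using \<open>x \<in> K\<close> by blast
  have KX: "K \<subseteq> points X" by (rule fd_spaces_subset_points[OF X K])
  have cK: "compactin (fst X) K" by (rule fd_spaceD(2)[OF X K])
  have \<omega>s: "\<omega> \<in> star_characters (FC X)" and \<omega>le: "\<And>\<phi>. \<phi> \<in> carrier (FC X) \<Longrightarrow> cmod (\<omega> \<phi>) \<le> sup_norm K \<phi>"
    using \<omega> by (auto simp: dominated_characters_def)
  note [simp] = star_characterD(2-)[OF \<omega>s] FC.star_character_diff[OF \<omega>s]
  define N where "N = {\<psi> \<in> carrier (FC X). \<omega> \<psi> = 0 \<and> (\<forall>y\<in>points X. Im (\<psi> y) = 0 \<and> 0 \<le> Re (\<psi> y))}"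
  have "\<exists>\<psi>\<in>N. 0 < Re (\<psi> x)" if x: "x \<in> K" for x
  proof -
    have "\<omega> \<in> extensional (carrier (FC X))" "point_evaluation X x \<in> extensional (carrier (FC X))"
      using \<omega>s x KX by (auto simp: star_characters_def point_evaluation_def)
    then obtain \<phi> where \<phi>: "\<phi> \<in> carrier (FC X)" "\<omega> \<phi> \<noteq> \<phi> x"
      using ne[OF x] extensionalityI[of \<omega> "carrier (FC X)" "point_evaluation X x"] x KX
      by (metis point_evaluation_apply subsetD)
    \<comment> \<open>\<open>?\<chi>\<close> is annihilated by \<open>\<omega>\<close> but nonzero
      at \<open>x\<close>; its squared modulus \<open>?\<psi>\<close> keeps both properties and is
      nonnegative.\<close>
    let ?\<chi> = "\<phi> \<ominus>\<^bsub>FC X\<^esub> \<omega> \<phi> \<odot>\<^bsub>FC X\<^esub> \<one>\<^bsub>FC X\<^esub>"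
    let ?\<psi> = "star (FC X) ?\<chi> \<otimes>\<^bsub>FC X\<^esub> ?\<chi>"
    have \<chi>: "?\<chi> \<in> carrier (FC X)" using \<phi> by simp
    have "?\<psi> y = complex_of_real ((cmod (\<phi> y - \<omega> \<phi>))\<^sup>2)" if y: "y \<in> points X" for y
    proof -
      have "?\<chi> y = \<phi> y - \<omega> \<phi>" using y \<phi> by (simp add: diff_FC) (simp add: smult_FC one_FC)
      then have "?\<psi> y = cnj (\<phi> y - \<omega> \<phi>) * (\<phi> y - \<omega> \<phi>)" using y by (simp add: mult_FC star_FC)
      then show ?thesis by (simp only: complex_norm_square mult.commute)
    qed
    moreover have "\<omega> ?\<psi> = 0" "?\<psi> \<in> carrier (FC X)" using \<phi> by simp_all
    ultimately show ?thesis
      using \<phi> x KX by (intro bexI[of _ ?\<psi>]) (auto simp: N_def simp del: of_real_power)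
  qed
  then obtain f where f: "\<And>x. x \<in> K \<Longrightarrow> f x \<in> N" "\<And>x. x \<in> K \<Longrightarrow> 0 < Re (f x x)" by metis
  define U where "U x = {y \<in> points X. Re (f x y) \<in> {0<..}}" for x
  have "openin (fst X) (U x)" if "x \<in> K" for x
    unfolding U_def using f(1)[OF that]
    by (intro openin_continuous_map_preimage[of _ euclideanreal] continuous_map_complex_intros(3))
      (auto simp: N_def carrier_FC)
  then have "\<And>V. V \<in> U ` K \<Longrightarrow> openin (fst X) V" by blast
  moreover have "K \<subseteq> \<Union>(U ` K)" using f(2) KX by (auto simp: U_def)
  ultimately obtain \<V> where \<V>: "finite \<V>" "\<V> \<subseteq> U ` K" "K \<subseteq> \<Union>\<V>"
    using compactinD[OF cK, of "U ` K"] by meson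
  from finite_subset_image[OF \<V>(1,2)] obtain D where D: "finite D" "D \<subseteq> K" "K \<subseteq> (\<Union>x\<in>D. U x)"
    using \<V>(3) by metis
  \<comment> \<open>Sums replace maxima: the functions in \<open>N\<close> are nonnegative, so a
    finite sum bounds each summand, and it stays in the kernel of \<open>\<omega>\<close>.\<close>
  have "\<exists>\<psi>\<in>N. \<forall>y\<in>points X. \<forall>x\<in>D. Re (f x y) \<le> Re (\<psi> y)" if "finite D" "D \<subseteq> K" for D
    using that
  proof (induction D)
    case empty
    have "\<omega> \<zero>\<^bsub>FC X\<^esub> = 0"
      using star_characterD(5)[OF \<omega>s FC_one_zero_closed(2), of 0] by simp
    then have "\<zero>\<^bsub>FC X\<^esub> \<in> N"
      by (simp add: N_def) (simp add: zero_FC)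
    then show ?case by blast
  next
    case (insert a D)
    then obtain \<psi> where \<psi>: "\<psi> \<in> N" "\<And>x y. y \<in> points X \<Longrightarrow> x \<in> D \<Longrightarrow> Re (f x y) \<le> Re (\<psi> y)" by auto
    have fa: "f a \<in> N" using f(1) insert by simp
    have sum: "\<psi> \<oplus>\<^bsub>FC X\<^esub> f a \<in> N" using \<psi>(1) fa by (auto simp: N_def FC_closed) (auto simp: add_FC)
    have "Re (f x y) \<le> Re ((\<psi> \<oplus>\<^bsub>FC X\<^esub> f a) y)" if y: "y \<in> points X" and x: "x \<in> insert a D" for x y
    proof -
      have "0 \<le> Re (\<psi> y)" "0 \<le> Re (f a y)" using \<psi>(1) fa y by (auto simp: N_def)
      then show ?thesis using x y \<psi>(2)[of y x] by (auto simp: add_FC)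
    qed
    then show ?case using sum by blast
  qed
  from this[OF D(1,2)] obtain \<psi> where \<psi>: "\<psi> \<in> N" "\<And>x y. y \<in> points X \<Longrightarrow> x \<in> D \<Longrightarrow> Re (f x y) \<le> Re (\<psi> y)" by blast
  have \<psi>C: "\<psi> \<in> carrier (FC X)" "\<omega> \<psi> = 0" using \<psi>(1) by (auto simp: N_def)
  have pos: "0 < Re (\<psi> y)" if y: "y \<in> K" for y
  proof -
    obtain x where "x \<in> D" "0 < Re (f x y)" using D(3) y by (auto simp: U_def)
    then show ?thesis using \<psi>(2)[of y x] y KX by (meson less_le_trans subsetD)
  qed
  define c where "c = sup_norm K \<psi>"
  have le_c: "Re (\<psi> y) \<le> c" if "y \<in> K" for y
    using le_sup_norm[OF cK _ that, of \<psi>] \<psi>C complex_Re_le_cmod[of "\<psi> y"] by (simp add: c_def carrier_FC)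
  \<comment> \<open>The norm over the empty set is 0, which would force \<open>\<omega>\<close> to
    vanish at the unit.\<close>
  have "K \<noteq> {}"
  proof
    assume "K = {}"
    then have "cmod (\<omega> \<one>\<^bsub>FC X\<^esub>) \<le> 0"
      using \<omega>le[OF FC_one_zero_closed(1)] sup_norm_le[of 0 K "\<one>\<^bsub>FC X\<^esub>"] by auto
    then show False by simp
  qed
  then have c: "0 < c" using pos le_c by (meson all_not_in_conv less_le_trans)
  let ?\<theta> = "complex_of_real c \<odot>\<^bsub>FC X\<^esub> \<one>\<^bsub>FC X\<^esub> \<ominus>\<^bsub>FC X\<^esub> \<psi>"
  have \<theta>: "?\<theta> \<in> carrier (FC X)" "\<omega> ?\<theta> = complex_of_real c" using \<psi>C by simp_all
  have "cmod (?\<theta> y) < c" if y: "y \<in> K" for y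
  proof -
    have yX: "y \<in> points X" using y KX by blast
    then have "\<psi> y = complex_of_real (Re (\<psi> y))" using \<psi>(1) by (simp add: N_def complex_eq_iff)
    moreover have "?\<theta> y = complex_of_real c - \<psi> y"
      using yX \<psi>C by (simp add: diff_FC) (simp add: smult_FC one_FC)
    ultimately have "?\<theta> y = complex_of_real (c - Re (\<psi> y))" by simp
    then have "cmod (?\<theta> y) = \<bar>c - Re (\<psi> y)\<bar>" by (simp only: norm_of_real)
    then show ?thesis using pos[OF y] le_c[OF y] by linarith
  qed
  then have "sup_norm K ?\<theta> < c"
    using sup_norm_less_iff[OF cK _ c] \<theta>(1) by (simp add: carrier_FC)
  then show False using \<omega>le[OF \<theta>(1)] \<theta>(2) c by simp
qed

lemma character_FC_is_evaluation:
  assumes X: "X \<in> fd_spaces" and \<omega>: "\<omega> \<in> characters (FC X)"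
  obtains x where "x \<in> points X" "\<omega> = point_evaluation X x"
proof -
  obtain K where K: "K \<in> snd X" "\<omega> \<in> dominated_characters (FC X) (sup_norm K)"
    using \<omega> cstar_family_topology.character_iff[OF cstar_family_topology_FC[OF X]] by blast
  then obtain x where "x \<in> K" "\<omega> = point_evaluation X x"
    using dominated_character_is_evaluation[OF X] by blast
  then show ?thesis using that fd_spaces_subset_points[OF X K(1)] by blast
qed

lemma inj_point_evaluation:
  assumes X: "X \<in> fd_spaces"
  shows "inj_on (point_evaluation X) (points X)"
proof (rule inj_onI, rule ccontr)
  fix x y assume xy: "x \<in> points X" "y \<in> points X" "point_evaluation X x = point_evaluation X y" "x \<noteq> y"
  have "t1_space (fst X)" using fd_spaceD(1)[OF X] by (simp add: Tychonoff_space_def)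
  then have "openin (fst X) (points X - {y})" using xy by (simp add: closedin_t1_singleton openin_diff)
  then obtain \<phi> where \<phi>: "\<phi> \<in> carrier (FC X)" "\<phi> x = 0" "\<And>z. z \<in> points X \<Longrightarrow> z \<notin> points X - {y} \<Longrightarrow> \<phi> z = 1"
    using FC_separating[OF X, of "points X - {y}" x] xy by blast
  then have "\<phi> x = \<phi> y" using xy by (metis point_evaluation_apply)
  then show False using \<phi> xy by simp
qed

text \<open>A member \<open>K\<close> goes to characters below its sup-norm. Conversely, a compact
  set of characters below a continuous C*-seminorm lies below the sup-norm over some member
  \<open>K\<close>, so the corresponding points lie in \<open>K\<close>; closure under compact
  subsets puts the set of these points into the family.\<close>

lemma point_evaluation_iso:
  assumes X: "X \<in> fd_spaces"
  shows "point_evaluation X \<in> fd_iso X (Spec (FC X))"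
proof -
  interpret comm_pro_cstar_algebra "FC X" by (rule FC_pro_cstar_algebra[OF X])
  let ?\<eta> = "point_evaluation X" and ?C = "characters (FC X)"
  define g where "g = (\<lambda>\<omega>\<in>?C. inv_into (points X) ?\<eta> \<omega>)"
  have img: "?\<eta> ` points X = ?C"
    using character_FC_is_evaluation[OF X] point_evaluation_character[OF X] by blast
  have g_\<eta>: "g (?\<eta> x) = x" if "x \<in> points X" for x
    using that inv_into_f_f[OF inj_point_evaluation[OF X] that] point_evaluation_character[OF X that]
    by (simp add: g_def)
  have \<eta>_g: "?\<eta> (g \<omega>) = \<omega>" "g \<omega> \<in> points X" if "\<omega> \<in> ?C" for \<omega>
    using that f_inv_into_f[of \<omega> ?\<eta> "points X"] inv_into_into[of \<omega> ?\<eta> "points X"] img by (auto simp: g_def)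
  have "?C \<subseteq> extensional (carrier (FC X))"
    by (auto simp: characters_eq_star_characters star_characters_def)
  have cont: "continuous_map (fst X) (character_space (FC X)) ?\<eta>"
    unfolding character_space_def continuous_map_in_subtopology continuous_map_componentwise
  proof (intro conjI ballI)
    fix \<phi> assume \<phi>: "\<phi> \<in> carrier (FC X)"
    then have "continuous_map (fst X) euclidean \<phi>" by (simp add: carrier_FC)
    then show "continuous_map (fst X) euclidean (\<lambda>x. ?\<eta> x \<phi>)"
      by (rule continuous_map_eq) (simp add: point_evaluation_apply \<phi>)
  qed (use img \<open>?C \<subseteq> extensional _\<close> in auto)
  have "?\<eta> \<in> fd_hom X (Spec (FC X))"
    unfolding fd_hom_def
  proof (intro CollectI IntI conjI ballI)
    show "?\<eta> \<in> extensional (points X)" by (simp add: point_evaluation_def)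
    show "continuous_map (fst X) (fst (Spec (FC X))) ?\<eta>" using cont by (simp add: Spec_def)
    fix K assume K: "K \<in> snd X"
    have "compactin (character_space (FC X)) (?\<eta> ` K)"
      by (rule image_compactin[OF fd_spaceD(2)[OF X K] cont])
    then have "compact (?\<eta> ` K)" by (simp add: character_space_eq compactin_subtopology)
    moreover have "continuous_cstar_seminorm (FC X) (sup_norm K)"
      using K cstar_seminorm_sup_norm[OF fd_spaceD(2)[OF X K]]
      by (auto simp: cstar_family_topology.continuous_cstar_seminorm_iff[OF cstar_family_topology_FC[OF X]])
    ultimately show "?\<eta> ` K \<in> snd (Spec (FC X))"
      using point_evaluation_dominated[OF X K] unfolding Spec_family_iff by blast
  qed
  moreover have "g \<in> fd_hom (Spec (FC X)) X"
    unfolding fd_hom_def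
  proof (intro CollectI IntI conjI ballI)
    show "g \<in> extensional (points (Spec (FC X)))" by (simp add: g_def)
    have cont_g: "continuous_map (character_space (FC X)) (fst X) g"
      unfolding continuous_map_alt
    proof (intro conjI allI impI)
      show "g \<in> topspace (character_space (FC X)) \<rightarrow> points X"
        using \<eta>_g by (simp add: character_space_eq)
      fix U assume U: "openin (fst X) U"
      show "openin (character_space (FC X)) (g -` U \<inter> topspace (character_space (FC X)))"
      proof (subst openin_subopen, intro ballI)
        fix \<omega> assume "\<omega> \<in> g -` U \<inter> topspace (character_space (FC X))"
        then have \<omega>: "\<omega> \<in> ?C" "g \<omega> \<in> U" by (auto simp: character_space_eq)
        obtain \<phi> where \<phi>: "\<phi> \<in> carrier (FC X)" "\<phi> (g \<omega>) = 0" "\<And>y. y \<in> points X \<Longrightarrow> y \<notin> U \<Longrightarrow> \<phi> y = 1"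
          using FC_separating[OF X U \<omega>(2)] by blast
        \<comment> \<open>\<open>\<phi>\<close> equals 1 at the points outside \<open>U\<close>, so
          a value of modulus below 1 keeps the point \<open>g \<omega>'\<close> inside
          \<open>U\<close>.\<close>
        let ?W = "?C \<inter> (\<lambda>\<omega>. \<omega> \<phi>) -` ball 0 1"
        have "openin (character_space (FC X)) ?W"
          unfolding character_space_eq
          by (intro openin_open_Int open_coordinate_vimage) simp
        moreover have eval: "\<omega>' \<phi> = \<phi> (g \<omega>')" if "\<omega>' \<in> ?C" for \<omega>'
          using \<eta>_g[OF that] \<phi>(1) by (metis point_evaluation_apply)
        moreover have "\<omega> \<in> ?W" using \<omega> eval[OF \<omega>(1)] \<phi>(2) by simp
        moreover have "?W \<subseteq> g -` U \<inter> topspace (character_space (FC X))"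
        proof
          fix \<omega>' assume \<omega>': "\<omega>' \<in> ?W"
          then have "\<phi> (g \<omega>') \<noteq> 1" using eval[of \<omega>'] by auto
          then show "\<omega>' \<in> g -` U \<inter> topspace (character_space (FC X))"
            using \<phi>(3)[of "g \<omega>'"] \<eta>_g(2)[of \<omega>'] \<omega>' by (auto simp: character_space_eq)
        qed
        ultimately show "\<exists>T. openin (character_space (FC X)) T \<and> \<omega> \<in> T \<and>
            T \<subseteq> g -` U \<inter> topspace (character_space (FC X))" by blast
      qed
    qed
    then show "continuous_map (fst (Spec (FC X))) (fst X) g" by (simp add: Spec_def)
    fix L assume L: "L \<in> snd (Spec (FC X))"
    then obtain p where p: "continuous_cstar_seminorm (FC X) p" "L \<subseteq> dominated_characters (FC X) p"
      unfolding Spec_family_iff by blast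
    obtain K where K: "K \<in> snd X" "\<forall>\<phi>\<in>carrier (FC X). p \<phi> \<le> sup_norm K \<phi>"
      using p(1) unfolding cstar_family_topology.continuous_cstar_seminorm_iff[OF cstar_family_topology_FC[OF X]]
      by blast
    have "g \<omega> \<in> K" if "\<omega> \<in> L" for \<omega>
    proof -
      have "\<omega> \<in> dominated_characters (FC X) (sup_norm K)"
        using that p(2) K(2) by (force simp: dominated_characters_def)
      then obtain x where x: "x \<in> K" "\<omega> = ?\<eta> x" using dominated_character_is_evaluation[OF X K(1)] by blast
      then show ?thesis using g_\<eta>[of x] fd_spaces_subset_points[OF X K(1)] by auto
    qed
    moreover have "compactin (fst X) (g ` L)"
      using image_compactin[OF _ cont_g, of L] L by (simp add: Spec_def)
    ultimately show "g ` L \<in> snd X"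
      using fd_spaceD(6)[OF X K(1)] by blast
  qed
  moreover have "compose (points X) g ?\<eta> = fd_id X"
    using g_\<eta> by (auto simp: compose_def fd_id_def)
  moreover have "compose (points (Spec (FC X))) ?\<eta> g = fd_id (Spec (FC X))"
    using \<eta>_g by (auto simp: compose_def fd_id_def)
  ultimately show ?thesis unfolding fd_iso_def by blast
qed

section \<open>The duality\<close>

lemma fd_homD:
  assumes "f \<in> fd_hom X Y"
  shows "f \<in> extensional (points X)" "continuous_map (fst X) (fst Y) f"
    "K \<in> snd X \<Longrightarrow> f ` K \<in> snd Y" "x \<in> points X \<Longrightarrow> f x \<in> points Y"
  using assms continuous_map_image_subset_topspace[of "fst X" "fst Y" f] by (auto simp: fd_hom_def)

lemma pro_cstar_homD:
  assumes "h \<in> pro_cstar_hom A B"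
  shows "h \<in> extensional (carrier A)" "h \<in> ring_hom A B" "continuous_map (topo A) (topo B) h"
    "x \<in> carrier A \<Longrightarrow> h x \<in> carrier B"
    "x \<in> carrier A \<Longrightarrow> h (c \<odot>\<^bsub>A\<^esub> x) = c \<odot>\<^bsub>B\<^esub> h x"
    "x \<in> carrier A \<Longrightarrow> h (star A x) = star B (h x)"
  using assms ring_hom_closed[of h A B] by (auto simp: pro_cstar_hom_def)

section \<open>Functoriality of \<open>FC\<close>\<close>

lemma FC_map_apply:
  "\<phi> \<in> carrier (FC Y) \<Longrightarrow> x \<in> points X \<Longrightarrow> FC_map X Y f \<phi> x = \<phi> (f x)"
  by (simp add: FC_map_def compose_eq)

lemma FC_map_closed:
  assumes f: "f \<in> fd_hom X Y" and \<phi>: "\<phi> \<in> carrier (FC Y)"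
  shows "FC_map X Y f \<phi> \<in> carrier (FC X)"
proof -
  have "continuous_map (fst X) euclidean (\<lambda>x. \<phi> (f x))"
    using continuous_map_compose[OF fd_homD(2)[OF f], of euclidean \<phi>] \<phi> by (simp add: carrier_FC o_def)
  from restrict_in_FC[OF this] show ?thesis using \<phi> by (simp add: FC_map_def compose_def)
qed

text \<open>The sup-norm over \<open>K\<close> of a pulled-back function is bounded by the sup-norm
  over the image of \<open>K\<close>. That image is a member of the target family by the definition
  of morphism, which gives continuity.\<close>

lemma FC_map_hom:
  assumes X: "X \<in> fd_spaces" and Y: "Y \<in> fd_spaces" and f: "f \<in> fd_hom X Y"
  shows "FC_map X Y f \<in> pro_cstar_hom (FC Y) (FC X)"
proof (rule pro_cstar_homI[OF cstar_family_topology_FC[OF Y] cstar_family_topology_FC[OF X]])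
  note closed = FC_map_closed[OF f]
  show "FC_map X Y f \<in> extensional (carrier (FC Y))" by (simp add: FC_map_def)
  show "FC_map X Y f \<in> ring_hom (FC Y) (FC X)"
  proof (rule ring_hom_memI)
    fix \<phi> \<psi> assume \<phi>: "\<phi> \<in> carrier (FC Y)" and \<psi>: "\<psi> \<in> carrier (FC Y)"
    show "FC_map X Y f (\<phi> \<otimes>\<^bsub>FC Y\<^esub> \<psi>) = FC_map X Y f \<phi> \<otimes>\<^bsub>FC X\<^esub> FC_map X Y f \<psi>"
      by (rule FC_eqI[OF closed FC_closed(1)[OF closed closed]])
        (use \<phi> \<psi> fd_homD(4)[OF f] in \<open>simp_all add: FC_closed FC_map_apply, simp_all add: mult_FC FC_map_apply\<close>)
    show "FC_map X Y f (\<phi> \<oplus>\<^bsub>FC Y\<^esub> \<psi>) = FC_map X Y f \<phi> \<oplus>\<^bsub>FC X\<^esub> FC_map X Y f \<psi>"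
      by (rule FC_eqI[OF closed FC_closed(2)[OF closed closed]])
        (use \<phi> \<psi> fd_homD(4)[OF f] in \<open>simp_all add: FC_closed FC_map_apply, simp_all add: add_FC FC_map_apply\<close>)
  next
    show "FC_map X Y f \<one>\<^bsub>FC Y\<^esub> = \<one>\<^bsub>FC X\<^esub>"
      by (rule FC_eqI[OF closed[OF FC_one_zero_closed(1)] FC_one_zero_closed(1)])
        (use fd_homD(4)[OF f] in \<open>simp add: FC_one_zero_closed FC_map_apply, simp add: one_FC\<close>)
  qed (rule closed)
  fix \<phi> c assume \<phi>: "\<phi> \<in> carrier (FC Y)"
  show "FC_map X Y f (c \<odot>\<^bsub>FC Y\<^esub> \<phi>) = c \<odot>\<^bsub>FC X\<^esub> FC_map X Y f \<phi>"
    by (rule FC_eqI[OF closed[OF FC_closed(3)[OF \<phi>]] FC_closed(3)[OF closed[OF \<phi>]]])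
      (use \<phi> fd_homD(4)[OF f] in \<open>simp add: FC_closed FC_map_apply, simp add: smult_FC FC_map_apply\<close>)
  show "FC_map X Y f (star (FC Y) \<phi>) = star (FC X) (FC_map X Y f \<phi>)"
    by (rule FC_eqI[OF closed[OF FC_closed(4)[OF \<phi>]] FC_closed(4)[OF closed[OF \<phi>]]])
      (use \<phi> fd_homD(4)[OF f] in \<open>simp add: FC_closed FC_map_apply, simp add: star_FC FC_map_apply\<close>)
next
  fix q assume "q \<in> sup_norm ` snd X"
  then obtain K where K: "K \<in> snd X" "q = sup_norm K" by blast
  have fK: "f ` K \<in> snd Y" by (rule fd_homD(3)[OF f K(1)])
  have "sup_norm K (FC_map X Y f \<phi>) \<le> sup_norm (f ` K) \<phi>" if \<phi>: "\<phi> \<in> carrier (FC Y)" for \<phi>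
  proof (rule sup_norm_le)
    have c: "continuous_map (fst Y) euclidean \<phi>" using \<phi> by (simp add: carrier_FC)
    show "0 \<le> sup_norm (f ` K) \<phi>" by (rule sup_norm_nonneg[OF fd_spaceD(2)[OF Y fK] c])
    show "cmod (FC_map X Y f \<phi> x) \<le> sup_norm (f ` K) \<phi>" if "x \<in> K" for x
      using le_sup_norm[OF fd_spaceD(2)[OF Y fK] c, of "f x"] that \<phi> fd_spaces_subset_points[OF X K(1)]
      by (auto simp: FC_map_apply)
  qed
  then show "\<exists>p\<in>sup_norm ` snd Y. \<forall>\<phi>\<in>carrier (FC Y). q (FC_map X Y f \<phi>) \<le> p \<phi>"
    using fK K(2) by blast
qed

lemma FC_map_id: "FC_map X X (fd_id X) = pro_cstar_id (FC X)"
proof (rule extensionalityI)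
  fix \<phi> assume \<phi>: "\<phi> \<in> carrier (FC X)"
  then have "\<phi> \<in> extensional (points X)" by (simp add: carrier_FC)
  then show "FC_map X X (fd_id X) \<phi> = pro_cstar_id (FC X) \<phi>"
    using \<phi> by (auto simp: FC_map_def pro_cstar_id_def fd_id_def compose_def extensional_def)
qed (auto simp: FC_map_def pro_cstar_id_def)

lemma FC_map_compose:
  assumes f: "f \<in> fd_hom X Y" and g: "g \<in> fd_hom Y Z"
  shows "FC_map X Z (compose (points X) g f) =
    compose (carrier (FC Z)) (FC_map X Y f) (FC_map Y Z g)"
proof (rule extensionalityI)
  fix \<phi> assume \<phi>: "\<phi> \<in> carrier (FC Z)"
  have "FC_map X Z (compose (points X) g f) \<phi> = FC_map X Y f (FC_map Y Z g \<phi>)"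
  proof (rule extensionalityI)
    show "FC_map X Z (compose (points X) g f) \<phi> \<in> extensional (points X)"
      using \<phi> by (simp add: FC_map_def)
    show "FC_map X Y f (FC_map Y Z g \<phi>) \<in> extensional (points X)"
      using FC_map_closed[OF f FC_map_closed[OF g \<phi>]] by (simp add: carrier_FC)
    show "FC_map X Z (compose (points X) g f) \<phi> x = FC_map X Y f (FC_map Y Z g \<phi>) x" if "x \<in> points X" for x
      using that \<phi> FC_map_closed[OF g \<phi>] fd_homD(4)[OF f] by (simp add: FC_map_apply compose_eq)
  qed
  then show "FC_map X Z (compose (points X) g f) \<phi> = compose (carrier (FC Z)) (FC_map X Y f) (FC_map Y Z g) \<phi>"
    using \<phi> by (simp add: compose_eq)
qed (auto simp: FC_map_def)

section \<open>Functoriality of the spectrum\<close>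

lemma Spec_map_apply:
  "\<omega> \<in> characters B \<Longrightarrow> a \<in> carrier A \<Longrightarrow> Spec_map A B h \<omega> a = \<omega> (h a)"
  by (simp add: Spec_map_def compose_eq)

lemma Spec_map_closed:
  assumes "A \<in> pro_cstar_algebras" "h \<in> pro_cstar_hom A B" "\<omega> \<in> characters B"
  shows "Spec_map A B h \<omega> \<in> characters A"
  using pro_cstar_compose_in_hom[OF assms(1,2), of \<omega> complex_star_algebra] assms(3)
  by (simp add: characters_def Spec_map_def)

text \<open>If \<open>p\<close> dominates a set of characters of \<open>B\<close>, its pullback
  along \<open>h\<close> is a continuous C*-seminorm on \<open>A\<close> that dominates the image
  set.\<close>

lemma Spec_map_hom:
  assumes A: "A \<in> pro_cstar_algebras" and B: "B \<in> pro_cstar_algebras" and h: "h \<in> pro_cstar_hom A B"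
  shows "Spec_map A B h \<in> fd_hom (Spec B) (Spec A)"
proof -
  interpret A: comm_pro_cstar_algebra A using A by (simp add: pro_cstar_algebras_def)
  interpret B: comm_pro_cstar_algebra B using B by (simp add: pro_cstar_algebras_def)
  have cont: "continuous_map (character_space B) (character_space A) (Spec_map A B h)"
    unfolding character_space_def[of A] continuous_map_in_subtopology continuous_map_componentwise
  proof (intro conjI ballI)
    fix a assume a: "a \<in> carrier A"
    have "continuous_map (character_space B) euclidean (\<lambda>\<omega>. \<omega> (h a))"
      by (simp add: character_space_eq continuous_on_evaluation)
    then show "continuous_map (character_space B) euclidean (\<lambda>\<omega>. Spec_map A B h \<omega> a)"
      by (rule continuous_map_eq) (simp add: character_space_eq Spec_map_apply a)
  qed (use Spec_map_closed[OF A h] in \<open>auto simp: character_space_eq Spec_map_def\<close>)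
  show ?thesis
    unfolding fd_hom_def
  proof (intro CollectI IntI conjI ballI)
    show "Spec_map A B h \<in> extensional (points (Spec B))" by (simp add: Spec_map_def)
    show "continuous_map (fst (Spec B)) (fst (Spec A)) (Spec_map A B h)" using cont by (simp add: Spec_def)
    fix K assume "K \<in> snd (Spec B)"
    then obtain p where K: "compactin (character_space B) K" "continuous_cstar_seminorm B p"
        "\<And>\<omega> b. \<omega> \<in> K \<Longrightarrow> b \<in> carrier B \<Longrightarrow> cmod (\<omega> b) \<le> p b"
      by (auto simp: Spec_def)
    have KB: "K \<subseteq> characters B"
      using compactin_subset_topspace[OF K(1)] by (simp add: character_space_eq)
    have "cstar_seminorm A (\<lambda>a. p (h a))"
      using K(2) pro_cstar_homD[OF h] ring_hom_add[OF pro_cstar_homD(2)[OF h]]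
        ring_hom_mult[OF pro_cstar_homD(2)[OF h]]
      by (simp add: continuous_cstar_seminorm_def cstar_seminorm_def)
    moreover have "continuous_map (topo A) euclideanreal (\<lambda>a. p (h a))"
      using continuous_map_compose[OF pro_cstar_homD(3)[OF h], of euclideanreal p] K(2)
      by (simp add: continuous_cstar_seminorm_def o_def)
    ultimately have "continuous_cstar_seminorm A (\<lambda>a. p (h a))"
      by (simp add: continuous_cstar_seminorm_def)
    moreover have "\<forall>\<omega>\<in>Spec_map A B h ` K. \<forall>a\<in>carrier A. cmod (\<omega> a) \<le> p (h a)"
      using K(3) KB pro_cstar_homD(4)[OF h] by (auto simp: Spec_map_apply subset_iff)
    ultimately show "Spec_map A B h ` K \<in> snd (Spec A)"
      using image_compactin[OF K(1) cont] by (auto simp: Spec_def)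
  qed
qed

lemma Spec_map_id: "Spec_map A A (pro_cstar_id A) = fd_id (Spec A)"
proof (rule extensionalityI)
  fix \<omega> assume \<omega>: "\<omega> \<in> characters A"
  then have "\<omega> \<in> extensional (carrier A)" by (simp add: characters_def pro_cstar_hom_def)
  then show "Spec_map A A (pro_cstar_id A) \<omega> = fd_id (Spec A) \<omega>"
    using \<omega> by (auto simp: Spec_map_def pro_cstar_id_def fd_id_def compose_def extensional_def)
qed (auto simp: Spec_map_def fd_id_def)

lemma Spec_map_compose:
  assumes B: "B \<in> pro_cstar_algebras" and h: "h \<in> pro_cstar_hom A B" and k: "k \<in> pro_cstar_hom B C"
  shows "Spec_map A C (compose (carrier A) k h) =
    compose (points (Spec C)) (Spec_map A B h) (Spec_map B C k)"
proof (rule extensionalityI)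
  fix \<omega> assume \<omega>: "\<omega> \<in> characters C"
  have k\<omega>: "Spec_map B C k \<omega> \<in> characters B" by (rule Spec_map_closed[OF B k \<omega>])
  have "Spec_map A C (compose (carrier A) k h) \<omega> = Spec_map A B h (Spec_map B C k \<omega>)"
  proof (rule extensionalityI)
    show "Spec_map A C (compose (carrier A) k h) \<omega> a = Spec_map A B h (Spec_map B C k \<omega>) a"
      if "a \<in> carrier A" for a
      using that \<omega> k\<omega> pro_cstar_homD(4)[OF h that] by (simp add: Spec_map_apply compose_eq)
    show "Spec_map A C (compose (carrier A) k h) \<omega> \<in> extensional (carrier A)"
      using \<omega> by (simp add: Spec_map_def)
    show "Spec_map A B h (Spec_map B C k \<omega>) \<in> extensional (carrier A)"
      using k\<omega> by (simp add: Spec_map_def[of A B])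
  qed
  then show "Spec_map A C (compose (carrier A) k h) \<omega> =
      compose (points (Spec C)) (Spec_map A B h) (Spec_map B C k) \<omega>"
    using \<omega> by (simp add: compose_eq)
qed (auto simp: Spec_map_def)

section \<open>Naturality of point evaluation and full faithfulness\<close>

lemma FC_in_pro_cstar_algebras: "X \<in> fd_spaces \<Longrightarrow> FC X \<in> pro_cstar_algebras"
  by (simp add: pro_cstar_algebras_def FC_pro_cstar_algebra)

lemma Spec_in_fd_spaces: "A \<in> pro_cstar_algebras \<Longrightarrow> Spec A \<in> fd_spaces"
  by (simp add: pro_cstar_algebras_def comm_pro_cstar_algebra.Spec_fd_space)

lemma point_evaluation_natural:
  assumes X: "X \<in> fd_spaces" and Y: "Y \<in> fd_spaces" and f: "f \<in> fd_hom X Y"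
  shows "compose (points X) (point_evaluation Y) f =
    compose (points X) (Spec_map (FC Y) (FC X) (FC_map X Y f)) (point_evaluation X)"
proof (rule extensionalityI)
  fix x assume x: "x \<in> points X"
  have "point_evaluation Y (f x) = Spec_map (FC Y) (FC X) (FC_map X Y f) (point_evaluation X x)"
  proof (rule extensionalityI)
    show "point_evaluation Y (f x) \<in> extensional (carrier (FC Y))"
      using fd_homD(4)[OF f x] by (simp add: point_evaluation_def)
    show "Spec_map (FC Y) (FC X) (FC_map X Y f) (point_evaluation X x) \<in> extensional (carrier (FC Y))"
      using point_evaluation_character[OF X x] by (simp add: Spec_map_def)
    show "point_evaluation Y (f x) \<phi> = Spec_map (FC Y) (FC X) (FC_map X Y f) (point_evaluation X x) \<phi>"
      if "\<phi> \<in> carrier (FC Y)" for \<phi>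
      using that x fd_homD(4)[OF f x] point_evaluation_character[OF X x] FC_map_closed[OF f that]
      by (simp add: Spec_map_apply point_evaluation_apply FC_map_apply)
  qed
  then show "compose (points X) (point_evaluation Y) f x =
      compose (points X) (Spec_map (FC Y) (FC X) (FC_map X Y f)) (point_evaluation X) x"
    using x by (simp add: compose_eq)
qed auto

text \<open>Faithfulness: evaluations separate points. Fullness: \<open>h\<close> is carried to a
  map of spectra and conjugated by the point evaluations; the resulting \<open>f\<close> satisfies
  \<open>\<phi> (f x) = h \<phi> x\<close>.\<close>

lemma FC_map_bij:
  assumes X: "X \<in> fd_spaces" and Y: "Y \<in> fd_spaces"
  shows "bij_betw (FC_map X Y) (fd_hom X Y) (pro_cstar_hom (FC Y) (FC X))"
  unfolding bij_betw_def
proof (intro conjI equalityI subsetI inj_onI)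
  fix f g assume f: "f \<in> fd_hom X Y" and g: "g \<in> fd_hom X Y" and eq: "FC_map X Y f = FC_map X Y g"
  show "f = g"
  proof (rule extensionalityI[OF fd_homD(1)[OF f] fd_homD(1)[OF g]])
    fix x assume x: "x \<in> points X"
    note fg = fd_homD(4)[OF f x] fd_homD(4)[OF g x]
    have "point_evaluation Y (f x) = point_evaluation Y (g x)"
    proof (rule extensionalityI)
      show "point_evaluation Y (f x) \<phi> = point_evaluation Y (g x) \<phi>" if "\<phi> \<in> carrier (FC Y)" for \<phi>
        using that x fg fun_cong[OF fun_cong[OF eq], of \<phi> x]
        by (simp add: point_evaluation_apply FC_map_apply)
    qed (use fg in \<open>simp_all add: point_evaluation_def\<close>)
    then show "f x = g x" using inj_point_evaluation[OF Y] fg by (simp add: inj_on_eq_iff)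
  qed
next
  fix h assume "h \<in> FC_map X Y ` fd_hom X Y"
  then show "h \<in> pro_cstar_hom (FC Y) (FC X)" using FC_map_hom[OF X Y] by blast
next
  fix h assume h: "h \<in> pro_cstar_hom (FC Y) (FC X)"
  let ?\<sigma> = "Spec_map (FC Y) (FC X) h"
  have \<sigma>: "?\<sigma> \<in> fd_hom (Spec (FC X)) (Spec (FC Y))"
    by (rule Spec_map_hom[OF FC_in_pro_cstar_algebras[OF Y] FC_in_pro_cstar_algebras[OF X] h])
  have \<eta>: "point_evaluation X \<in> fd_hom X (Spec (FC X))"
    using point_evaluation_iso[OF X] by (simp add: fd_iso_def)
  obtain g where g: "g \<in> fd_hom (Spec (FC Y)) Y"
    "compose (characters (FC Y)) (point_evaluation Y) g = fd_id (Spec (FC Y))"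
    using point_evaluation_iso[OF Y] by (auto simp: fd_iso_def)
  define f where "f = compose (points X) g (compose (points X) ?\<sigma> (point_evaluation X))"
  have f: "f \<in> fd_hom X Y"
    unfolding f_def by (rule fd_compose_in_hom[OF X fd_compose_in_hom[OF X \<eta> \<sigma>] g(1)])
  have eval: "\<phi> (f x) = h \<phi> x" if x: "x \<in> points X" and \<phi>: "\<phi> \<in> carrier (FC Y)" for x \<phi>
  proof -
    have ev: "point_evaluation X x \<in> characters (FC X)" by (rule point_evaluation_character[OF X x])
    then have \<sigma>x: "?\<sigma> (point_evaluation X x) \<in> characters (FC Y)" using fd_homD(4)[OF \<sigma>] by simp
    have "\<phi> (f x) = point_evaluation Y (f x) \<phi>"
      using fd_homD(4)[OF f x] \<phi> by (simp add: point_evaluation_apply)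
    also have "point_evaluation Y (f x) = ?\<sigma> (point_evaluation X x)"
      using fun_cong[OF g(2), of "?\<sigma> (point_evaluation X x)"] \<sigma>x x
      by (simp add: f_def compose_eq fd_id_def)
    also have "\<dots> \<phi> = h \<phi> x"
      using ev \<phi> x pro_cstar_homD(4)[OF h \<phi>] by (simp add: Spec_map_apply point_evaluation_apply)
    finally show ?thesis .
  qed
  have "FC_map X Y f = h"
  proof (rule extensionalityI)
    show "h \<in> extensional (carrier (FC Y))" by (rule pro_cstar_homD(1)[OF h])
    show "FC_map X Y f \<in> extensional (carrier (FC Y))" by (simp add: FC_map_def)
    show "FC_map X Y f \<phi> = h \<phi>" if \<phi>: "\<phi> \<in> carrier (FC Y)" for \<phi>
      by (rule FC_eqI[OF FC_map_closed[OF f \<phi>] pro_cstar_homD(4)[OF h \<phi>]])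
        (simp add: FC_map_apply \<phi> eval)
  qed
  then show "h \<in> FC_map X Y ` fd_hom X Y" using f by blast
qed

section \<open>The Gelfand transform\<close>

lemma Gelfand_transform_apply:
  "a \<in> carrier A \<Longrightarrow> \<omega> \<in> characters A \<Longrightarrow> Gelfand_transform A a \<omega> = \<omega> a"
  by (simp add: Gelfand_transform_def)

lemma Gelfand_transform_closed:
  "a \<in> carrier A \<Longrightarrow> Gelfand_transform A a \<in> carrier (FC (Spec A))"
  using restrict_in_FC[of "Spec A" "\<lambda>\<omega>. \<omega> a"]
  by (simp add: Gelfand_transform_def Spec_def character_space_eq continuous_on_evaluation)

text \<open>The inverse of a bijective homomorphism respects the algebraic structure by injectivity;
  the reverse seminorm bound makes it continuous.\<close>

lemma pro_cstar_isoI: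
  assumes A: "cstar_family_topology A P" and B: "cstar_family_topology B Q"
    and h: "h \<in> pro_cstar_hom A B" and bij: "bij_betw h (carrier A) (carrier B)"
    and bound: "\<And>p. p \<in> P \<Longrightarrow> \<exists>q\<in>Q. \<forall>x\<in>carrier A. p x \<le> q (h x)"
  shows "h \<in> pro_cstar_iso A B"
proof -
  interpret A: cstar_family_topology A P by (rule A)
  interpret B: cstar_family_topology B Q by (rule B)
  note hD = pro_cstar_homD[OF h]
  define k where "k = (\<lambda>y\<in>carrier B. inv_into (carrier A) h y)"
  have k: "k y \<in> carrier A" "h (k y) = y" if "y \<in> carrier B" for y
    using that bij_betw_inv_into_right[OF bij that] bij_betw_imp_surj_on[OF bij]
      inv_into_into[of y h "carrier A"] by (auto simp: k_def)
  have k_eqI: "k y = x" if "x \<in> carrier A" "h x = y" for x y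
    using that bij_betw_inv_into_left[OF bij that(1)] hD(4)[OF that(1)] by (simp add: k_def)
  have "k \<in> pro_cstar_hom B A"
  proof (rule pro_cstar_homI[OF B A])
    show "k \<in> ring_hom B A"
      by (rule ring_hom_memI)
        (auto intro!: k_eqI simp: k ring_hom_add[OF hD(2)] ring_hom_mult[OF hD(2)] ring_hom_one[OF hD(2)])
    show "k (c \<odot>\<^bsub>B\<^esub> y) = c \<odot>\<^bsub>A\<^esub> k y" "k (star B y) = star A (k y)" if "y \<in> carrier B" for c y
      using that by (auto intro!: k_eqI simp: k hD)
    show "\<exists>q\<in>Q. \<forall>y\<in>carrier B. p (k y) \<le> q y" if "p \<in> P" for p
      using bound[OF that] k by metis
  qed (simp add: k_def)
  moreover have "compose (carrier A) k h = pro_cstar_id A"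
    using k_eqI by (auto simp: compose_def pro_cstar_id_def)
  moreover have "compose (carrier B) h k = pro_cstar_id B"
    using k by (auto simp: compose_def pro_cstar_id_def)
  ultimately show ?thesis using h unfolding pro_cstar_iso_def by blast
qed

text \<open>The two bounds combine to an isometry: \<open>p a\<close> is the sup-norm of the
  transform of \<open>a\<close> over \<open>dominated_characters A p\<close>. Injectivity comes from
  the Hausdorff property and norming characters, surjectivity from
  \<open>represent_locally_continuous\<close> and hence from completeness.\<close>

lemma Gelfand_transform_iso:
  assumes A: "A \<in> pro_cstar_algebras"
  shows "Gelfand_transform A \<in> pro_cstar_iso A (FC (Spec A))"
proof -
  interpret comm_pro_cstar_algebra A using A by (simp add: pro_cstar_algebras_def)
  let ?\<Gamma> = "Gelfand_transform A" and ?P = "Collect (continuous_cstar_seminorm A)"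
  have Afam: "cstar_family_topology A ?P" by unfold_locales
  note FCfam = cstar_family_topology_FC[OF Spec_fd_space]
  have star_char: "\<omega> \<in> star_characters A" if "\<omega> \<in> characters A" for \<omega>
    using that by (simp add: characters_eq_star_characters)
  have hom: "?\<Gamma> \<in> pro_cstar_hom A (FC (Spec A))"
  proof (rule pro_cstar_homI[OF Afam FCfam])
    show "?\<Gamma> \<in> extensional (carrier A)" by (simp add: Gelfand_transform_def)
    show "?\<Gamma> \<in> ring_hom A (FC (Spec A))"
      by (rule ring_hom_memI)
        (auto simp: Gelfand_transform_closed, auto simp: Gelfand_transform_def mult_FC add_FC one_FC
          star_characterD[OF star_char] intro!: restrict_ext)
    show "?\<Gamma> (c \<odot>\<^bsub>A\<^esub> a) = c \<odot>\<^bsub>FC (Spec A)\<^esub> ?\<Gamma> a" "?\<Gamma> (star A a) = star (FC (Spec A)) (?\<Gamma> a)"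
      if "a \<in> carrier A" for c a
      using that by (auto simp: Gelfand_transform_def smult_FC star_FC star_characterD[OF star_char]
          intro!: restrict_ext)
    fix q assume "q \<in> sup_norm ` snd (Spec A)"
    then obtain K where K: "K \<in> snd (Spec A)" "q = sup_norm K" by blast
    obtain p where p: "continuous_cstar_seminorm A p" "K \<subseteq> dominated_characters A p"
      using K(1) unfolding Spec_family_iff by blast
    have "sup_norm K (?\<Gamma> a) \<le> p a" if a: "a \<in> carrier A" for a
    proof (rule sup_norm_le)
      show "0 \<le> p a" using p(1) a by (simp add: continuous_cstar_seminorm_def cstar_seminorm_def)
      show "cmod (?\<Gamma> a \<omega>) \<le> p a" if "\<omega> \<in> K" for \<omega>
      proof -
        have "\<omega> \<in> dominated_characters A p" using p(2) that by blast
        then show ?thesis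
          using dominated_characters_subset[OF p(1)] a
          by (auto simp: Gelfand_transform_apply dominated_characters_def)
      qed
    qed
    then show "\<exists>p\<in>?P. \<forall>a\<in>carrier A. q (?\<Gamma> a) \<le> p a" using p(1) K(2) by blast
  qed
  have inj: "inj_on ?\<Gamma> (carrier A)"
  proof (rule inj_onI, rule ccontr)
    fix a b assume ab: "a \<in> carrier A" "b \<in> carrier A" "?\<Gamma> a = ?\<Gamma> b" "a \<noteq> b"
    then have "a \<ominus>\<^bsub>A\<^esub> b \<noteq> \<zero>\<^bsub>A\<^esub>" using diff_eq_zeroD by blast
    then obtain p where p: "continuous_cstar_seminorm A p" "0 < p (a \<ominus>\<^bsub>A\<^esub> b)"
      using separating_seminorm[of "a \<ominus>\<^bsub>A\<^esub> b"] ab by auto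
    interpret p: cstar_seminormed A p using p(1) by unfold_locales (simp add: continuous_cstar_seminorm_def)
    obtain \<omega> where \<omega>: "\<omega> \<in> dominated_characters A p" "cmod (\<omega> (a \<ominus>\<^bsub>A\<^esub> b)) = p (a \<ominus>\<^bsub>A\<^esub> b)"
      using p.norming_character[of "a \<ominus>\<^bsub>A\<^esub> b"] p(2) ab by auto
    have \<omega>c: "\<omega> \<in> characters A" using \<omega>(1) dominated_characters_subset[OF p(1)] by blast
    then have "\<omega> a = \<omega> b" using ab by (metis Gelfand_transform_apply)
    then show False using \<omega>(2) p(2) ab star_character_diff[OF star_char[OF \<omega>c]] by simp
  qed
  have surj: "?\<Gamma> ` carrier A = carrier (FC (Spec A))"
  proof (intro equalityI subsetI)
    fix f assume f: "f \<in> carrier (FC (Spec A))"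
    then have "continuous_on (characters A) f" by (simp add: carrier_FC Spec_def character_space_eq)
    then have "continuous_on (dominated_characters A p) f" if "continuous_cstar_seminorm A p" for p
      using dominated_characters_subset[OF that] continuous_on_subset by blast
    then obtain a where a: "a \<in> carrier A" "\<And>\<omega>. \<omega> \<in> characters A \<Longrightarrow> \<omega> a = f \<omega>"
      using represent_locally_continuous by blast
    have "?\<Gamma> a = f"
      by (rule FC_eqI[OF Gelfand_transform_closed[OF a(1)] f]) (simp add: Gelfand_transform_apply a)
    then show "f \<in> ?\<Gamma> ` carrier A" using a(1) by blast
  qed (auto intro: Gelfand_transform_closed)
  show ?thesis
  proof (rule pro_cstar_isoI[OF Afam FCfam hom])
    show "bij_betw ?\<Gamma> (carrier A) (carrier (FC (Spec A)))" using inj surj by (simp add: bij_betw_def)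
    fix p assume "p \<in> ?P"
    then have p: "continuous_cstar_seminorm A p" by simp
    interpret p: cstar_seminormed A p using p by unfold_locales (simp add: continuous_cstar_seminorm_def)
    let ?K = "dominated_characters A p"
    have K: "?K \<in> snd (Spec A)" using p compact_dominated_characters unfolding Spec_family_iff by blast
    have "p a \<le> sup_norm ?K (?\<Gamma> a)" if a: "a \<in> carrier A" for a
    proof (rule p.le_if_dominated_characters_le[OF a])
      have c: "continuous_map (fst (Spec A)) euclidean (?\<Gamma> a)"
        using Gelfand_transform_closed[OF a] by (simp add: carrier_FC)
      note cK = fd_spaceD(2)[OF Spec_fd_space K]
      show "0 \<le> sup_norm ?K (?\<Gamma> a)" by (rule sup_norm_nonneg[OF cK c])
      show "cmod (\<omega> a) \<le> sup_norm ?K (?\<Gamma> a)" if "\<omega> \<in> ?K" for \<omega>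
      proof -
        have "\<omega> \<in> characters A" using that dominated_characters_subset[OF p] by blast
        then show ?thesis using le_sup_norm[OF cK c that] a by (simp add: Gelfand_transform_apply)
      qed
    qed
    then show "\<exists>q\<in>sup_norm ` snd (Spec A). \<forall>a\<in>carrier A. p a \<le> q (?\<Gamma> a)" using K by blast
  qed
qed

lemma Gelfand_transform_natural:
  assumes A: "A \<in> pro_cstar_algebras" and h: "h \<in> pro_cstar_hom A B"
  shows "compose (carrier A) (Gelfand_transform B) h =
    compose (carrier A) (FC_map (Spec B) (Spec A) (Spec_map A B h)) (Gelfand_transform A)"
proof (rule extensionalityI)
  fix a assume a: "a \<in> carrier A"
  have ha: "h a \<in> carrier B" by (rule pro_cstar_homD(4)[OF h a])
  note \<Gamma>a = Gelfand_transform_closed[OF a]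
  have "Gelfand_transform B (h a) = FC_map (Spec B) (Spec A) (Spec_map A B h) (Gelfand_transform A a)"
  proof (rule extensionalityI)
    show "Gelfand_transform B (h a) \<in> extensional (characters B)"
      using ha by (simp add: Gelfand_transform_def)
    show "FC_map (Spec B) (Spec A) (Spec_map A B h) (Gelfand_transform A a) \<in> extensional (characters B)"
      using \<Gamma>a by (simp add: FC_map_def)
    show "Gelfand_transform B (h a) \<omega> =
        FC_map (Spec B) (Spec A) (Spec_map A B h) (Gelfand_transform A a) \<omega>"
      if "\<omega> \<in> characters B" for \<omega>
      using that a ha \<Gamma>a Spec_map_closed[OF A h that]
      by (simp add: FC_map_apply Gelfand_transform_apply Spec_map_apply)
  qed
  then show "compose (carrier A) (Gelfand_transform B) h a =
      compose (carrier A) (FC_map (Spec B) (Spec A) (Spec_map A B h)) (Gelfand_transform A) a"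
    using a by (simp add: compose_eq)
qed auto

theorem corollary3p19:
  shows
    "\<comment> \<open>a contravariant functor\<close>
     (\<forall>X \<in> fd_spaces :: 'a fd_space set. FC X \<in> pro_cstar_algebras) \<and>
     (\<forall>X \<in> fd_spaces :: 'a fd_space set. \<forall>Y \<in> fd_spaces :: 'b fd_space set. \<forall>f \<in> fd_hom X Y.
        FC_map X Y f \<in> pro_cstar_hom (FC Y) (FC X)) \<and>
     (\<forall>X \<in> fd_spaces :: 'a fd_space set. FC_map X X (fd_id X) = pro_cstar_id (FC X)) \<and>
     (\<forall>X \<in> fd_spaces :: 'a fd_space set. \<forall>Y \<in> fd_spaces :: 'b fd_space set.
      \<forall>Z \<in> fd_spaces :: 'c fd_space set. \<forall>f \<in> fd_hom X Y. \<forall>g \<in> fd_hom Y Z.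
        FC_map X Z (compose (points X) g f) =
        compose (carrier (FC Z)) (FC_map X Y f) (FC_map Y Z g)) \<and>
     \<comment> \<open>fully faithful and essentially surjective\<close>
     (\<forall>X \<in> fd_spaces :: 'a fd_space set. \<forall>Y \<in> fd_spaces :: 'b fd_space set.
        bij_betw (FC_map X Y) (fd_hom X Y) (pro_cstar_hom (FC Y) (FC X))) \<and>
     (\<forall>A \<in> pro_cstar_algebras :: 'd star_algebra set.
        \<exists>X \<in> fd_spaces :: ('d \<Rightarrow> complex) fd_space set. pro_cstar_iso A (FC X) \<noteq> {}) \<and>
     \<comment> \<open>a contravariant functor in the opposite direction\<close>
     (\<forall>A \<in> pro_cstar_algebras :: 'd star_algebra set. Spec A \<in> fd_spaces) \<and>
     (\<forall>A \<in> pro_cstar_algebras :: 'd star_algebra set.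
      \<forall>B \<in> pro_cstar_algebras :: 'e star_algebra set. \<forall>h \<in> pro_cstar_hom A B.
        Spec_map A B h \<in> fd_hom (Spec B) (Spec A)) \<and>
     (\<forall>A \<in> pro_cstar_algebras :: 'd star_algebra set.
        Spec_map A A (pro_cstar_id A) = fd_id (Spec A)) \<and>
     (\<forall>A \<in> pro_cstar_algebras :: 'd star_algebra set.
      \<forall>B \<in> pro_cstar_algebras :: 'e star_algebra set.
      \<forall>C \<in> pro_cstar_algebras :: 'f star_algebra set.
      \<forall>h \<in> pro_cstar_hom A B. \<forall>k \<in> pro_cstar_hom B C.
        Spec_map A C (compose (carrier A) k h) =
        compose (points (Spec C)) (Spec_map A B h) (Spec_map B C k)) \<and>
     \<comment> \<open>natural isomorphisms from the identities to the two composites\<close>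
     (\<forall>X \<in> fd_spaces :: 'a fd_space set. point_evaluation X \<in> fd_iso X (Spec (FC X))) \<and>
     (\<forall>X \<in> fd_spaces :: 'a fd_space set. \<forall>Y \<in> fd_spaces :: 'b fd_space set. \<forall>f \<in> fd_hom X Y.
        compose (points X) (point_evaluation Y) f =
        compose (points X) (Spec_map (FC Y) (FC X) (FC_map X Y f)) (point_evaluation X)) \<and>
     (\<forall>A \<in> pro_cstar_algebras :: 'd star_algebra set.
        Gelfand_transform A \<in> pro_cstar_iso A (FC (Spec A))) \<and>
     (\<forall>A \<in> pro_cstar_algebras :: 'd star_algebra set.
      \<forall>B \<in> pro_cstar_algebras :: 'e star_algebra set. \<forall>h \<in> pro_cstar_hom A B.
        compose (carrier A) (Gelfand_transform B) h =
        compose (carrier A) (FC_map (Spec B) (Spec A) (Spec_map A B h)) (Gelfand_transform A))"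
proof (intro conjI ballI; (rule FC_in_pro_cstar_algebras FC_map_hom FC_map_id FC_map_compose FC_map_bij
      Spec_in_fd_spaces Spec_map_hom Spec_map_id Spec_map_compose point_evaluation_iso
      point_evaluation_natural Gelfand_transform_iso Gelfand_transform_natural; assumption)?)
  \<comment> \<open>What remains is essential surjectivity, with the spectrum as witness; this is
    why the space lives on the type of functions from \<open>'d\<close> to
    \<open>complex\<close>.\<close>
  fix A :: "'d star_algebra" assume "A \<in> pro_cstar_algebras"
  then show "\<exists>X\<in>fd_spaces :: ('d \<Rightarrow> complex) fd_space set. pro_cstar_iso A (FC X) \<noteq> {}"
    using Spec_in_fd_spaces Gelfand_transform_iso by blast
qed

end
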